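(* Consider, for $i\in\{1,\dots,n\}$, the distributed observer $$\dot P_i=\tfrac12 P_i\circ v_i-\lambda_1\,\mathrm{sgn}^{\beta_1}\Big(\sum_{j=0}^{n}a_{ij}(P_i-P_j)\Big),\qquad \dot v_i=z_i-\lambda_2\,\mathrm{sgn}^{\beta_2}\Big(\sum_{j=0}^{n}a_{ij}(v_i-v_j)\Big),$$ $$\dot z_i=-\lambda_3\,\mathrm{sgn}\Big(a_{i0}(z_i-w_i)+\sum_{j=1}^{n}a_{ij}(z_i-z_j)\Big),$$ $$\dot y_i=-\mu_1a_{i0}\,\mathrm{sgn}^{1/2}(y_i-\omega_0)+w_i,\qquad \dot w_i=-\mu_2a_{i0}\,\mathrm{sgn}(y_i-\omega_0),\qquad y_i(0)=w_i(0)=0,$$ where $(P_0,v_0,z_0)=(Q_0,\omega_0,\dot\omega_0)$ is the leader's trajectory, $(P_i(0),v_i(0),z_i(0))\in\mathbb R^4\times\mathbb R^3\times\mathbb R^3$ is arbitrary, $\lambda_1,\lambda_2,\mu_1>0$, $0<\beta_1,\beta_2<1$, and $\lambda_3,\mu_2>\gamma_3$. Assume: (1) the communication among the $n$ followers is constant and bidirectional, and the leader-following graph $\bar{\mathcal G}$ contains a spanning tree rooted at node $0$ (there is a path from the leader to any follower); (2) $\omega_0(t)$ and its first two derivatives are continuous in time and there are constants $\gamma_1,\gamma_2,\gamma_3$ with $\|\omega_0(t)\|_\infty\le\gamma_1$, $\|\dot\omega_0(t)\|_\infty\le\gamma_2$, $\|\ddot\omega_0(t)\|_\infty\le\gamma_3$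 for all $t\geq 0$. Then the state estimates are all uniformly bounded on $[0,\infty)$, and there is a finite time $T_p\ge 0$ such that $$(P_i(t),v_i(t),z_i(t))=(Q_0(t),\omega_0(t),\dot\omega_0(t))\quad\text{for all } t\ge T_p,\ i\in\{1,\dots,n\},$$ where $T_p$ satisfies $$T_p\le T_v+\frac{2\left[c_{p2}e^{c_{p0}T_v}-c_{p1}/c_{p0}\right]^{\frac{1-\beta_1}{2}}}{c_p(1-\beta_1)},$$ with the time $T_v$ and the constants $c_{p0},c_{p1},c_{p2},c_p$ as specified in the context.
   Context: Notation. For $x\in\mathbb R$, $\alpha\ge0$: $\mathrm{sgn}^\alpha(x)=\mathrm{sgn}(x)|x|^\alpha$, where $\mathrm{sgn}$ is the standard sign function; for vectors these act componentwise. A quaternion is $Q=[\eta,q^T]^T\in\mathbb R^4$ with $\eta\in\mathbb R$, $q\in\mathbb R^3$; multiplication is $Q\circ Q'=[\eta\eta'-q^Tq',\ (\eta q'+\eta'q+q\times q')^T]^T$. A vector in $\mathbb R^3$ is treated as a quaternion with zero scalar part when operating with quaternions. $\mathbb S^3$ is the set of unit quaternions. $\otimes$ is the Kronecker product. $\bar\sigma(\cdot),\underline\sigma(\cdot)$ are the maximum and minimum singular values. Leader. $Q_0(t)\in\mathbb S^3$, $\omega_0(t)\in\mathbb R^3$, $\dot Q_0=\frac12Q_0\circ\omega_0$. Graph. The followers $1,\dots,n$ communicate over a weighted undirected graph with adjacency matrix $A=[a_{ij}]$, $a_{ij}=a_{ji}\ge0$, $a_{ij}>0$ iff $i$ and $j$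 are connected by an edge, $a_{ii}=0$. Its Laplacian is $L=[l_{ij}]$, $l_{ii}=\sum_{j=1}^n a_{ij}$, $l_{ij}=-a_{ij}$ for $i\ne j$. The leader is node $0$; $a_{i0}=1$ if follower $i$ connects to the leader and $a_{i0}=0$ otherwise; $A_0=\mathrm{diag}\{a_{10},\dots,a_{n0}\}$; $H=L+A_0$. $\bar{\mathcal G}$ is the graph on $\{0,1,\dots,n\}$ formed by these connections. Solutions of the (discontinuous) observer equations are understood in the Filippov sense. Constants in the estimate of $T_p$. Let $\tilde P_i=P_i-P_0$, $\tilde v_i=v_i-v_0$, $\tilde z_i=z_i-z_0$, and let $\tilde P,\tilde v,\tilde z$ be the stacked vectors over $i=1,\dots,n$. Let $V_z(\tilde z)=\frac12\tilde z^T(H\otimes I_3)\tilde z$, $V_v(\tilde v)=\frac12\tilde v^T(H\otimes I_3)\tilde v$, $V_p(\tilde P)=\frac12\tilde P^T(H\otimes I_4)\tilde P$. Then: - $t_r\ge0$ is a finite time such that $w_i(t)=\dot\omega_0(t)$ for all $t\ge t_r$ and all $i$ with $a_{i0}=1$. - $c_z=(\lambda_3-\gamma_3)\underline\sigma(H)\sqrt{2/\bar\sigma(H)}$ and $T_z=\dfrac{2\sqrt{V_z(\tilde z(0))}}{c_z}+t_r$. - $\gamma_z=\sqrt{2V_z(\tilde z(0))/\underline\sigma(H)}$, $c_{v0}=\gamma_z\bar\sigma(H)\sqrt{2/\underline\sigma(H)}$, $\Gamma_v(t)=\left[0.5c_{v0}t+\sqrt{V_v(\tilde v(0))}\right]^2$.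 - $c_v=\lambda_2\left[2\underline\sigma^2(H)/\bar\sigma(H)\right]^{(1+\beta_2)/2}$, and $T_v\ge T_z$ is a finite time, after which $\tilde v=0$, satisfying $T_v\le T_z+\dfrac{2\Gamma_v^{(1-\beta_2)/2}(T_z)}{c_v(1-\beta_2)}$. - $\gamma_v=\sqrt{2\Gamma_v(T_z)/\underline\sigma(H)}+\sqrt{3n}\,\gamma_1$, $c_{p0}=2n\gamma_v\bar\sigma(H)/\underline\sigma(H)$, $c_{p1}=n\gamma_v\bar\sigma(H)/8$, $c_{p2}=V_p(\tilde P(0))+c_{p1}/c_{p0}$ (the ratio $c_{p1}/c_{p0}$ equals $\underline\sigma(H)/16$, and is read this way if $\gamma_v=0$). - $c_p=\lambda_1\left[2\underline\sigma^2(H)/\bar\sigma(H)\right]^{(1+\beta_1)/2}$.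
   Formalization: That some finite settling time t_r exists is assumed (it can fail for small μ_1, and then no T_p exists); the estimate is proved for one suitably large t_r, the same for all P, v, z, since it is false for some settling times, such as the least one. *)

theory Defs
  imports "HOL-Analysis.Analysis"
begin

section \<open>Signed powers and quaternions\<close>

(* For \<alpha> = 0 this is sgn x, also at x = 0, because of the factor sgn x. *)
definition spow :: "real \<Rightarrow> real \<Rightarrow> real" where
  "spow \<alpha> x = sgn x * \<bar>x\<bar> powr \<alpha>"

definition vspow :: "real \<Rightarrow> real ^ 'k \<Rightarrow> real ^ 'k" where
  "vspow \<alpha> x = (\<chi> k. spow \<alpha> (x $ k))"

(* Componentwise; the library's sgn on real ^ 'k is x /\<^sub>R norm x instead. *)
definition vsgn :: "real ^ 'k \<Rightarrow> real ^ 'k" where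
  "vsgn x = (\<chi> k. sgn (x $ k))"

definition mk_quat :: "real \<Rightarrow> real ^ 3 \<Rightarrow> real ^ 4" where
  "mk_quat \<eta> q = vector [\<eta>, q $ 1, q $ 2, q $ 3]"

definition quat_scal :: "real ^ 4 \<Rightarrow> real" where
  "quat_scal Q = Q $ 1"

definition quat_vec :: "real ^ 4 \<Rightarrow> real ^ 3" where
  "quat_vec Q = vector [Q $ 2, Q $ 3, Q $ 4]"

definition qmult :: "real ^ 4 \<Rightarrow> real ^ 4 \<Rightarrow> real ^ 4" where
  "qmult Q Q' = mk_quat
     (quat_scal Q * quat_scal Q' - quat_vec Q \<bullet> quat_vec Q')
     (quat_scal Q *\<^sub>R quat_vec Q' + quat_scal Q' *\<^sub>R quat_vec Q
       + cross3 (quat_vec Q) (quat_vec Q'))"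

definition pure_quat :: "real ^ 3 \<Rightarrow> real ^ 4" where
  "pure_quat q = mk_quat 0 q"

lemma mk_quat_nth [simp]:
  "mk_quat \<eta> q $ 1 = \<eta>" "mk_quat \<eta> q $ 2 = q $ 1"
  "mk_quat \<eta> q $ 3 = q $ 2" "mk_quat \<eta> q $ 4 = q $ 3"
  by (simp_all add: mk_quat_def vector_def)

lemma quat_scal_mk_quat [simp]: "quat_scal (mk_quat \<eta> q) = \<eta>"
  by (simp add: quat_scal_def)

lemma quat_vec_mk_quat [simp]: "quat_vec (mk_quat \<eta> q) = q"
  by (simp add: quat_vec_def vec_eq_iff forall_3)

section \<open>Matrices\<close>

definition diag_mat :: "real ^ 'n \<Rightarrow> real ^ 'n ^ 'n" where
  "diag_mat d = (\<chi> i j. if i = j then d $ i else 0)"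

definition kron :: "real ^ 'b ^ 'a \<Rightarrow> real ^ 'd ^ 'c \<Rightarrow> real ^ ('b \<times> 'd) ^ ('a \<times> 'c)"
    (infixl \<open>\<otimes>\<^sub>K\<close> 70) where
  "M \<otimes>\<^sub>K N = (\<chi> p q. M $ fst p $ fst q * N $ snd p $ snd q)"

definition stack :: "real ^ 'k ^ 'n \<Rightarrow> real ^ ('n \<times> 'k)" where
  "stack x = (\<chi> p. x $ fst p $ snd p)"

definition singular_values :: "real ^ 'n ^ 'm \<Rightarrow> real set" where
  "singular_values M =
     {s. 0 \<le> s \<and> (\<exists>x. x \<noteq> 0 \<and> (transpose M ** M) *v x = s\<^sup>2 *\<^sub>R x)}"

definition sv_max :: "real ^ 'n ^ 'm \<Rightarrow> real" where
  "sv_max M = Max (singular_values M)"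

definition sv_min :: "real ^ 'n ^ 'm \<Rightarrow> real" where
  "sv_min M = Min (singular_values M)"

section \<open>Communication graph\<close>

definition laplacian :: "real ^ 'n ^ 'n \<Rightarrow> real ^ 'n ^ 'n" where
  "laplacian A = (\<chi> i j. if i = j then \<Sum>k\<in>UNIV. A $ i $ k else - A $ i $ j)"

definition Hmat :: "real ^ 'n ^ 'n \<Rightarrow> real ^ 'n \<Rightarrow> real ^ 'n ^ 'n" where
  "Hmat A a\<^sub>0 = laplacian A + diag_mat a\<^sub>0"

definition undirected_weights :: "real ^ 'n ^ 'n \<Rightarrow> bool" where
  "undirected_weights A \<longleftrightarrow>
     (\<forall>i j. A $ i $ j = A $ j $ i) \<and> (\<forall>i j. 0 \<le> A $ i $ j) \<and> (\<forall>i. A $ i $ i = 0)"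

(* None is the leader (node 0), Some i is follower i. *)
definition leader_graph :: "real ^ 'n ^ 'n \<Rightarrow> real ^ 'n \<Rightarrow> ('n option \<times> 'n option) set" where
  "leader_graph A a\<^sub>0 =
     {(None, Some i) | i. a\<^sub>0 $ i = 1} \<union> {(Some i, Some j) | i j. 0 < A $ i $ j}"

definition spanned_from_leader :: "real ^ 'n ^ 'n \<Rightarrow> real ^ 'n \<Rightarrow> bool" where
  "spanned_from_leader A a\<^sub>0 \<longleftrightarrow> (\<forall>i. (None, Some i) \<in> (leader_graph A a\<^sub>0)\<^sup>*)"

section \<open>Filippov solutions\<close>

definition abs_cont_on :: "real set \<Rightarrow> (real \<Rightarrow> 'a::real_normed_vector) \<Rightarrow> bool" where
  "abs_cont_on S x \<longleftrightarrow>
     (\<forall>\<epsilon>>0. \<exists>\<delta>>0. \<forall>D. D division_of \<Union>D \<and> \<Union>D \<subseteq> S \<and> (\<Sum>I\<in>D. Sup I - Inf I) < \<delta>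
        \<longrightarrow> (\<Sum>I\<in>D. norm (x (Sup I) - x (Inf I))) < \<epsilon>)"

definition filippov_set :: "('a::euclidean_space \<Rightarrow> 'a) \<Rightarrow> 'a \<Rightarrow> 'a set" where
  "filippov_set f x =
     (\<Inter>\<delta>\<in>{0<..}. \<Inter>N\<in>{N. negligible N}. closure (convex hull (f ` (ball x \<delta> - N))))"

definition filippov_solution ::
  "(real \<Rightarrow> 'a::euclidean_space \<Rightarrow> 'a) \<Rightarrow> (real \<Rightarrow> 'a) \<Rightarrow> bool" where
  "filippov_solution f x \<longleftrightarrow>
     (\<forall>T\<ge>0. abs_cont_on {0..T} x) \<and>
     (AE t in lebesgue. 0 < t \<longrightarrow>
        (\<exists>d\<in>filippov_set (f t) (x t). (x has_vector_derivative d) (at t)))"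

section \<open>The distributed observer\<close>

(* The sum over all nodes j = 0, ..., n, where x0 is the value used for node 0. *)
definition disagreement ::
  "real ^ 'n ^ 'n \<Rightarrow> real ^ 'n \<Rightarrow> real ^ 'k ^ 'n \<Rightarrow> real ^ 'k \<Rightarrow> 'n \<Rightarrow> real ^ 'k" where
  "disagreement A a\<^sub>0 x x0 i =
     a\<^sub>0 $ i *\<^sub>R (x $ i - x0) + (\<Sum>j\<in>UNIV. A $ i $ j *\<^sub>R (x $ i - x $ j))"

type_synonym 'n obs_state =
  "(real ^ 4 ^ 'n) \<times> (real ^ 3 ^ 'n) \<times> (real ^ 3 ^ 'n) \<times> (real ^ 3 ^ 'n) \<times> (real ^ 3 ^ 'n)"

definition observer_field ::
  "real ^ 'n ^ 'n \<Rightarrow> real ^ 'n \<Rightarrow> real \<Rightarrow> real \<Rightarrow> real \<Rightarrow> real \<Rightarrow> real \<Rightarrow> real \<Rightarrow> real \<Rightarrow>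
   (real \<Rightarrow> real ^ 4) \<Rightarrow> (real \<Rightarrow> real ^ 3) \<Rightarrow> real \<Rightarrow> 'n obs_state \<Rightarrow> 'n obs_state" where
  "observer_field A a\<^sub>0 l\<^sub>1 l\<^sub>2 l\<^sub>3 \<beta>\<^sub>1 \<beta>\<^sub>2 \<mu>\<^sub>1 \<mu>\<^sub>2 Q\<^sub>0 \<omega>\<^sub>0 t = (\<lambda>(P, v, z, y, w).
     (\<chi> i. (1/2) *\<^sub>R qmult (P $ i) (pure_quat (v $ i))
             - l\<^sub>1 *\<^sub>R vspow \<beta>\<^sub>1 (disagreement A a\<^sub>0 P (Q\<^sub>0 t) i),
      \<chi> i. z $ i - l\<^sub>2 *\<^sub>R vspow \<beta>\<^sub>2 (disagreement A a\<^sub>0 v (\<omega>\<^sub>0 t) i),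
      \<chi> i. - l\<^sub>3 *\<^sub>R vsgn (disagreement A a\<^sub>0 z (w $ i) i),
      \<chi> i. - (\<mu>\<^sub>1 * a\<^sub>0 $ i) *\<^sub>R vspow (1/2) (y $ i - \<omega>\<^sub>0 t) + w $ i,
      \<chi> i. - (\<mu>\<^sub>2 * a\<^sub>0 $ i) *\<^sub>R vsgn (y $ i - \<omega>\<^sub>0 t)))"

(* The times t_r of the convergence estimate. While w differs from \<omega>_0', the z-error may grow
   beyond its initial value, so the estimate in terms of the initial errors cannot hold for
   every such time (for example the least one). The admissible t_r depends on the leader, the
   graph, the gains and (y, w), but not on the (P, v, z) part of the solution. *)
definition settled_from ::
  "real ^ 'n \<Rightarrow> (real \<Rightarrow> real ^ 3) \<Rightarrow> (real \<Rightarrow> real ^ 3 ^ 'n) \<Rightarrow> real \<Rightarrow> bool" where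
  "settled_from a\<^sub>0 \<omega>\<^sub>0' w t\<^sub>r \<longleftrightarrow>
     0 \<le> t\<^sub>r \<and> (\<forall>t\<ge>t\<^sub>r. \<forall>i. a\<^sub>0 $ i = 1 \<longrightarrow> w t $ i = \<omega>\<^sub>0' t)"

section \<open>Constants of the convergence time estimate\<close>

definition err :: "real ^ 'k ^ 'n \<Rightarrow> real ^ 'k \<Rightarrow> real ^ 'k ^ 'n" where
  "err x x0 = (\<chi> i. x $ i - x0)"

definition V_fun :: "real ^ 'n ^ 'n \<Rightarrow> real ^ 'k ^ 'n \<Rightarrow> real" where
  "V_fun H x = (1/2) * (stack x \<bullet> ((H \<otimes>\<^sub>K (mat 1 :: real ^ 'k ^ 'k)) *v stack x))"

definition c_z :: "real ^ 'n ^ 'n \<Rightarrow> real \<Rightarrow> real \<Rightarrow> real" where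
  "c_z H l\<^sub>3 \<gamma>\<^sub>3 = (l\<^sub>3 - \<gamma>\<^sub>3) * sv_min H * sqrt (2 / sv_max H)"

(* Here and below Vz0, Vv0, Vp0 are the values of V_z, V_v, V_p at the initial errors. *)
definition T_z :: "real ^ 'n ^ 'n \<Rightarrow> real \<Rightarrow> real \<Rightarrow> real \<Rightarrow> real \<Rightarrow> real" where
  "T_z H l\<^sub>3 \<gamma>\<^sub>3 t\<^sub>r Vz0 = 2 * sqrt Vz0 / c_z H l\<^sub>3 \<gamma>\<^sub>3 + t\<^sub>r"

definition gamma_z :: "real ^ 'n ^ 'n \<Rightarrow> real \<Rightarrow> real" where
  "gamma_z H Vz0 = sqrt (2 * Vz0 / sv_min H)"

definition c_v0 :: "real ^ 'n ^ 'n \<Rightarrow> real \<Rightarrow> real" where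
  "c_v0 H Vz0 = gamma_z H Vz0 * sv_max H * sqrt (2 / sv_min H)"

definition Gamma_v :: "real ^ 'n ^ 'n \<Rightarrow> real \<Rightarrow> real \<Rightarrow> real \<Rightarrow> real" where
  "Gamma_v H Vz0 Vv0 t = ((1/2) * c_v0 H Vz0 * t + sqrt Vv0)\<^sup>2"

(* c_v is c_rate H \<lambda>_2 \<beta>_2 and c_p is c_rate H \<lambda>_1 \<beta>_1. *)
definition c_rate :: "real ^ 'n ^ 'n \<Rightarrow> real \<Rightarrow> real \<Rightarrow> real" where
  "c_rate H l \<beta> = l * (2 * (sv_min H)\<^sup>2 / sv_max H) powr ((1 + \<beta>) / 2)"

definition gamma_v :: "real ^ 'n ^ 'n \<Rightarrow> real \<Rightarrow> real \<Rightarrow> real" where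
  "gamma_v H \<gamma>\<^sub>1 G = sqrt (2 * G / sv_min H) + sqrt (3 * real CARD('n)) * \<gamma>\<^sub>1"

definition c_p0 :: "real ^ 'n ^ 'n \<Rightarrow> real \<Rightarrow> real" where
  "c_p0 H g = 2 * real CARD('n) * g * sv_max H / sv_min H"

definition c_p1 :: "real ^ 'n ^ 'n \<Rightarrow> real \<Rightarrow> real" where
  "c_p1 H g = real CARD('n) * g * sv_max H / 8"

(* c_p1 / c_p0, continued to g = 0. *)
definition c_p10 :: "real ^ 'n ^ 'n \<Rightarrow> real \<Rightarrow> real" where
  "c_p10 H g = (if g = 0 then sv_min H / 16 else c_p1 H g / c_p0 H g)"

definition c_p2 :: "real ^ 'n ^ 'n \<Rightarrow> real \<Rightarrow> real \<Rightarrow> real" where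
  "c_p2 H g Vp0 = Vp0 + c_p10 H g"

(* Gz is Gamma_v evaluated at T_z. *)
definition is_T_v ::
  "real ^ 'n ^ 'n \<Rightarrow> real \<Rightarrow> real \<Rightarrow> (real \<Rightarrow> real ^ 3) \<Rightarrow> (real \<Rightarrow> real ^ 3 ^ 'n) \<Rightarrow>
   real \<Rightarrow> real \<Rightarrow> real \<Rightarrow> bool" where
  "is_T_v H l\<^sub>2 \<beta>\<^sub>2 \<omega>\<^sub>0 v Tz Gz Tv \<longleftrightarrow>
     Tz \<le> Tv \<and> (\<forall>t\<ge>Tv. err (v t) (\<omega>\<^sub>0 t) = 0) \<and>
     Tv \<le> Tz + 2 * Gz powr ((1 - \<beta>\<^sub>2) / 2) / (c_rate H l\<^sub>2 \<beta>\<^sub>2 * (1 - \<beta>\<^sub>2))"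

definition T_p_bound ::
  "real ^ 'n ^ 'n \<Rightarrow> real \<Rightarrow> real \<Rightarrow> real \<Rightarrow> real \<Rightarrow> real \<Rightarrow> real" where
  "T_p_bound H l\<^sub>1 \<beta>\<^sub>1 g Vp0 Tv =
     Tv + 2 * (c_p2 H g Vp0 * exp (c_p0 H g * Tv) - c_p10 H g) powr ((1 - \<beta>\<^sub>1) / 2)
            / (c_rate H l\<^sub>1 \<beta>\<^sub>1 * (1 - \<beta>\<^sub>1))"

end

theory Submission
  imports Defs
begin

text \<open>
  The errors of the z-, v- and P-estimates form a cascade in which the z-error drives the v-error
  and the v-error drives the P-error. Each error e is measured by the energy
  V(e) = (1/2) e . (H \<otimes> I) e. The disagreement fed back by the observer is (H \<otimes> I) e, which is
  the gradient of V, so the feedback contributes the inner product of the disagreement with minus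
  its signed power. This is at most - c V^\<alpha> with some \<alpha> < 1, and a nonnegative function with
  V' \<le> - c V^\<alpha> vanishes in finite time (finite_time_decay). The coupling terms are controlled by
  bounds on the growth of the square root of V (sqrt_growth) for v, and of V plus a constant
  (exponential_growth) for P. The matrix H is positive definite because every follower is reachable
  from the leader (Hmat_positive), and it enters only through the bounds
  sv_min H |x|^2 \<le> x . H x \<le> sv_max H |x|^2 (singular_value_bounds).

  In the attitude equation the product with the leader velocity is a skew map that acts on each
  follower separately and hence commutes with H \<otimes> I. It therefore does not change the energy
  (inner_block_mult_qmult), and V_P + sv_min H / 16 grows at a rate proportional to the v-error alone
  (eP_derivative).

  Filippov solutions satisfy these differential inequalities only almost everywhere. What makes them
  usable is abs_cont_on_nonincreasing: an absolutely continuous function whose derivative is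
  nonpositive almost everywhere does not increase.

  The delicate point is that one t_r has to serve all solutions (P, v, z), and that the estimates are
  expressed by the initial energies although the z-error may grow until the time t_0 at which w settles.
  In terms of the square root of V_z this growth is at most drift * t_0, uniformly in the
  solution. Delaying t_r beyond t_0 adds to T_z without changing the solution, which has three uses.
  The z-error has vanished before T_z. The square root of V_v exceeds the square root b of
  Gamma_v(T_z) by at most a constant (overshoot), because b itself increases with t_r unless the initial
  z-error vanishes. Finally, the decay of V_v absorbs this excess within a bounded time (catch_up), hence
  before T_z. All this is the lemma transient.

  The excess also leaves a bounded additional term in the exponent of the attitude estimate. The
  constant gamma_v contains a summand sqrt (3 n) * gamma_1, which is generous because the leader velocity
  does not contribute to the growth, so a late t_r pays for the term as soon as gamma_1 > 0
  (attitude_energy_bound). If gamma_1 = 0 the leader does not rotate, and the Lyapunov function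
  mu_2 |y| + w^2 / 2 shows that y and w stay at rest (super_twisting_rest). Then w is settled from
  the start and there is no excess.
\<close>


lemma abs_cont_onE:
  assumes "abs_cont_on S x" "e > 0"
  obtains d where "d > 0"
    "\<forall>D. D division_of \<Union>D \<and> \<Union>D \<subseteq> S \<and> (\<Sum>I\<in>D. Sup I - Inf I) < d
        \<longrightarrow> (\<Sum>I\<in>D. norm (x (Sup I) - x (Inf I))) < e"
proof -
  have "\<exists>d>0. \<forall>D. D division_of \<Union>D \<and> \<Union>D \<subseteq> S \<and> (\<Sum>I\<in>D. Sup I - Inf I) < d
        \<longrightarrow> (\<Sum>I\<in>D. norm (x (Sup I) - x (Inf I))) < e"
    using assms by (simp add: abs_cont_on_def)
  then show thesis using that by (elim exE conjE)
qed

section \<open>Absolutely continuous functions\<close>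

lemma abs_cont_on_subset:
  assumes "abs_cont_on S x" "T \<subseteq> S"
  shows "abs_cont_on T x"
  using assms unfolding abs_cont_on_def by (meson order_trans)

lemma division_interval_endpoints:
  fixes D :: "real set set"
  assumes "D division_of S" "I \<in> D"
  shows "Inf I \<le> Sup I" "Inf I \<in> I" "Sup I \<in> I"
proof -
  obtain a b where I: "I = cbox a b" "a \<le> b"
    using division_ofD(3,4)[OF assms] by (metis atLeastatMost_empty_iff box_real(2) not_le)
  then show "Inf I \<le> Sup I" "Inf I \<in> I" "Sup I \<in> I" by auto
qed

text \<open>
  The closure properties needed below (Lipschitz maps, sums, bilinear products) all follow from this
  one comparison of increments.
\<close>

lemma abs_cont_on_dominated:
  fixes x :: "real \<Rightarrow> 'a::real_normed_vector" and y :: "real \<Rightarrow> 'b::real_normed_vector"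
    and g :: "real \<Rightarrow> 'c::real_normed_vector"
  assumes x: "abs_cont_on S x" and y: "abs_cont_on S y"
    and dom: "\<And>u v. u \<in> S \<Longrightarrow> v \<in> S \<Longrightarrow> u \<le> v \<Longrightarrow>
                norm (g v - g u) \<le> L * (norm (x v - x u) + norm (y v - y u))"
  shows "abs_cont_on S g"
  unfolding abs_cont_on_def
proof (intro allI impI)
  fix e :: real assume "e > 0"
  define e' where "e' = e / (2 * (\<bar>L\<bar> + 1))"
  have "e' > 0" using \<open>e > 0\<close> by (simp add: e'_def)
  obtain d1 where d1: "d1 > 0" "\<forall>D. D division_of \<Union>D \<and> \<Union>D \<subseteq> S \<and> (\<Sum>I\<in>D. Sup I - Inf I) < d1
        \<longrightarrow> (\<Sum>I\<in>D. norm (x (Sup I) - x (Inf I))) < e'"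
    using abs_cont_onE[OF x \<open>e' > 0\<close>] .
  obtain d2 where d2: "d2 > 0" "\<forall>D. D division_of \<Union>D \<and> \<Union>D \<subseteq> S \<and> (\<Sum>I\<in>D. Sup I - Inf I) < d2
        \<longrightarrow> (\<Sum>I\<in>D. norm (y (Sup I) - y (Inf I))) < e'"
    using abs_cont_onE[OF y \<open>e' > 0\<close>] .
  show "\<exists>d>0. \<forall>D. D division_of \<Union>D \<and> \<Union>D \<subseteq> S \<and> (\<Sum>I\<in>D. Sup I - Inf I) < d
        \<longrightarrow> (\<Sum>I\<in>D. norm (g (Sup I) - g (Inf I))) < e"
  proof (rule exI[of _ "min d1 d2"], intro conjI allI impI)
    show "min d1 d2 > 0" using d1 d2 by simp
    fix D assume D: "D division_of \<Union>D \<and> \<Union>D \<subseteq> S \<and> (\<Sum>I\<in>D. Sup I - Inf I) < min d1 d2"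
    let ?X = "\<Sum>I\<in>D. norm (x (Sup I) - x (Inf I))"
    let ?Y = "\<Sum>I\<in>D. norm (y (Sup I) - y (Inf I))"
    have XY: "?X < e'" "?Y < e'" using D d1 d2 by auto
    have "(\<Sum>I\<in>D. norm (g (Sup I) - g (Inf I)))
        \<le> (\<Sum>I\<in>D. (\<bar>L\<bar> + 1) * (norm (x (Sup I) - x (Inf I)) + norm (y (Sup I) - y (Inf I))))"
    proof (rule sum_mono)
      fix I assume "I \<in> D"
      then have "I \<subseteq> S" using D by blast
      have "norm (g (Sup I) - g (Inf I)) \<le> L * (norm (x (Sup I) - x (Inf I)) + norm (y (Sup I) - y (Inf I)))"
        using division_interval_endpoints[of D _ I] D \<open>I \<in> D\<close> \<open>I \<subseteq> S\<close> by (intro dom) auto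
      also have "\<dots> \<le> (\<bar>L\<bar> + 1) * (norm (x (Sup I) - x (Inf I)) + norm (y (Sup I) - y (Inf I)))"
        by (intro mult_right_mono) auto
      finally show "norm (g (Sup I) - g (Inf I)) \<le> (\<bar>L\<bar> + 1) * (norm (x (Sup I) - x (Inf I)) + norm (y (Sup I) - y (Inf I)))" .
    qed
    also have "\<dots> = (\<bar>L\<bar> + 1) * (?X + ?Y)"
      by (simp add: sum_distrib_left[symmetric] sum.distrib)
    also have "\<dots> < (\<bar>L\<bar> + 1) * (e' + e')"
      using XY by (intro mult_strict_left_mono) auto
    also have "(\<bar>L\<bar> + 1) * (e' + e') = e"
    proof -
      have "\<bar>L\<bar> + 1 \<noteq> 0" using abs_ge_zero[of L] by linarith
      then show ?thesis unfolding e'_def by (simp add: divide_simps)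
    qed
    finally show "(\<Sum>I\<in>D. norm (g (Sup I) - g (Inf I))) < e" .
  qed
qed

lemma abs_cont_on_id: "abs_cont_on S (\<lambda>t::real. t)"
  unfolding abs_cont_on_def
proof (intro allI impI)
  fix e :: real assume "e > 0"
  have "(\<Sum>I\<in>D. norm (Sup I - Inf I)) = (\<Sum>I\<in>D. Sup I - Inf I)" if "D division_of \<Union>D" for D :: "real set set"
    using division_interval_endpoints(1)[OF that] by (intro sum.cong) auto
  then show "\<exists>d>0. \<forall>D. D division_of \<Union>D \<and> \<Union>D \<subseteq> S \<and> (\<Sum>I\<in>D. Sup I - Inf I) < d
        \<longrightarrow> (\<Sum>I\<in>D. norm (Sup I - Inf I)) < e"
    using \<open>e > 0\<close> by (intro exI[of _ e]) auto
qed

lemma abs_cont_on_lipschitz: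
  fixes g :: "real \<Rightarrow> 'a::real_normed_vector"
  assumes "\<And>u v. u \<in> S \<Longrightarrow> v \<in> S \<Longrightarrow> u \<le> v \<Longrightarrow> norm (g v - g u) \<le> L * (v - u)"
  shows "abs_cont_on S g"
proof (rule abs_cont_on_dominated[OF abs_cont_on_id abs_cont_on_id, where L = "L/2"])
  fix u v assume "u \<in> S" "v \<in> S" "u \<le> v"
  then show "norm (g v - g u) \<le> L / 2 * (norm (v - u) + norm (v - u))"
    using assms[OF \<open>u \<in> S\<close> \<open>v \<in> S\<close> \<open>u \<le> v\<close>] \<open>u \<le> v\<close> by (simp add: right_diff_distrib)
qed

lemma abs_cont_on_const: "abs_cont_on S (\<lambda>t. c)"
  by (rule abs_cont_on_lipschitz[where L = 0]) simp

lemma abs_cont_on_compose_lipschitz: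
  assumes "abs_cont_on S x"
    and "\<And>p q. p \<in> x ` S \<Longrightarrow> q \<in> x ` S \<Longrightarrow> norm (\<phi> p - \<phi> q) \<le> L * norm (p - q)"
  shows "abs_cont_on S (\<lambda>t. \<phi> (x t))"
  by (rule abs_cont_on_dominated[OF assms(1) assms(1), where L = "L/2"]) (use assms(2) in auto)

lemma abs_cont_on_linear:
  assumes "bounded_linear \<phi>" "abs_cont_on S x"
  shows "abs_cont_on S (\<lambda>t. \<phi> (x t))"
proof -
  interpret bounded_linear \<phi> by fact
  obtain K where "\<And>p. norm (\<phi> p) \<le> norm p * K" using bounded by blast
  then show ?thesis
    by (intro abs_cont_on_compose_lipschitz[OF assms(2), where L = K]) (metis diff mult.commute)
qed

lemma abs_cont_on_add:
  assumes "abs_cont_on S x" "abs_cont_on S y"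
  shows "abs_cont_on S (\<lambda>t. x t + y t)"
proof (rule abs_cont_on_dominated[OF assms, where L = 1])
  fix u v
  show "norm (x v + y v - (x u + y u)) \<le> 1 * (norm (x v - x u) + norm (y v - y u))"
    using norm_triangle_ineq[of "x v - x u" "y v - y u"] by (simp add: algebra_simps)
qed

lemma abs_cont_on_diff:
  assumes "abs_cont_on S x" "abs_cont_on S y"
  shows "abs_cont_on S (\<lambda>t. x t - y t)"
  using abs_cont_on_add[OF assms(1) abs_cont_on_linear[OF _ assms(2), of uminus]]
  by (simp add: bounded_linear_minus)

lemma abs_cont_on_imp_continuous_on:
  fixes x :: "real \<Rightarrow> 'a::real_normed_vector"
  assumes "abs_cont_on {a..b} x"
  shows "continuous_on {a..b} x"
  unfolding continuous_on_iff
proof (intro ballI allI impI)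
  fix s e :: real assume s: "s \<in> {a..b}" and "e > 0"
  obtain d where d: "d > 0" "\<forall>D. D division_of \<Union>D \<and> \<Union>D \<subseteq> {a..b} \<and> (\<Sum>I\<in>D. Sup I - Inf I) < d
        \<longrightarrow> (\<Sum>I\<in>D. norm (x (Sup I) - x (Inf I))) < e"
    using abs_cont_onE[OF assms \<open>e > 0\<close>] .
  have *: "norm (x v - x u) < e" if "u \<in> {a..b}" "v \<in> {a..b}" "u \<le> v" "v - u < d" for u v
  proof -
    have "{{u..v}} division_of {u..v}"
      using that division_of_self[of u v] by simp
    then show ?thesis using d(2)[rule_format, of "{{u..v}}"] that by simp
  qed
  show "\<exists>d>0. \<forall>x'\<in>{a..b}. dist x' s < d \<longrightarrow> dist (x x') (x s) < e"
  proof (rule exI[of _ d], intro conjI ballI impI)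
    fix r assume r: "r \<in> {a..b}" "dist r s < d"
    then show "dist (x r) (x s) < e"
      using *[of r s] *[of s r] s by (cases "r \<le> s") (auto simp: dist_norm norm_minus_commute)
  qed (use d in auto)
qed

lemma bounded_bilinear_diff_bound:
  assumes "bounded_bilinear pr"
  obtains K where "K > 0" "\<And>a b a' b'. norm (pr a b - pr a' b') \<le> K * (norm b * norm (a - a') + norm a' * norm (b - b'))"
proof -
  interpret bounded_bilinear pr by fact
  obtain K where K: "K > 0" "\<And>a b. norm (pr a b) \<le> norm a * norm b * K" using pos_bounded by blast
  have "norm (pr a b - pr a' b') \<le> K * (norm b * norm (a - a') + norm a' * norm (b - b'))" for a b a' b'
  proof -
    have "pr a b - pr a' b' = pr (a - a') b + pr a' (b - b')" by (simp add: diff_left diff_right)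
    also have "norm \<dots> \<le> norm (pr (a - a') b) + norm (pr a' (b - b'))" by (rule norm_triangle_ineq)
    also have "\<dots> \<le> norm (a - a') * norm b * K + norm a' * norm (b - b') * K"
      by (intro add_mono K)
    finally show ?thesis by (simp add: algebra_simps)
  qed
  with K(1) that show ?thesis by blast
qed

lemma abs_cont_on_bilinear:
  assumes "bounded_bilinear pr" "abs_cont_on {a..b} x" "abs_cont_on {a..b} y"
  shows "abs_cont_on {a..b} (\<lambda>t. pr (x t) (y t))"
proof -
  obtain K where K: "K > 0" "\<And>p q p' q'. norm (pr p q - pr p' q') \<le> K * (norm q * norm (p - p') + norm p' * norm (q - q'))"
    using bounded_bilinear_diff_bound[OF assms(1)] by metis
  have "bounded (x ` {a..b})" "bounded (y ` {a..b})"
    using assms(2,3) by (auto intro!: compact_imp_bounded compact_continuous_image abs_cont_on_imp_continuous_on)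
  then obtain Bx By where B: "\<And>t. t \<in> {a..b} \<Longrightarrow> norm (x t) \<le> Bx" "\<And>t. t \<in> {a..b} \<Longrightarrow> norm (y t) \<le> By"
    unfolding bounded_iff by blast
  show ?thesis
  proof (rule abs_cont_on_dominated[OF assms(2,3), where L = "K * (\<bar>Bx\<bar> + \<bar>By\<bar>)"])
    fix u v assume uv: "u \<in> {a..b}" "v \<in> {a..b}" "u \<le> v"
    have "norm (pr (x v) (y v) - pr (x u) (y u)) \<le> K * (norm (y v) * norm (x v - x u) + norm (x u) * norm (y v - y u))"
      by (rule K)
    also have "\<dots> \<le> K * ((\<bar>Bx\<bar> + \<bar>By\<bar>) * norm (x v - x u) + (\<bar>Bx\<bar> + \<bar>By\<bar>) * norm (y v - y u))"
      using K(1) B(1)[OF uv(1)] B(2)[OF uv(2)]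
      by (intro mult_left_mono add_mono mult_right_mono) auto
    finally show "norm (pr (x v) (y v) - pr (x u) (y u)) \<le> K * (\<bar>Bx\<bar> + \<bar>By\<bar>) * (norm (x v - x u) + norm (y v - y u))"
      by (simp add: algebra_simps)
  qed
qed

lemma sum_length_division_le:
  fixes D :: "real set set"
  assumes D: "D division_of \<Union>D" and U: "\<Union>D \<subseteq> U" "U \<in> lmeasurable"
  shows "(\<Sum>I\<in>D. Sup I - Inf I) \<le> measure lebesgue U"
proof -
  note d = division_ofD[OF D]
  have cb: "\<exists>a b. I = cbox a b \<and> a \<le> b" if "I \<in> D" for I
    using d(3,4)[OF that] by (metis atLeastatMost_empty_iff box_real(2) not_le)
  have "(\<Sum>I\<in>D. Sup I - Inf I) = (\<Sum>I\<in>D. measure lebesgue I)"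
    by (rule sum.cong) (use cb in fastforce)+
  also have "\<dots> = measure lebesgue (\<Union>D)"
  proof (rule measure_negligible_finite_Union[symmetric])
    show "pairwise (\<lambda>S T. negligible (S \<inter> T)) D"
    proof (rule pairwiseI)
      fix I J assume IJ: "I \<in> D" "J \<in> D" "I \<noteq> J"
      obtain c e where c: "I \<inter> J = cbox c e" 
        using cb[OF IJ(1)] cb[OF IJ(2)] Int_interval[where 'a = real] by (elim exE conjE) (simp only:)
      have "interior (I \<inter> J) = {}" using d(5)[OF IJ] by simp
      then show "negligible (I \<inter> J)" unfolding c negligible_interval by (simp add: interior_cbox del: interior_Int)
    qed
  qed (use d(1) cb in force)+
  also have "\<dots> \<le> measure lebesgue U"
  proof (rule measure_mono_fmeasurable[OF U(1) _ U(2)])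
    have "closed (\<Union>D)" using d(1) cb by (intro closed_Union) force+
    then show "\<Union>D \<in> sets lebesgue" by simp
  qed
  finally show ?thesis .
qed

lemma negligible_open_cover:
  fixes N :: "'a::euclidean_space set"
  assumes "negligible N" "d > 0"
  obtains U where "open U" "N \<subseteq> U" "U \<in> lmeasurable" "measure lebesgue U < d"
proof -
  have N: "N \<in> null_sets lebesgue" using assms(1) negligible_iff_null_sets by blast
  then obtain U where U: "open U" "N \<subseteq> U" "U - N \<in> lmeasurable" "emeasure lebesgue (U - N) < ennreal d"
    using sets_lebesgue_outer_open[OF null_setsD2[OF N] assms(2)] by metis
  have e: "emeasure lebesgue U = emeasure lebesgue (U - N)"
    using N U(1) by (simp add: emeasure_Diff_null_set)
  have "emeasure lebesgue U < ennreal d" using e U(4) by simp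
  then have "U \<in> lmeasurable"
    using U(1) by (intro fmeasurableI) (auto intro: order.strict_trans)
  moreover have "measure lebesgue U < d"
    using \<open>emeasure lebesgue U < ennreal d\<close> assms(2)
    unfolding measure_def by (subst enn2real_less_iff) (auto intro: order.strict_trans)
  ultimately show ?thesis by (rule that[OF U(1,2)])
qed

text \<open>
  Let N be the null set where the derivative is not available. Outside N a small interval around a
  tag t satisfies g v - g u \<le> e (v - u); the tags in N are given intervals inside an open set of measure
  below the \<delta> of absolute continuity, so that their total contribution is below e. Cousin's
  lemma provides a division fine for both kinds of neighbourhoods, and summing the increments
  gives the claim.
\<close>

lemma abs_cont_on_nonincreasing:
  fixes g :: "real \<Rightarrow> real"
  assumes ac: "abs_cont_on {a..b} g" and "a \<le> b"
    and deriv: "AE t in lebesgue. a < t \<and> t < b \<longrightarrow> (\<exists>d\<le>0. (g has_real_derivative d) (at t))"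
  shows "g b \<le> g a"
proof -
  obtain N0 where N0: "\<And>t. t \<notin> N0 \<Longrightarrow> a < t \<and> t < b \<longrightarrow> (\<exists>d\<le>0. (g has_real_derivative d) (at t))"
    "N0 \<in> null_sets lebesgue"
    using AE_E3[OF deriv] by (auto simp del: not_less)
  \<comment> \<open>The derivative is known only inside the interval, so the endpoints count as exceptional tags.\<close>
  define N where "N = insert a (insert b N0)"
  have negN: "negligible N" using N0(2) by (simp add: N_def negligible_iff_null_sets[symmetric])
  have key: "g b - g a \<le> e * (b - a) + e" if "e > 0" for e
  proof -
    obtain d where d: "d > 0" "\<forall>D. D division_of \<Union>D \<and> \<Union>D \<subseteq> {a..b} \<and> (\<Sum>I\<in>D. Sup I - Inf I) < d
        \<longrightarrow> (\<Sum>I\<in>D. norm (g (Sup I) - g (Inf I))) < e"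
      using abs_cont_onE[OF ac \<open>e > 0\<close>] .
    obtain U where U: "open U" "N \<subseteq> U" "U \<in> lmeasurable" "measure lebesgue U < d"
      using negligible_open_cover[OF negN d(1)] .
    have "\<exists>r>0. ball t r \<subseteq> U" if "t \<in> N" for t
      using U that openE by blast
    moreover
    have "\<exists>r>0. \<forall>s. \<bar>s - t\<bar> < r \<longrightarrow> (s \<ge> t \<longrightarrow> g s - g t \<le> e * (s - t)) \<and> (s \<le> t \<longrightarrow> g t - g s \<le> e * (t - s))"
      if "t \<in> {a..b} - N" for t
    proof -
      have "a < t" "t < b" "t \<notin> N0" using that by (auto simp: N_def less_le)
      then obtain D where D: "D \<le> 0" "(g has_real_derivative D) (at t)" using N0(1) by blast
      obtain r where r: "r > 0" "\<And>s. norm (s - t) < r \<Longrightarrow> norm (g s - g t - D * (s - t)) \<le> e * norm (s - t)"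
        using D(2) \<open>e > 0\<close> unfolding has_field_derivative_def has_derivative_at_alt by blast
      show ?thesis
      proof (rule exI[of _ r], intro conjI allI impI)
        fix s assume s: "\<bar>s - t\<bar> < r" "t \<le> s"
        have "g s - g t - D * (s - t) \<le> e * (s - t)" using r(2)[of s] s by simp
        moreover have "D * (s - t) \<le> 0" using D s by (simp add: mult_nonpos_nonneg)
        ultimately show "g s - g t \<le> e * (s - t)" by linarith
      next
        fix s assume s: "\<bar>s - t\<bar> < r" "s \<le> t"
        have "- (g s - g t - D * (s - t)) \<le> e * (t - s)" using r(2)[of s] s by simp
        moreover have "0 \<le> D * (s - t)" using D s by (simp add: mult_nonpos_nonpos)
        ultimately show "g t - g s \<le> e * (t - s)" by linarith
      qed (use r in auto)
    qed
    ultimately have "\<forall>t. \<exists>r>0. (t \<in> N \<longrightarrow> ball t r \<subseteq> U) \<and> (t \<in> {a..b} - N \<longrightarrow>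
        (\<forall>s. \<bar>s - t\<bar> < r \<longrightarrow> (s \<ge> t \<longrightarrow> g s - g t \<le> e * (s - t)) \<and> (s \<le> t \<longrightarrow> g t - g s \<le> e * (t - s))))"
      by (metis DiffD2 zero_less_one)
    then obtain r where r: "\<And>t. r t > 0" "\<And>t. t \<in> N \<Longrightarrow> ball t (r t) \<subseteq> U"
      "\<And>t s. t \<in> {a..b} - N \<Longrightarrow> \<bar>s - t\<bar> < r t \<Longrightarrow> s \<ge> t \<Longrightarrow> g s - g t \<le> e * (s - t)"
      "\<And>t s. t \<in> {a..b} - N \<Longrightarrow> \<bar>s - t\<bar> < r t \<Longrightarrow> s \<le> t \<Longrightarrow> g t - g s \<le> e * (t - s)"
      by metis
    have "gauge (\<lambda>t. ball t (r t))" using r(1) by (simp add: gauge_ball_dependent)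
    then obtain p where p: "p tagged_division_of {a..b}" "(\<lambda>t. ball t (r t)) fine p"
      using fine_division_exists_real by blast
    have fin: "finite p" using p(1) by blast
    define B where "B = {q \<in> p. fst q \<in> N}"
    define G where "G = p - B"
    have I: "\<exists>u v. K = {u..v} \<and> u \<le> v \<and> u \<le> t \<and> t \<le> v \<and> a \<le> u \<and> v \<le> b \<and> K \<subseteq> ball t (r t)" if tK: "(t, K) \<in> p" for t K
    proof -
      obtain u v where "K = cbox u v" "t \<in> K" "K \<subseteq> {a..b}"
        using tagged_division_ofD(2-4)[OF p(1) tK] by blast
      moreover have "K \<subseteq> ball t (r t)" using p(2) that by (auto simp: fine_def)
      ultimately show ?thesis by auto
    qed
    have "g b - g a = (\<Sum>(t, K)\<in>p. g (Sup K) - g (Inf K))"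
      using additive_tagged_division_1[OF \<open>a \<le> b\<close> p(1), of g] by simp
    also have "\<dots> = (\<Sum>(t, K)\<in>G. g (Sup K) - g (Inf K)) + (\<Sum>(t, K)\<in>B. g (Sup K) - g (Inf K))"
      unfolding G_def by (rule sum.subset_diff) (use fin in \<open>auto simp: B_def\<close>)
    also have "(\<Sum>(t, K)\<in>G. g (Sup K) - g (Inf K)) \<le> (\<Sum>(t, K)\<in>G. e * (Sup K - Inf K))"
    proof (rule sum_mono, clarify)
      fix t K assume tK: "(t, K) \<in> G"
      then obtain u v where K: "K = {u..v}" "u \<le> t" "t \<le> v" "a \<le> u" "v \<le> b" "K \<subseteq> ball t (r t)"
        using I[of t K] by (auto simp: G_def)
      have t: "t \<in> {a..b} - N" using tK K by (auto simp: G_def B_def)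
      have "u \<in> K" "v \<in> K" using K by auto
      then have "\<bar>u - t\<bar> < r t" "\<bar>v - t\<bar> < r t" using K(6) by (auto simp: dist_real_def abs_minus_commute)
      then have "g v - g t \<le> e * (v - t)" "g t - g u \<le> e * (t - u)" using r(3,4) t K by auto
      then show "g (Sup K) - g (Inf K) \<le> e * (Sup K - Inf K)" using K by (simp add: algebra_simps)
    qed
    also have "\<dots> \<le> (\<Sum>(t, K)\<in>p. e * (Sup K - Inf K))"
    proof (rule sum_mono2[OF fin])
      show "G \<subseteq> p" by (auto simp: G_def)
      fix q assume "q \<in> p - G"
      then show "0 \<le> (case q of (t, K) \<Rightarrow> e * (Sup K - Inf K))"
        using I[of "fst q" "snd q"] \<open>e > 0\<close> by (auto simp: case_prod_beta)
    qed
    also have "\<dots> = e * (b - a)"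
      using additive_tagged_division_1[OF \<open>a \<le> b\<close> p(1), of "\<lambda>x. x"]
      by (simp add: sum_distrib_left[symmetric] case_prod_beta)
    also have "(\<Sum>(t, K)\<in>B. g (Sup K) - g (Inf K)) \<le> e"
    proof -
      have Bp: "B tagged_partial_division_of {a..b}"
        using p(1) tagged_partial_division_subset[of p "{a..b}" B] by (auto simp: B_def tagged_division_of_def)
      then have Bt: "B tagged_division_of \<Union>(snd ` B)" by (rule tagged_partial_division_of_Union_self)
      have D: "snd ` B division_of \<Union>(snd ` B)" by (rule division_of_tagged_division[OF Bt])
      have subU: "\<Union>(snd ` B) \<subseteq> U"
        using I r(2) by (fastforce simp: B_def)
      have "(\<Sum>K\<in>snd ` B. Sup K - Inf K) < d"
        using sum_length_division_le[OF D subU U(3)] U(4) by linarith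
      moreover have "\<Union>(snd ` B) \<subseteq> {a..b}" using I by (fastforce simp: B_def)
      ultimately have lt: "(\<Sum>K\<in>snd ` B. norm (g (Sup K) - g (Inf K))) < e" using d(2) D by blast
      have "(\<Sum>(t, K)\<in>B. g (Sup K) - g (Inf K)) \<le> (\<Sum>(t, K)\<in>B. norm (g (Sup K) - g (Inf K)))"
        by (rule sum_mono) (auto simp: case_prod_beta)
      also have "\<dots> = (\<Sum>(t, K)\<in>B. if K = {} then 0 else norm (g (Sup K) - g (Inf K)))"
        using I by (intro sum.cong) (force simp: B_def)+
      also have "\<dots> = (\<Sum>K\<in>snd ` B. if K = {} then 0 else norm (g (Sup K) - g (Inf K)))"
      proof (rule sum.over_tagged_division_lemma[OF Bt])
        fix u v :: real assume "box u v = {}"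
        then have "u \<ge> v" by simp
        then show "(if cbox u v = {} then 0 else norm (g (Sup (cbox u v)) - g (Inf (cbox u v)))) = 0"
          by (cases "u = v") auto
      qed
      also have "\<dots> \<le> (\<Sum>K\<in>snd ` B. norm (g (Sup K) - g (Inf K)))"
        by (rule sum_mono) simp
      finally show ?thesis using lt by linarith
    qed
    finally show ?thesis by simp
  qed
  show ?thesis
  proof (rule field_le_epsilon)
    fix e :: real assume "e > 0"
    define e' where "e' = e / (b - a + 1)"
    have "e' > 0" using \<open>e > 0\<close> \<open>a \<le> b\<close> by (simp add: e'_def)
    moreover have "e' * (b - a) + e' = e"
    proof -
      have "e' * (b - a + 1) = e" using \<open>a \<le> b\<close> unfolding e'_def by simp
      then show ?thesis by (simp add: algebra_simps)
    qed
    ultimately show "g b \<le> g a + e" using key[of e'] by linarith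
  qed
qed

section \<open>Differential inequalities\<close>

lemma abs_cont_on_compose_deriv:
  fixes g :: "real \<Rightarrow> real" and \<phi> \<phi>' :: "real \<Rightarrow> real"
  assumes "abs_cont_on S g" "convex C" "g ` S \<subseteq> C"
    and "\<And>x. x \<in> C \<Longrightarrow> (\<phi> has_real_derivative \<phi>' x) (at x within C)"
    and "\<And>x. x \<in> C \<Longrightarrow> \<bar>\<phi>' x\<bar> \<le> L"
  shows "abs_cont_on S (\<lambda>t. \<phi> (g t))"
proof (rule abs_cont_on_compose_lipschitz[OF assms(1), where L = L])
  fix p q assume "p \<in> g ` S" "q \<in> g ` S"
  then show "norm (\<phi> p - \<phi> q) \<le> L * norm (p - q)"
    using assms(3,5) by (intro field_differentiable_bound[OF assms(2) assms(4)]) auto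
qed

text \<open>
  The square root is not differentiable at 0, where V may spend any amount of time. The proof
  therefore works with sqrt (V + e^2), whose derivative is still at most h, and lets e tend to 0.
\<close>

lemma sqrt_growth:
  fixes V :: "real \<Rightarrow> real"
  assumes ac: "abs_cont_on {a..b} V" and "a \<le> b" and "0 \<le> h"
    and nonneg: "\<And>t. t \<in> {a..b} \<Longrightarrow> 0 \<le> V t"
    and deriv: "AE t in lebesgue. a < t \<and> t < b \<longrightarrow>
                  (\<exists>d. (V has_real_derivative d) (at t) \<and> d \<le> 2 * h * sqrt (V t))"
  shows "sqrt (V b) \<le> sqrt (V a) + h * (b - a)"
proof (rule field_le_epsilon)
  fix e :: real assume e: "e > 0"
  define \<phi> where "\<phi> x = sqrt (x + e\<^sup>2)" for x
  have pos: "x + e\<^sup>2 > 0" if "x \<ge> 0" for x using that e by (simp add: add_nonneg_pos)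
  have d\<phi>: "(\<phi> has_real_derivative inverse (\<phi> x) / 2) (at x)" if "x \<ge> 0" for x
    unfolding \<phi>_def by (rule derivative_eq_intros refl | use pos[OF that] in simp)+
  have \<phi>_ge: "e \<le> \<phi> x" "sqrt x \<le> \<phi> x" if "x \<ge> 0" for x
    using that e by (auto simp: \<phi>_def intro!: real_le_rsqrt)
  have ac\<phi>: "abs_cont_on {a..b} (\<lambda>t. \<phi> (V t))"
  proof (rule abs_cont_on_compose_deriv[OF ac, where C = "{0..}" and \<phi>' = "\<lambda>x. inverse (\<phi> x) / 2" and L = "inverse e"])
    fix x :: real assume x: "x \<in> {0..}"
    show "(\<phi> has_real_derivative inverse (\<phi> x) / 2) (at x within {0..})"
      using d\<phi>[of x] x by (auto intro: DERIV_subset)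
    have "0 < \<phi> x" using \<phi>_ge(1)[of x] x e by simp
    moreover have "inverse (\<phi> x) \<le> inverse e" using \<phi>_ge(1)[of x] x e by (intro le_imp_inverse_le) auto
    moreover have "0 < inverse (\<phi> x)" using \<open>0 < \<phi> x\<close> by simp
    ultimately show "\<bar>inverse (\<phi> x) / 2\<bar> \<le> inverse e" by linarith
  qed (use nonneg in auto)
  have "\<phi> (V b) - h * b \<le> \<phi> (V a) - h * a"
  proof (rule abs_cont_on_nonincreasing[OF _ \<open>a \<le> b\<close>])
    show "abs_cont_on {a..b} (\<lambda>t. \<phi> (V t) - h * t)"
      by (intro abs_cont_on_diff ac\<phi> abs_cont_on_linear[OF bounded_linear_mult_right] abs_cont_on_id)
    show "AE t in lebesgue. a < t \<and> t < b \<longrightarrow>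
            (\<exists>d\<le>0. ((\<lambda>t. \<phi> (V t) - h * t) has_real_derivative d) (at t))"
      using deriv
    proof (rule AE_mp, intro AE_I2 impI)
      fix t assume *: "a < t \<and> t < b \<longrightarrow> (\<exists>d. (V has_real_derivative d) (at t) \<and> d \<le> 2 * h * sqrt (V t))"
        and t: "a < t \<and> t < b"
      then obtain d where d: "(V has_real_derivative d) (at t)" "d \<le> 2 * h * sqrt (V t)" by blast
      have V: "V t \<ge> 0" using nonneg t by simp
      have p: "\<phi> (V t) > 0" using \<phi>_ge(1)[OF V] e by simp
      have "((\<lambda>t. \<phi> (V t)) has_real_derivative (inverse (\<phi> (V t)) / 2) * d) (at t)"
        using DERIV_chain2[OF d\<phi>[OF V] d(1)] .
      then have "((\<lambda>t. \<phi> (V t) - h * t) has_real_derivative (inverse (\<phi> (V t)) / 2) * d - h) (at t)"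
        by (auto intro!: derivative_eq_intros)
      moreover have "(inverse (\<phi> (V t)) / 2) * d \<le> h"
      proof -
        have "2 * h * sqrt (V t) \<le> 2 * h * \<phi> (V t)" using \<phi>_ge(2)[OF V] \<open>0 \<le> h\<close> by (intro mult_left_mono) auto
        then show ?thesis using d(2) p by (simp add: field_simps)
      qed
      ultimately show "\<exists>d\<le>0. ((\<lambda>t. \<phi> (V t) - h * t) has_real_derivative d) (at t)" by (intro exI conjI) auto
    qed
  qed
  moreover have "sqrt (V b) \<le> \<phi> (V b)" using \<phi>_ge nonneg \<open>a \<le> b\<close> by simp
  moreover have "\<phi> (V a) \<le> sqrt (V a) + e"
    using sqrt_add_le_add_sqrt[of "V a" "e\<^sup>2"] nonneg[of a] \<open>a \<le> b\<close> e by (simp add: \<phi>_def)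
  ultimately show "sqrt (V b) \<le> sqrt (V a) + h * (b - a) + e" by (simp add: algebra_simps)
qed

text \<open>
  V is nonincreasing. If V b > 0, then V stays above V b on the whole interval, where
  V powr (1 - \<alpha>) is a smooth function of V with derivative at most - (1 - \<alpha>) c. If V b = 0, there is
  nothing to show. Besides the decay rate, the bound includes that V does not increase.
\<close>

lemma finite_time_decay:
  fixes V :: "real \<Rightarrow> real"
  assumes ac: "abs_cont_on {a..b} V" and "a \<le> b" and "0 \<le> c" "0 < \<alpha>" "\<alpha> < 1"
    and nonneg: "\<And>t. t \<in> {a..b} \<Longrightarrow> 0 \<le> V t"
    and deriv: "AE t in lebesgue. a < t \<and> t < b \<longrightarrow>
                  (\<exists>d. (V has_real_derivative d) (at t) \<and> d \<le> - c * V t powr \<alpha>)"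
  shows "V b powr (1 - \<alpha>) \<le> max 0 (V a powr (1 - \<alpha>) - (1 - \<alpha>) * c * (b - a))"
proof (cases "V b = 0")
  case False
  define m where "m = V b"
  have "m > 0" using False nonneg[of b] \<open>a \<le> b\<close> by (simp add: m_def)
  have mono: "V b \<le> V s" if "s \<in> {a..b}" for s
  proof (rule abs_cont_on_nonincreasing[where g = V and a = s and b = b])
    show "abs_cont_on {s..b} V" using ac by (rule abs_cont_on_subset) (use that in auto)
    show "AE t in lebesgue. s < t \<and> t < b \<longrightarrow> (\<exists>d\<le>0. (V has_real_derivative d) (at t))"
      using deriv
    proof (rule AE_mp, intro AE_I2 impI)
      fix t assume *: "a < t \<and> t < b \<longrightarrow> (\<exists>d. (V has_real_derivative d) (at t) \<and> d \<le> - c * V t powr \<alpha>)"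
        and t: "s < t \<and> t < b"
      then obtain d where d: "(V has_real_derivative d) (at t)" "d \<le> - c * V t powr \<alpha>"
        using \<open>s \<in> {a..b}\<close> by auto
      have "0 \<le> c * V t powr \<alpha>" using \<open>0 \<le> c\<close> by simp
      then have "d \<le> 0" using d(2) by linarith
      with d(1) show "\<exists>d\<le>0. (V has_real_derivative d) (at t)" by blast
    qed
  qed (use that in auto)
  have "V b powr (1 - \<alpha>) + (1 - \<alpha>) * c * b \<le> V a powr (1 - \<alpha>) + (1 - \<alpha>) * c * a"
  proof (rule abs_cont_on_nonincreasing[OF _ \<open>a \<le> b\<close>])
    have dp: "((\<lambda>x. x powr (1 - \<alpha>)) has_real_derivative (1 - \<alpha>) * x powr (- \<alpha>)) (at x)" if "x > 0" for x
      using has_real_derivative_powr[OF that, of "1 - \<alpha>"] by simp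
    have "abs_cont_on {a..b} (\<lambda>t. V t powr (1 - \<alpha>))"
    proof (rule abs_cont_on_compose_deriv[OF ac, where C = "{m..}" and \<phi>' = "\<lambda>x. (1 - \<alpha>) * x powr (- \<alpha>)" and L = "(1 - \<alpha>) * m powr (- \<alpha>)"])
      fix x assume x: "x \<in> {m..}"
      show "((\<lambda>x. x powr (1 - \<alpha>)) has_real_derivative (1 - \<alpha>) * x powr (- \<alpha>)) (at x within {m..})"
        using dp[of x] x \<open>m > 0\<close> by (auto intro: DERIV_subset)
      have "x powr (- \<alpha>) \<le> m powr (- \<alpha>)"
        using x \<open>m > 0\<close> \<open>0 < \<alpha>\<close> by (intro powr_mono2') auto
      then show "\<bar>(1 - \<alpha>) * x powr (- \<alpha>)\<bar> \<le> (1 - \<alpha>) * m powr (- \<alpha>)"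
        using \<open>\<alpha> < 1\<close> by (simp add: abs_mult mult_left_mono)
    qed (use mono in \<open>auto simp: m_def\<close>)
    then show "abs_cont_on {a..b} (\<lambda>t. V t powr (1 - \<alpha>) + (1 - \<alpha>) * c * t)"
      by (intro abs_cont_on_add abs_cont_on_linear[OF bounded_linear_mult_right] abs_cont_on_id)
    show "AE t in lebesgue. a < t \<and> t < b \<longrightarrow>
            (\<exists>d\<le>0. ((\<lambda>t. V t powr (1 - \<alpha>) + (1 - \<alpha>) * c * t) has_real_derivative d) (at t))"
      using deriv
    proof (rule AE_mp, intro AE_I2 impI)
      fix t assume *: "a < t \<and> t < b \<longrightarrow> (\<exists>d. (V has_real_derivative d) (at t) \<and> d \<le> - c * V t powr \<alpha>)"
        and t: "a < t \<and> t < b"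
      then obtain d where d: "(V has_real_derivative d) (at t)" "d \<le> - c * V t powr \<alpha>" by blast
      have V: "V t > 0" using mono[of t] t \<open>m > 0\<close> by (auto simp: m_def)
      have "((\<lambda>t. V t powr (1 - \<alpha>)) has_real_derivative ((1 - \<alpha>) * V t powr (- \<alpha>)) * d) (at t)"
        using DERIV_chain2[OF dp[OF V] d(1)] .
      then have "((\<lambda>t. V t powr (1 - \<alpha>) + (1 - \<alpha>) * c * t) has_real_derivative
                   ((1 - \<alpha>) * V t powr (- \<alpha>)) * d + (1 - \<alpha>) * c) (at t)"
        by (intro DERIV_add DERIV_cmult_Id)
      moreover have "((1 - \<alpha>) * V t powr (- \<alpha>)) * d \<le> - ((1 - \<alpha>) * c)"
      proof -
        have "((1 - \<alpha>) * V t powr (- \<alpha>)) * d \<le> ((1 - \<alpha>) * V t powr (- \<alpha>)) * (- c * V t powr \<alpha>)"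
          using d(2) \<open>\<alpha> < 1\<close> by (intro mult_left_mono) auto
        also have "\<dots> = - ((1 - \<alpha>) * c) * (V t powr (- \<alpha>) * V t powr \<alpha>)" by (simp add: mult_ac)
        also have "V t powr (- \<alpha>) * V t powr \<alpha> = 1" using V by (simp add: powr_add[symmetric])
        finally show ?thesis by simp
      qed
      ultimately show "\<exists>d\<le>0. ((\<lambda>t. V t powr (1 - \<alpha>) + (1 - \<alpha>) * c * t) has_real_derivative d) (at t)"
        by (intro exI conjI) auto
    qed
  qed
  then show ?thesis by (simp add: algebra_simps)
qed simp

lemma exponential_growth:
  fixes W :: "real \<Rightarrow> real"
  assumes ac: "abs_cont_on {a..b} W" and "a \<le> b"
    and deriv: "AE t in lebesgue. a < t \<and> t < b \<longrightarrow>
                  (\<exists>d. (W has_real_derivative d) (at t) \<and> d \<le> k * W t)"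
  shows "W b \<le> W a * exp (k * (b - a))"
proof -
  have "W b * exp (- k * b) \<le> W a * exp (- k * a)"
  proof (rule abs_cont_on_nonincreasing[OF _ \<open>a \<le> b\<close>])
    have "abs_cont_on {a..b} (\<lambda>t. exp (- k * t))"
    proof (rule abs_cont_on_compose_deriv[OF abs_cont_on_id, where C = "{a..b}" and \<phi>' = "\<lambda>t. - k * exp (- k * t)"
            and L = "\<bar>k\<bar> * (exp (- k * a) + exp (- k * b))"])
      fix t assume t: "t \<in> {a..b}"
      show "((\<lambda>t. exp (- k * t)) has_real_derivative - k * exp (- k * t)) (at t within {a..b})"
        by (auto intro!: derivative_eq_intros)
      have "exp (- k * t) \<le> exp (- k * a) + exp (- k * b)"
      proof (cases "k \<ge> 0")
        case True
        then have "exp (- k * t) \<le> exp (- k * a)" using t by (simp add: mult_left_mono)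
        then show ?thesis using exp_gt_zero[of "- k * b"] by linarith
      next
        case False
        then have "exp (- k * t) \<le> exp (- k * b)" using t by (simp add: mult_left_mono_neg)
        then show ?thesis using exp_gt_zero[of "- k * a"] by linarith
      qed
      then show "\<bar>- k * exp (- k * t)\<bar> \<le> \<bar>k\<bar> * (exp (- k * a) + exp (- k * b))"
        by (simp add: abs_mult mult_left_mono)
    qed auto
    then show "abs_cont_on {a..b} (\<lambda>t. W t * exp (- k * t))"
      by (rule abs_cont_on_bilinear[OF bounded_bilinear_mult ac])
    show "AE t in lebesgue. a < t \<and> t < b \<longrightarrow>
            (\<exists>d\<le>0. ((\<lambda>t. W t * exp (- k * t)) has_real_derivative d) (at t))"
      using deriv
    proof (rule AE_mp, intro AE_I2 impI)
      fix t assume *: "a < t \<and> t < b \<longrightarrow> (\<exists>d. (W has_real_derivative d) (at t) \<and> d \<le> k * W t)"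
        and t: "a < t \<and> t < b"
      then obtain d where d: "(W has_real_derivative d) (at t)" "d \<le> k * W t" by blast
      have "((\<lambda>t. W t * exp (- k * t)) has_real_derivative (d - k * W t) * exp (- k * t)) (at t)"
        using d(1) by (auto intro!: derivative_eq_intros simp: algebra_simps)
      moreover have "(d - k * W t) * exp (- k * t) \<le> 0"
        using d(2) by (simp add: mult_nonpos_nonneg)
      ultimately show "\<exists>d\<le>0. ((\<lambda>t. W t * exp (- k * t)) has_real_derivative d) (at t)" by blast
    qed
  qed
  then have "W b * exp (- k * b) * exp (k * b) \<le> W a * exp (- k * a) * exp (k * b)"
    by (intro mult_right_mono) auto
  then show ?thesis by (simp add: mult.assoc exp_add[symmetric] algebra_simps)
qed

lemma powr_add_le:
  fixes x y p :: real
  assumes "0 \<le> x" "0 \<le> y" "0 < p" "p \<le> 1"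
  shows "(x + y) powr p \<le> x powr p + y powr p"
proof (cases "x + y = 0")
  case False
  then have s: "x + y > 0" using assms by simp
  have *: "z / (x + y) \<le> (z / (x + y)) powr p" if "0 \<le> z" "z \<le> x + y" for z
  proof (cases "z = 0")
    case False
    then have "(z / (x + y)) powr 1 \<le> (z / (x + y)) powr p"
      using that s assms by (intro powr_mono') auto
    then show ?thesis using that s by (simp add: powr_one_gt_zero_iff)
  qed simp
  have "1 = x / (x + y) + y / (x + y)" using s by (simp add: add_divide_distrib[symmetric])
  also have "\<dots> \<le> (x / (x + y)) powr p + (y / (x + y)) powr p"
    using assms by (intro add_mono *) auto
  also have "\<dots> = (x powr p + y powr p) / (x + y) powr p"
    using assms s by (simp add: powr_divide add_divide_distrib)
  finally show ?thesis using s by (simp add: field_simps)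
qed (use assms in simp)

lemma powr_sum_le:
  fixes f :: "'a \<Rightarrow> real"
  assumes "finite I" "\<And>i. i \<in> I \<Longrightarrow> 0 \<le> f i" "0 < p" "p \<le> 1"
  shows "(\<Sum>i\<in>I. f i) powr p \<le> (\<Sum>i\<in>I. f i powr p)"
  using assms(1,2)
proof (induction rule: finite_induct)
  case (insert i I)
  have "(f i + (\<Sum>i\<in>I. f i)) powr p \<le> f i powr p + (\<Sum>i\<in>I. f i) powr p"
    using insert.prems assms by (intro powr_add_le sum_nonneg) auto
  then show ?case using insert by simp
qed simp

section \<open>Extreme singular values\<close>

text \<open>
  A minimiser of the quadratic form on the unit sphere is an eigenvector: otherwise, moving it along
  the residual r = M x - m x against the sign of the gradient would decrease x . M x - m x . x below 0.
\<close>

lemma symmetric_extreme_eigenvector: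
  fixes M :: "real ^ 'n ^ 'n"
  assumes sym: "transpose M = M"
  obtains x where "norm x = 1" "M *v x = (x \<bullet> (M *v x)) *\<^sub>R x"
    "\<And>y. (x \<bullet> (M *v x)) * (y \<bullet> y) \<le> y \<bullet> (M *v y)"
proof -
  have adj: "x \<bullet> (M *v y) = (M *v x) \<bullet> y" for x y
    using dot_lmul_matrix[of x M y] sym by (metis transpose_matrix_vector)
  have "continuous_on (sphere 0 1) (\<lambda>x. x \<bullet> (M *v x))"
    by (intro continuous_intros linear_continuous_on) (simp add: matrix_vector_mul_bounded_linear)
  then have "\<exists>x\<in>sphere 0 1. \<forall>y\<in>sphere 0 1. x \<bullet> (M *v x) \<le> y \<bullet> (M *v y)"
    by (intro continuous_attains_inf) auto
  then obtain x where x: "x \<in> sphere 0 1" "\<And>y. y \<in> sphere 0 1 \<Longrightarrow> x \<bullet> (M *v x) \<le> y \<bullet> (M *v y)"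
    by (elim bexE) simp
  define m where "m = x \<bullet> (M *v x)"
  have le: "m * (y \<bullet> y) \<le> y \<bullet> (M *v y)" for y
  proof (cases "y = 0")
    case False
    have "m \<le> (y /\<^sub>R norm y) \<bullet> (M *v (y /\<^sub>R norm y))"
      unfolding m_def using False by (intro x(2)) simp
    also have "\<dots> = (y \<bullet> (M *v y)) / (y \<bullet> y)"
      using False by (simp add: matrix_vector_mult_scaleR dot_square_norm power2_eq_square field_simps)
    finally show ?thesis using False by (simp add: field_simps)
  qed simp
  define r where "r = M *v x - m *\<^sub>R x"
  have xx: "x \<bullet> x = 1" using x(1) by (simp add: dot_square_norm)
  have ineq: "0 \<le> 2 * e * (r \<bullet> r) + e\<^sup>2 * (r \<bullet> (M *v r) - m * (r \<bullet> r))" for e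
  proof -
    have h1: "m * ((x + e *\<^sub>R r) \<bullet> (x + e *\<^sub>R r)) \<le> (x + e *\<^sub>R r) \<bullet> (M *v (x + e *\<^sub>R r))"
      by (rule le)
    have h2: "(x + e *\<^sub>R r) \<bullet> (x + e *\<^sub>R r) = 1 + 2 * e * (r \<bullet> x) + e\<^sup>2 * (r \<bullet> r)"
      using xx by (simp add: inner_add_left inner_add_right inner_commute[of x r] algebra_simps power2_eq_square)
    have h3: "(x + e *\<^sub>R r) \<bullet> (M *v (x + e *\<^sub>R r)) = m + 2 * e * (r \<bullet> (M *v x)) + e\<^sup>2 * (r \<bullet> (M *v r))"
      using adj[of x r]
      by (simp add: matrix_vector_right_distrib matrix_vector_mult_scaleR inner_add_left inner_add_right
          m_def inner_commute[of "M *v x" r] algebra_simps power2_eq_square)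
    have h4: "r \<bullet> (M *v x) = r \<bullet> r + m * (r \<bullet> x)"
      using inner_diff_right[of r "M *v x" "m *\<^sub>R x"] by (simp add: r_def[symmetric])
    show ?thesis
      using h1 unfolding h2 h3 h4 by (simp add: algebra_simps)
  qed
  have "r \<bullet> r = 0"
  proof (rule ccontr)
    assume "r \<bullet> r \<noteq> 0"
    then have p: "r \<bullet> r > 0" by simp
    define q where "q = r \<bullet> (M *v r) - m * (r \<bullet> r)"
    have q: "q \<ge> 0" using le[of r] by (simp add: q_def)
    define e where "e = - (r \<bullet> r) / (q + 1)"
    have "e < 0" using p q by (simp add: e_def divide_neg_pos)
    moreover have "0 < 2 * (r \<bullet> r) + e * q"
    proof -
      have "- e * q \<le> (r \<bullet> r)" using p q by (simp add: e_def field_simps)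
      then show ?thesis using p by linarith
    qed
    ultimately have "e * (2 * (r \<bullet> r) + e * q) < 0" by (rule mult_neg_pos)
    then show False using ineq[of e] by (simp add: q_def power2_eq_square algebra_simps)
  qed
  then have "M *v x = m *\<^sub>R x" by (simp add: r_def)
  then show ?thesis using that[of x] x(1) le by (simp add: m_def)
qed

text \<open>
  Finiteness makes the Max and Min in the definitions of sv_max and sv_min meaningful. It holds
  because eigenvectors of the symmetric matrix for different eigenvalues are orthogonal, hence
  linearly independent.
\<close>

lemma finite_singular_values: "finite (singular_values (M :: real ^ 'n ^ 'm))"
proof -
  define N where "N = transpose M ** M"
  have sym: "transpose N = N" by (simp add: N_def matrix_transpose_mul)
  have adj: "x \<bullet> (N *v y) = (N *v x) \<bullet> y" for x y
    using dot_lmul_matrix[of x N y] sym by (metis transpose_matrix_vector)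
  define f where "f s = (SOME x. x \<noteq> 0 \<and> N *v x = s\<^sup>2 *\<^sub>R x)" for s :: real
  have f: "f s \<noteq> 0" "N *v f s = s\<^sup>2 *\<^sub>R f s" if "s \<in> singular_values M" for s
    using someI_ex[of "\<lambda>x. x \<noteq> 0 \<and> N *v x = s\<^sup>2 *\<^sub>R x"] that
    by (auto simp: singular_values_def N_def f_def)
  have orth: "f s \<bullet> f t = 0" if "s \<in> singular_values M" "t \<in> singular_values M" "s \<noteq> t" for s t
  proof -
    have "s\<^sup>2 * (f s \<bullet> f t) = t\<^sup>2 * (f s \<bullet> f t)"
      using adj[of "f s" "f t"] f(2)[OF that(1)] f(2)[OF that(2)] by (metis inner_scaleR_left inner_scaleR_right)
    moreover have "s\<^sup>2 \<noteq> t\<^sup>2" using that by (auto simp: singular_values_def power2_eq_iff_nonneg)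
    ultimately show ?thesis using mult_cancel_right[of "s\<^sup>2" "f s \<bullet> f t" "t\<^sup>2"] by blast
  qed
  have inj: "inj_on f (singular_values M)"
    by (rule inj_onI) (metis f(1) inner_eq_zero_iff orth)
  have "independent (f ` singular_values M)"
    using orth f(1) by (intro pairwise_orthogonal_independent) (auto simp: pairwise_def orthogonal_def)
  then have "finite (f ` singular_values M)" using independent_bound by blast
  then show ?thesis using inj by (simp add: finite_image_iff)
qed

text \<open>
  The extreme eigenvalues of a positive definite H are singular values of H, so that sv_min H lies below
  the smallest and sv_max H above the largest one.
\<close>

lemma singular_value_bounds:
  fixes H :: "real ^ 'n ^ 'n"
  assumes sym: "transpose H = H" and pos: "\<And>x. x \<noteq> 0 \<Longrightarrow> 0 < x \<bullet> (H *v x)"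
  shows "0 < sv_min H" "sv_min H * (x \<bullet> x) \<le> x \<bullet> (H *v x)" "x \<bullet> (H *v x) \<le> sv_max H * (x \<bullet> x)"
proof -
  have mem: "m \<in> singular_values H" if "norm y = 1" "H *v y = m *\<^sub>R y" for y m
  proof -
    have "y \<noteq> 0" using that by auto
    have "0 < m" using pos[OF \<open>y \<noteq> 0\<close>] that by (simp add: dot_square_norm)
    moreover have "(transpose H ** H) *v y = m\<^sup>2 *\<^sub>R y"
      using that by (simp add: sym matrix_vector_mul_assoc[symmetric] matrix_vector_mult_scaleR power2_eq_square)
    ultimately show ?thesis using \<open>y \<noteq> 0\<close> by (auto simp: singular_values_def)
  qed
  obtain y where y: "norm y = 1" "H *v y = (y \<bullet> (H *v y)) *\<^sub>R y"
    "\<And>x. (y \<bullet> (H *v y)) * (x \<bullet> x) \<le> x \<bullet> (H *v x)"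
    using symmetric_extreme_eigenvector[OF sym] by metis
  have "transpose (- H) = - H" using sym by (simp add: transpose_def vec_eq_iff)
  then obtain z where z': "norm z = 1" "(- H) *v z = (z \<bullet> ((- H) *v z)) *\<^sub>R z"
    "\<And>x. (z \<bullet> ((- H) *v z)) * (x \<bullet> x) \<le> x \<bullet> ((- H) *v x)"
    using symmetric_extreme_eigenvector[of "- H"] by metis
  have neg: "(- H) *v u = - (H *v u)" for u
    by (simp add: matrix_vector_mult_def vec_eq_iff sum_negf)
  have z: "norm z = 1" "H *v z = (z \<bullet> (H *v z)) *\<^sub>R z"
    "\<And>x. x \<bullet> (H *v x) \<le> (z \<bullet> (H *v z)) * (x \<bullet> x)"
    using z' unfolding neg by auto
  have y_mem: "y \<bullet> (H *v y) \<in> singular_values H" using mem y by blast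
  have z_mem: "z \<bullet> (H *v z) \<in> singular_values H" using mem z by blast
  have "sv_min H \<in> singular_values H"
    unfolding sv_min_def using finite_singular_values[of H] y_mem by (intro Min_in) auto
  moreover have "(0::real) \<notin> singular_values H"
  proof
    assume "0 \<in> singular_values H"
    then obtain u where u: "u \<noteq> 0" "H *v (H *v u) = 0"
      by (auto simp: singular_values_def sym matrix_vector_mul_assoc[symmetric])
    have "H *v u \<noteq> 0" using pos[OF u(1)] by auto
    then show False using pos[of "H *v u"] u(2) by simp
  qed
  ultimately show "0 < sv_min H" by (metis (mono_tags, lifting) less_eq_real_def mem_Collect_eq singular_values_def)
  have "sv_min H \<le> y \<bullet> (H *v y)"
    unfolding sv_min_def using finite_singular_values y_mem by (intro Min_le) auto
  then have "sv_min H * (x \<bullet> x) \<le> (y \<bullet> (H *v y)) * (x \<bullet> x)" by (intro mult_right_mono) auto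
  then show "sv_min H * (x \<bullet> x) \<le> x \<bullet> (H *v x)" using y(3)[of x] by linarith
  have "z \<bullet> (H *v z) \<le> sv_max H"
    unfolding sv_max_def using finite_singular_values z_mem by (intro Max_ge) auto
  then have "(z \<bullet> (H *v z)) * (x \<bullet> x) \<le> sv_max H * (x \<bullet> x)" by (intro mult_right_mono) auto
  then show "x \<bullet> (H *v x) \<le> sv_max H * (x \<bullet> x)" using z(3)[of x] by linarith
qed

section \<open>Coercive operators and their energies\<close>

text \<open>
  The operator H \<otimes> I on stacked vectors, acting on the unstacked representation.
\<close>

definition block_mult :: "real ^ 'n ^ 'n \<Rightarrow> real ^ 'k ^ 'n \<Rightarrow> real ^ 'k ^ 'n" where
  "block_mult H x = (\<chi> i. \<Sum>j\<in>UNIV. H $ i $ j *\<^sub>R x $ j)"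

lemma inner_block_mult_columns:
  "x \<bullet> block_mult H y = (\<Sum>k\<in>UNIV. column k x \<bullet> (H *v column k y))"
  by (simp add: block_mult_def inner_vec_def column_def matrix_vector_mult_def sum.swap[of _ "UNIV :: 'b set"])

lemma inner_columns:
  fixes x y :: "real ^ 'k ^ 'n"
  shows "x \<bullet> y = (\<Sum>k\<in>UNIV. column k x \<bullet> column k y)"
  by (simp add: inner_vec_def column_def) (rule sum.swap)

lemma V_fun_eq: "V_fun H x = (1/2) * (x \<bullet> block_mult H x)"
proof -
  have "stack x \<bullet> ((H \<otimes>\<^sub>K (mat 1 :: real ^ 'b ^ 'b)) *v stack x) =
    (\<Sum>p\<in>UNIV \<times> UNIV. x $ fst p $ snd p *
       (\<Sum>q\<in>UNIV \<times> UNIV. H $ fst p $ fst q * (if snd p = snd q then 1 else 0) * x $ fst q $ snd q))"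
    by (simp add: inner_vec_def stack_def kron_def mat_def matrix_vector_mult_def)
  also have "\<dots> = (\<Sum>i\<in>UNIV. \<Sum>k\<in>UNIV. x $ i $ k *
       (\<Sum>j\<in>UNIV. \<Sum>l\<in>UNIV. H $ i $ j * (if k = l then 1 else 0) * x $ j $ l))"
    unfolding sum.cartesian_product' by simp
  also have "\<dots> = (\<Sum>i\<in>UNIV. \<Sum>k\<in>UNIV. x $ i $ k * (\<Sum>j\<in>UNIV. H $ i $ j * x $ j $ k))"
    by (simp add: if_distrib if_distribR cong: if_cong)
  also have "\<dots> = x \<bullet> block_mult H x"
    by (simp add: block_mult_def inner_vec_def)
  finally show ?thesis by (simp add: V_fun_def)
qed

text \<open>
  The energy estimates are the same for the errors in dimension 3 and 4, and need only the quadratic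
  form bounds of the operator, not its matrix.
\<close>

locale coercive_operator =
  fixes B :: "'a::real_inner \<Rightarrow> 'a" and \<sigma> \<Sigma> :: real
  assumes bounded_linear: "bounded_linear B"
    and selfadjoint: "x \<bullet> B y = B x \<bullet> y"
    and lower_pos: "0 < \<sigma>"
    and lower: "\<sigma> * (x \<bullet> x) \<le> x \<bullet> B x"
    and upper: "x \<bullet> B x \<le> \<Sigma> * (x \<bullet> x)"
    and ordered: "\<sigma> \<le> \<Sigma>"
begin

definition energy :: "'a \<Rightarrow> real" where
  "energy x = (1/2) * (x \<bullet> B x)"

lemma upper_pos: "0 < \<Sigma>"
  using lower_pos ordered by linarith

lemma form_nonneg: "0 \<le> x \<bullet> B x"
proof -
  have "0 \<le> \<sigma> * (x \<bullet> x)" using lower_pos by simp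
  then show ?thesis using lower[of x] by linarith
qed

lemma energy_nonneg: "0 \<le> energy x"
  using form_nonneg by (simp add: energy_def)

lemma energy_lower: "\<sigma> * (norm x)\<^sup>2 \<le> 2 * energy x"
  using lower[of x] by (simp add: energy_def dot_square_norm)

lemma energy_upper: "2 * energy x \<le> \<Sigma> * (norm x)\<^sup>2"
  using upper[of x] by (simp add: energy_def dot_square_norm)

lemma energy_eq_0_iff: "energy x = 0 \<longleftrightarrow> x = 0"
proof
  assume "energy x = 0"
  then have "\<sigma> * (norm x)\<^sup>2 \<le> 0" using energy_lower[of x] by simp
  then show "x = 0" using lower_pos by (simp add: mult_le_0_iff)
qed (simp add: energy_def)

lemma norm_le_energy: "norm x \<le> sqrt (2 / \<sigma>) * sqrt (energy x)"
proof -
  have "(norm x)\<^sup>2 \<le> 2 / \<sigma> * energy x"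
    using energy_lower[of x] lower_pos by (simp add: field_simps)
  then show ?thesis by (metis norm_ge_zero real_le_rsqrt real_sqrt_mult)
qed

text \<open>
  This is the Cauchy-Schwarz inequality of the inner product x . B y. Compared with the Euclidean one
  it avoids a factor sqrt (\<Sigma> / \<sigma>) in the coupling between the z-error and the v-error.
\<close>

lemma form_cauchy_schwarz: "x \<bullet> B y \<le> 2 * sqrt (energy x) * sqrt (energy y)"
proof (cases "energy y = 0")
  case True
  then show ?thesis using energy_eq_0_iff[of y] bounded_linear linear_0 bounded_linear.linear by fastforce
next
  case False
  interpret B: bounded_linear B by (rule bounded_linear)
  define q where "q = y \<bullet> B y"
  have q: "q > 0" using False form_nonneg[of y] by (simp add: q_def energy_def)
  define a where "a = - (x \<bullet> B y) / q"
  have "0 \<le> (x + a *\<^sub>R y) \<bullet> B (x + a *\<^sub>R y)" by (rule form_nonneg)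
  also have "\<dots> = x \<bullet> B x + 2 * a * (x \<bullet> B y) + a\<^sup>2 * q"
    using selfadjoint[of x y]
    by (simp add: B.add B.scaleR inner_add_left inner_add_right q_def inner_commute power2_eq_square algebra_simps)
  also have "\<dots> = x \<bullet> B x - (x \<bullet> B y)\<^sup>2 / q"
    using q by (simp add: a_def power2_eq_square field_simps)
  finally have "(x \<bullet> B y)\<^sup>2 \<le> (x \<bullet> B x) * q" using q by (simp add: field_simps)
  also have "\<dots> = (2 * sqrt (energy x) * sqrt (energy y))\<^sup>2"
    using form_nonneg[of x] form_nonneg[of y] by (simp add: q_def energy_def power_mult_distrib)
  finally show ?thesis
    by (rule power2_le_imp_le) (simp add: energy_nonneg)
qed

lemma norm_image_le_energy: "norm (B x) \<le> sqrt (2 * \<Sigma>) * sqrt (energy x)"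
proof (cases "B x = 0")
  case False
  have "(norm (B x))\<^sup>2 = x \<bullet> B (B x)" using selfadjoint[of x "B x"] by (simp add: dot_square_norm)
  also have "\<dots> \<le> 2 * sqrt (energy x) * sqrt (energy (B x))" by (rule form_cauchy_schwarz)
  also have "\<dots> \<le> 2 * sqrt (energy x) * (sqrt (\<Sigma> / 2) * norm (B x))"
  proof (intro mult_left_mono)
    have "energy (B x) \<le> \<Sigma> / 2 * (norm (B x))\<^sup>2" using energy_upper[of "B x"] by simp
    then have "sqrt (energy (B x)) \<le> sqrt (\<Sigma> / 2 * (norm (B x))\<^sup>2)" by (rule real_sqrt_le_mono)
    then show "sqrt (energy (B x)) \<le> sqrt (\<Sigma> / 2) * norm (B x)" by (simp only: real_sqrt_mult real_sqrt_abs abs_norm_cancel)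
  qed (use energy_nonneg in auto)
  finally have "norm (B x) * norm (B x) \<le> (2 * sqrt (\<Sigma> / 2) * sqrt (energy x)) * norm (B x)"
    by (simp add: power2_eq_square mult_ac)
  then have "norm (B x) \<le> 2 * sqrt (\<Sigma> / 2) * sqrt (energy x)" using False by simp
  also have "2 * sqrt (\<Sigma> / 2) = sqrt (2 * \<Sigma>)"
    by (simp add: real_sqrt_mult real_sqrt_divide field_simps)
  finally show ?thesis .
qed (use upper_pos energy_nonneg in simp)

lemma norm_image_ge: "\<sigma> * norm x \<le> norm (B x)"
proof (cases "x = 0")
  case False
  have "\<sigma> * norm x * norm x \<le> x \<bullet> B x" using lower[of x] by (simp add: dot_square_norm power2_eq_square mult.assoc)
  also have "\<dots> \<le> norm x * norm (B x)" using norm_cauchy_schwarz .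
  finally show ?thesis using False by (simp add: mult.commute mult_le_cancel_left)
qed simp

lemma norm_image_le: "norm (B x) \<le> \<Sigma> * norm x"
proof -
  have "norm (B x) \<le> sqrt (2 * \<Sigma>) * sqrt (energy x)" by (rule norm_image_le_energy)
  also have "\<dots> \<le> sqrt (2 * \<Sigma>) * sqrt (\<Sigma> / 2 * (norm x)\<^sup>2)"
    using energy_upper[of x] upper_pos by (intro mult_left_mono real_sqrt_le_mono) auto
  also have "\<dots> = sqrt ((\<Sigma> * norm x)\<^sup>2)"
  proof -
    have "2 * \<Sigma> * (\<Sigma> / 2 * (norm x)\<^sup>2) = (\<Sigma> * norm x)\<^sup>2" by (simp add: power2_eq_square)
    then show ?thesis by (simp only: real_sqrt_mult[symmetric])
  qed
  also have "\<dots> = \<Sigma> * norm x" using upper_pos by simp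
  finally show ?thesis .
qed

lemma norm_image_ge_energy: "\<sigma> * sqrt (2 / \<Sigma>) * sqrt (energy x) \<le> norm (B x)"
proof -
  have "2 / \<Sigma> * energy x \<le> (norm x)\<^sup>2"
    using energy_upper[of x] upper_pos by (simp add: field_simps)
  then have "sqrt (2 / \<Sigma>) * sqrt (energy x) \<le> norm x"
    by (metis norm_ge_zero real_le_lsqrt real_sqrt_mult)
  then have "\<sigma> * (sqrt (2 / \<Sigma>) * sqrt (energy x)) \<le> \<sigma> * norm x" using lower_pos by (intro mult_left_mono) auto
  then show ?thesis using norm_image_ge[of x] by (simp add: mult.assoc)
qed

text \<open>
  The vector B e is the gradient of the energy. Since it is also the disagreement used as feedback,
  every energy estimate below starts here.
\<close>

lemma energy_derivative:
  assumes "(e has_vector_derivative e') (at t)"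
  shows "((\<lambda>t. energy (e t)) has_real_derivative B (e t) \<bullet> e') (at t)"
proof -
  have "((\<lambda>t. e t \<bullet> B (e t)) has_vector_derivative (e t \<bullet> B e' + e' \<bullet> B (e t))) (at t)"
    by (intro bounded_bilinear.has_vector_derivative[OF bounded_bilinear_inner] assms bounded_linear.has_vector_derivative[OF bounded_linear])
  then have "((\<lambda>t. energy (e t)) has_vector_derivative (1/2) * (e t \<bullet> B e' + e' \<bullet> B (e t))) (at t)"
    unfolding energy_def by (rule bounded_linear.has_vector_derivative[OF bounded_linear_mult_right])
  moreover have "(1/2) * (e t \<bullet> B e' + e' \<bullet> B (e t)) = B (e t) \<bullet> e'"
    using selfadjoint[of "e t" e'] by (simp add: inner_commute)
  ultimately show ?thesis by (simp add: has_real_derivative_iff_has_vector_derivative)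
qed

lemma energy_abs_cont:
  assumes "abs_cont_on {a..b} e"
  shows "abs_cont_on {a..b} (\<lambda>t. energy (e t))"
  unfolding energy_def
  by (intro abs_cont_on_linear[OF bounded_linear_mult_right] abs_cont_on_bilinear[OF bounded_bilinear_inner] assms
      abs_cont_on_linear[OF bounded_linear])

end

lemma block_mult_coercive:
  fixes H :: "real ^ 'n ^ 'n"
  assumes sym: "transpose H = H" and pos: "\<And>x. x \<noteq> 0 \<Longrightarrow> 0 < x \<bullet> (H *v x)"
  shows "coercive_operator (block_mult H :: real ^ 'k ^ 'n \<Rightarrow> real ^ 'k ^ 'n) (sv_min H) (sv_max H)"
proof (rule coercive_operator.intro)
  note b = singular_value_bounds[OF sym pos]
  have adj: "x \<bullet> (H *v y) = (H *v x) \<bullet> y" for x y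
    using dot_lmul_matrix[of x H y] sym by (metis transpose_matrix_vector)
  have "linear (block_mult H :: real ^ 'k ^ 'n \<Rightarrow> _)"
    by (rule linearI) (simp_all add: block_mult_def vec_eq_iff scaleR_right_distrib sum.distrib scaleR_sum_right sum_distrib_left algebra_simps)
  then show "bounded_linear (block_mult H :: real ^ 'k ^ 'n \<Rightarrow> _)" by (simp add: linear_conv_bounded_linear)
  fix x y :: "real ^ 'k ^ 'n"
  show "x \<bullet> block_mult H y = block_mult H x \<bullet> y"
    unfolding inner_commute[of "block_mult H x"] inner_block_mult_columns using adj by (simp add: inner_commute)
  show "0 < sv_min H" by (rule b)
  show "sv_min H * (x \<bullet> x) \<le> x \<bullet> block_mult H x"
    unfolding inner_block_mult_columns inner_columns[of x x] sum_distrib_left by (intro sum_mono b)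
  show "x \<bullet> block_mult H x \<le> sv_max H * (x \<bullet> x)"
    unfolding inner_block_mult_columns inner_columns[of x x] sum_distrib_left by (intro sum_mono b)
  obtain u :: "real ^ 'n" where u: "u \<noteq> 0" using zero_neq_one by (metis axis_eq_0_iff)
  then have "sv_min H * (u \<bullet> u) \<le> sv_max H * (u \<bullet> u)" using b(2,3)[of u] by linarith
  then show "sv_min H \<le> sv_max H" using u by simp
qed

section \<open>The graph matrix\<close>

lemma Hmat_symmetric:
  assumes "undirected_weights A"
  shows "transpose (Hmat A a\<^sub>0) = Hmat A a\<^sub>0"
  using assms by (auto simp: transpose_def Hmat_def laplacian_def diag_mat_def vec_eq_iff undirected_weights_def)

text \<open>
  Subtracting the same x0 at every node changes no difference, so the disagreement depends only on
  the errors; a leader link becomes a diagonal entry of H.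
\<close>

lemma disagreement_err:
  "disagreement A a\<^sub>0 x x0 i = block_mult (Hmat A a\<^sub>0) (err x x0) $ i" 
  if "undirected_weights A"
proof -
  have d: "A $ i $ i = 0" using that by (simp add: undirected_weights_def)
  have "block_mult (Hmat A a\<^sub>0) (err x x0) $ i =
     (\<Sum>j\<in>UNIV. (if i = j then (\<Sum>k\<in>UNIV. A $ i $ k) *\<^sub>R (x $ j - x0) else 0) + (if i = j then a\<^sub>0 $ i *\<^sub>R (x $ j - x0) else 0) - A $ i $ j *\<^sub>R (x $ j - x0))"
    unfolding block_mult_def vec_lambda_beta by (rule sum.cong) (auto simp: d Hmat_def laplacian_def diag_mat_def err_def algebra_simps)
  also have "\<dots> = (\<Sum>k\<in>UNIV. A $ i $ k) *\<^sub>R (x $ i - x0) + a\<^sub>0 $ i *\<^sub>R (x $ i - x0) - (\<Sum>j\<in>UNIV. A $ i $ j *\<^sub>R (x $ j - x0))"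
    by (simp add: sum_subtractf sum.distrib)
  also have "\<dots> = disagreement A a\<^sub>0 x x0 i"
    by (simp add: disagreement_def scaleR_sum_left scaleR_diff_right sum_subtractf)
  finally show ?thesis by simp
qed

lemma Hmat_form:
  assumes A: "undirected_weights A"
  shows "x \<bullet> (Hmat A a\<^sub>0 *v x) = (\<Sum>i\<in>UNIV. a\<^sub>0 $ i * (x $ i)\<^sup>2) + (1/2) * (\<Sum>i\<in>UNIV. \<Sum>j\<in>UNIV. A $ i $ j * (x $ i - x $ j)\<^sup>2)"
proof -
  have sym: "A $ i $ j = A $ j $ i" and d: "A $ i $ i = 0" for i j using A by (auto simp: undirected_weights_def)
  have "(Hmat A a\<^sub>0 *v x) $ i = a\<^sub>0 $ i * x $ i + (\<Sum>j\<in>UNIV. A $ i $ j * (x $ i - x $ j))" for i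
  proof -
    have "(Hmat A a\<^sub>0 *v x) $ i =
       (\<Sum>j\<in>UNIV. (if i = j then (\<Sum>k\<in>UNIV. A $ i $ k) * x $ j else 0) + (if i = j then a\<^sub>0 $ i * x $ j else 0) - A $ i $ j * x $ j)"
      unfolding matrix_vector_mult_def vec_lambda_beta by (rule sum.cong) (auto simp: d Hmat_def laplacian_def diag_mat_def algebra_simps)
    also have "\<dots> = a\<^sub>0 $ i * x $ i + (\<Sum>j\<in>UNIV. A $ i $ j * (x $ i - x $ j))"
      by (simp add: sum_subtractf sum.distrib sum_distrib_left algebra_simps)
    finally show ?thesis .
  qed
  then have 1: "x \<bullet> (Hmat A a\<^sub>0 *v x) = (\<Sum>i\<in>UNIV. a\<^sub>0 $ i * (x $ i)\<^sup>2) + (\<Sum>i\<in>UNIV. \<Sum>j\<in>UNIV. A $ i $ j * (x $ i - x $ j) * x $ i)"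
    by (simp add: inner_vec_def distrib_left sum.distrib sum_distrib_left power2_eq_square mult_ac)
  let ?S = "\<Sum>i\<in>UNIV. \<Sum>j\<in>UNIV. A $ i $ j * (x $ i - x $ j) * x $ i"
  have "?S = (\<Sum>i\<in>UNIV. \<Sum>j\<in>UNIV. A $ i $ j * (x $ j - x $ i) * x $ j)"
    by (subst sum.swap) (simp add: sym)
  then have "?S + ?S = (\<Sum>i\<in>UNIV. \<Sum>j\<in>UNIV. A $ i $ j * (x $ i - x $ j) * x $ i + A $ i $ j * (x $ j - x $ i) * x $ j)"
    by (simp add: sum.distrib)
  also have "\<dots> = (\<Sum>i\<in>UNIV. \<Sum>j\<in>UNIV. A $ i $ j * (x $ i - x $ j)\<^sup>2)"
    by (intro sum.cong refl) (simp add: power2_eq_square algebra_simps)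
  finally show ?thesis using 1 by simp
qed

text \<open>
  If the form vanishes at x, then x vanishes at the followers linked to the leader and is constant along
  edges. The set of nodes where x vanishes is therefore closed under the edges of the graph, and it
  contains everything reachable from the leader.
\<close>

lemma Hmat_positive:
  assumes A: "undirected_weights A" and a0: "\<forall>i. a\<^sub>0 $ i = 0 \<or> a\<^sub>0 $ i = 1"
    and span: "spanned_from_leader A a\<^sub>0" and "x \<noteq> 0"
  shows "0 < x \<bullet> (Hmat A a\<^sub>0 *v x)"
proof (rule ccontr)
  assume n: "\<not> ?thesis"
  have a0': "0 \<le> a\<^sub>0 $ i" for i using a0[rule_format, of i] by auto
  have A': "0 \<le> A $ i $ j" for i j using A by (simp add: undirected_weights_def)
  have n1: "0 \<le> (\<Sum>i\<in>UNIV. a\<^sub>0 $ i * (x $ i)\<^sup>2)" using a0' by (intro sum_nonneg) simp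
  have n2: "0 \<le> (\<Sum>i\<in>UNIV. \<Sum>j\<in>UNIV. A $ i $ j * (x $ i - x $ j)\<^sup>2)" using A' by (intro sum_nonneg) simp
  have "(\<Sum>i\<in>UNIV. a\<^sub>0 $ i * (x $ i)\<^sup>2) = 0" "(\<Sum>i\<in>UNIV. \<Sum>j\<in>UNIV. A $ i $ j * (x $ i - x $ j)\<^sup>2) = 0"
    using n n1 n2 unfolding Hmat_form[OF A] by linarith+
  then have z: "a\<^sub>0 $ i * (x $ i)\<^sup>2 = 0" "A $ i $ j * (x $ i - x $ j)\<^sup>2 = 0" for i j
    using a0' A' by (simp_all add: sum_nonneg_eq_0_iff sum_nonneg)
  have "p = None \<or> (\<exists>i. p = Some i \<and> x $ i = 0)" if "(None, p) \<in> (leader_graph A a\<^sub>0)\<^sup>*" for p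
    using that
  proof (induction rule: rtrancl_induct)
    case (step p q)
    show ?case
    proof (cases p)
      case None
      then obtain i where "q = Some i" "a\<^sub>0 $ i = 1" using step by (auto simp: leader_graph_def)
      then show ?thesis using z(1)[of i] by simp
    next
      case (Some i)
      then obtain j where "q = Some j" "0 < A $ i $ j" using step by (auto simp: leader_graph_def)
      then show ?thesis using z(2)[of i j] step.IH Some by simp
    qed
  qed simp
  then have "x $ i = 0" for i using span by (force simp: spanned_from_leader_def)
  then show False using \<open>x \<noteq> 0\<close> by (simp add: vec_eq_iff)
qed

section \<open>Filippov sets\<close>

text \<open>
  It suffices to use one small ball and the empty null set in the intersection defining the Filippov set.
\<close>

lemma filippov_set_closed_convex:
  fixes f :: "'a::euclidean_space \<Rightarrow> 'a" and \<phi> :: "'a \<Rightarrow> 'b::real_normed_vector"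
  assumes d: "d \<in> filippov_set f x" and \<phi>: "bounded_linear \<phi>"
    and C: "closed C" "convex C" and near: "\<forall>\<^sub>F p in nhds x. \<phi> (f p) \<in> C"
  shows "\<phi> d \<in> C"
proof -
  obtain r where r: "r > 0" "\<And>p. p \<in> ball x r \<Longrightarrow> \<phi> (f p) \<in> C"
    using near unfolding eventually_nhds_metric by (auto simp: dist_commute)
  have "d \<in> closure (convex hull (f ` (ball x r - {})))"
    using d r(1) unfolding filippov_set_def by (metis (no_types, lifting) INT_D greaterThan_iff mem_Collect_eq negligible_empty)
  moreover have "closure (convex hull (f ` (ball x r - {}))) \<subseteq> \<phi> -` C"
  proof (rule closure_minimal)
    have "convex (\<phi> -` C)" using C(2) \<phi> by (simp add: bounded_linear.linear convex_linear_vimage)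
    then show "convex hull (f ` (ball x r - {})) \<subseteq> \<phi> -` C"
      using r(2) by (intro hull_minimal) auto
    show "closed (\<phi> -` C)"
      using C(1) linear_continuous_on[OF \<phi>] continuous_closed_vimage[OF C(1), of \<phi>] by (simp add: \<phi> linear_continuous_at)
  qed
  ultimately show ?thesis by blast
qed

lemma filippov_set_continuous_part:
  fixes f :: "'a::euclidean_space \<Rightarrow> 'a" and \<phi> :: "'a \<Rightarrow> 'b::real_normed_vector"
  assumes d: "d \<in> filippov_set f x" and \<phi>: "bounded_linear \<phi>"
    and cont: "isCont (\<lambda>p. \<phi> (f p)) x"
  shows "\<phi> d = \<phi> (f x)"
proof (rule ccontr)
  assume "\<phi> d \<noteq> \<phi> (f x)"
  then have e: "0 < dist (\<phi> (f x)) (\<phi> d) / 2" by simp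
  have "\<forall>\<^sub>F p in nhds x. \<phi> (f p) \<in> cball (\<phi> (f x)) (dist (\<phi> (f x)) (\<phi> d) / 2)"
    (is "\<forall>\<^sub>F p in _. ?P p")
  proof -
    have "\<forall>\<^sub>F p in at x. dist (\<phi> (f p)) (\<phi> (f x)) < dist (\<phi> (f x)) (\<phi> d) / 2"
      using cont e unfolding isCont_def by (rule tendstoD)
    then show ?thesis
      unfolding eventually_at_filter
    proof (rule eventually_mono)
      fix p assume "p \<noteq> x \<longrightarrow> p \<in> UNIV \<longrightarrow> dist (\<phi> (f p)) (\<phi> (f x)) < dist (\<phi> (f x)) (\<phi> d) / 2"
      then show "?P p" by (cases "p = x") (simp_all add: dist_commute)
    qed
  qed
  from filippov_set_closed_convex[OF d \<phi> _ _ this] have "dist (\<phi> (f x)) (\<phi> d) \<le> dist (\<phi> (f x)) (\<phi> d) / 2"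
    by simp
  with e show False by linarith
qed

text \<open>
  Near a point with s x \<noteq> 0 the component is locally constant, and at s x = 0 it is only known to lie in
  [-c, c]. The product with s x does not see the difference, which is all that an energy estimate
  requires.
\<close>

lemma filippov_set_sign_part:
  fixes f :: "'a::euclidean_space \<Rightarrow> 'a" and \<phi> s :: "'a \<Rightarrow> real"
  assumes d: "d \<in> filippov_set f x" and \<phi>: "bounded_linear \<phi>"
    and s: "isCont s x" and f: "\<And>p. \<phi> (f p) = - c * sgn (s p)" and "0 \<le> c"
  shows "\<bar>\<phi> d\<bar> \<le> c" "s x \<noteq> 0 \<Longrightarrow> \<phi> d = - c * sgn (s x)" "s x * \<phi> d = - c * \<bar>s x\<bar>"
proof -
  have "\<phi> d \<in> {-c..c}"
    using \<open>0 \<le> c\<close> by (intro filippov_set_closed_convex[OF d \<phi>] always_eventually) (auto simp: f sgn_if)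
  then show "\<bar>\<phi> d\<bar> \<le> c" by auto
  show *: "\<phi> d = - c * sgn (s x)" if "s x \<noteq> 0"
  proof -
    have "\<forall>\<^sub>F p in at x. sgn (s p) = sgn (s x)"
    proof (cases "s x > 0")
      case True
      then have "\<forall>\<^sub>F p in at x. s p > 0" using s True unfolding isCont_def by (intro order_tendstoD(1))
      then show ?thesis by (rule eventually_mono) (use True in simp)
    next
      case False
      then have neg: "s x < 0" using that by simp
      then have "\<forall>\<^sub>F p in at x. s p < 0" using s neg unfolding isCont_def by (intro order_tendstoD(2))
      then show ?thesis by (rule eventually_mono) (use neg in simp)
    qed
    then have "\<forall>\<^sub>F p in nhds x. \<phi> (f p) \<in> {- c * sgn (s x)}"
      unfolding eventually_at_filter by (rule eventually_mono) (auto simp: f)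
    from filippov_set_closed_convex[OF d \<phi> _ _ this] show ?thesis by simp
  qed
  show "s x * \<phi> d = - c * \<bar>s x\<bar>"
    using * by (cases "s x = 0") (auto simp: abs_sgn mult_ac)
qed

section \<open>Signed powers and quaternion products\<close>

text \<open>
  The sign function is discontinuous at 0. Writing the signed power as a difference of powers of
  positive and negative parts exhibits the continuity there.
\<close>

lemma spow_isCont: "0 < \<alpha> \<Longrightarrow> isCont (spow \<alpha>) x"
proof -
  assume \<alpha>: "0 < \<alpha>"
  have eq: "spow \<alpha> = (\<lambda>x. (max x 0) powr \<alpha> - (max (- x) 0) powr \<alpha>)"
    using \<alpha> by (auto simp: spow_def fun_eq_iff max_def sgn_if)
  have "isCont (\<lambda>x. (max x 0) powr \<alpha>) x" for x :: real
    using \<alpha> continuous_on_powr'[of UNIV "\<lambda>x. max x 0" "\<lambda>_. \<alpha>"]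
    by (auto simp: continuous_on_eq_continuous_at intro!: continuous_intros)
  moreover have "isCont (\<lambda>x. (max (- x) 0) powr \<alpha>) x" for x :: real
    using \<alpha> continuous_on_powr'[of UNIV "\<lambda>x. max (- x) 0" "\<lambda>_. \<alpha>"]
    by (auto simp: continuous_on_eq_continuous_at intro!: continuous_intros)
  ultimately show ?thesis unfolding eq by (intro continuous_diff)
qed

lemma spow_mult_self: "x * spow \<alpha> x = \<bar>x\<bar> powr (1 + \<alpha>)"
  by (simp add: spow_def powr_add mult.assoc[symmetric] abs_sgn[symmetric])

lemma vspow_isCont: "0 < \<alpha> \<Longrightarrow> isCont (vspow \<alpha>) (x :: real ^ 'k)"
  unfolding vspow_def isCont_def
  by (intro tendsto_vec_lambda isCont_tendsto_compose[OF spow_isCont] tendsto_vec_nth tendsto_ident_at)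

lemma qmult_pure_nth:
  "qmult p (pure_quat v) $ 1 = - (p $ 2 * v $ 1 + p $ 3 * v $ 2 + p $ 4 * v $ 3)"
  "qmult p (pure_quat v) $ 2 = p $ 1 * v $ 1 + p $ 3 * v $ 3 - p $ 4 * v $ 2"
  "qmult p (pure_quat v) $ 3 = p $ 1 * v $ 2 + p $ 4 * v $ 1 - p $ 2 * v $ 3"
  "qmult p (pure_quat v) $ 4 = p $ 1 * v $ 3 + p $ 2 * v $ 2 - p $ 3 * v $ 1"
  by (simp_all add: qmult_def pure_quat_def quat_scal_def quat_vec_def cross3_def inner_vec_def sum_3)

lemma norm_qmult_pure: "norm (qmult p (pure_quat v)) = norm p * norm v"
proof -
  have "(norm (qmult p (pure_quat v)))\<^sup>2 = (norm p * norm v)\<^sup>2"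
    by (simp add: power_mult_distrib power2_norm_eq_inner inner_vec_def sum_4 sum_3 qmult_pure_nth algebra_simps)
  then show ?thesis by simp
qed

lemma bounded_bilinear_qmult_pure: "bounded_bilinear (\<lambda>p v. qmult p (pure_quat v))"
proof (rule bounded_bilinear.intro)
  show "\<exists>K. \<forall>a b. norm (qmult a (pure_quat b)) \<le> norm a * norm b * K"
    by (intro exI[of _ 1]) (simp add: norm_qmult_pure)
qed (simp_all add: vec_eq_iff forall_4 qmult_pure_nth algebra_simps)

text \<open>
  Right multiplication by a pure quaternion generates rotations, so it is a skew map on \<real>^4.
\<close>

lemma qmult_pure_skew: "p \<bullet> qmult q (pure_quat v) = - (qmult p (pure_quat v) \<bullet> q)"
  by (simp add: inner_vec_def sum_4 qmult_pure_nth algebra_simps)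

section \<open>The velocities of an observer solution\<close>

lemma disagreement_tendsto [tendsto_intros]:
  assumes "(x \<longlongrightarrow> l) F" "(x0 \<longlongrightarrow> l0) F"
  shows "((\<lambda>p. disagreement A a\<^sub>0 (x p) (x0 p) i) \<longlongrightarrow> disagreement A a\<^sub>0 l l0 i) F"
  unfolding disagreement_def by (intro tendsto_intros assms)

lemma vspow_tendsto:
  assumes "0 < \<alpha>" "(x \<longlongrightarrow> l) F"
  shows "((\<lambda>p. vspow \<alpha> (x p)) \<longlongrightarrow> vspow \<alpha> l) F"
  using isCont_tendsto_compose[OF vspow_isCont[OF assms(1)] assms(2)] .

lemma filippov_set_observer:
  fixes P dP :: "real ^ 4 ^ 'n" and v z y w dv dz dy dw :: "real ^ 3 ^ 'n"
  assumes d: "(dP, dv, dz, dy, dw) \<in> filippov_set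
      (observer_field A a\<^sub>0 l\<^sub>1 l\<^sub>2 l\<^sub>3 \<beta>\<^sub>1 \<beta>\<^sub>2 \<mu>\<^sub>1 \<mu>\<^sub>2 Q\<^sub>0 \<omega>\<^sub>0 t) (P, v, z, y, w)"
    and \<beta>: "0 < \<beta>\<^sub>1" "0 < \<beta>\<^sub>2" and l: "0 \<le> l\<^sub>3" "0 \<le> \<mu>\<^sub>2 * a\<^sub>0 $ i"
  shows "dP $ i = (1/2) *\<^sub>R qmult (P $ i) (pure_quat (v $ i)) - l\<^sub>1 *\<^sub>R vspow \<beta>\<^sub>1 (disagreement A a\<^sub>0 P (Q\<^sub>0 t) i)"
    and "dv $ i = z $ i - l\<^sub>2 *\<^sub>R vspow \<beta>\<^sub>2 (disagreement A a\<^sub>0 v (\<omega>\<^sub>0 t) i)"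
    and "dy $ i = - (\<mu>\<^sub>1 * a\<^sub>0 $ i) *\<^sub>R vspow (1/2) (y $ i - \<omega>\<^sub>0 t) + w $ i"
    and "\<bar>dz $ i $ k\<bar> \<le> l\<^sub>3"
    and "disagreement A a\<^sub>0 z (w $ i) i $ k * dz $ i $ k = - l\<^sub>3 * \<bar>disagreement A a\<^sub>0 z (w $ i) i $ k\<bar>"
    and "\<bar>dw $ i $ k\<bar> \<le> \<mu>\<^sub>2 * a\<^sub>0 $ i"
    and "y $ i $ k \<noteq> \<omega>\<^sub>0 t $ k \<Longrightarrow> dw $ i $ k = - (\<mu>\<^sub>2 * a\<^sub>0 $ i) * sgn (y $ i $ k - \<omega>\<^sub>0 t $ k)"
proof -
  let ?f = "observer_field A a\<^sub>0 l\<^sub>1 l\<^sub>2 l\<^sub>3 \<beta>\<^sub>1 \<beta>\<^sub>2 \<mu>\<^sub>1 \<mu>\<^sub>2 Q\<^sub>0 \<omega>\<^sub>0 t"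
  let ?x = "(P, v, z, y, w)"
  have bl: "bounded_linear (\<lambda>p. fst p :: real ^ 4 ^ 'n)"
     "bounded_linear (\<lambda>p. fst (snd p) :: real ^ 3 ^ 'n)"
     "bounded_linear (\<lambda>p. fst (snd (snd p)) :: real ^ 3 ^ 'n)"
     "bounded_linear (\<lambda>p. fst (snd (snd (snd p))) :: real ^ 3 ^ 'n)"
     "bounded_linear (\<lambda>p. snd (snd (snd (snd p))) :: real ^ 3 ^ 'n)"
    by (intro bounded_linear_fst bounded_linear_snd bounded_linear_fst_comp bounded_linear_snd_comp)+
  note ob = observer_field_def case_prod_beta fst_conv snd_conv
  have tp: "(fst \<longlongrightarrow> P) (at ?x)" "((\<lambda>p. fst (snd p)) \<longlongrightarrow> v) (at ?x)"
    "((\<lambda>p. fst (snd (snd p))) \<longlongrightarrow> z) (at ?x)"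
    "((\<lambda>p. fst (snd (snd (snd p)))) \<longlongrightarrow> y) (at ?x)"
    "((\<lambda>p. snd (snd (snd (snd p)))) \<longlongrightarrow> w) (at ?x)"
    by (auto intro!: tendsto_eq_intros)
  have "isCont (\<lambda>p. fst (?f p) $ i) ?x"
    unfolding isCont_def ob vec_lambda_beta
    by (intro tendsto_intros vspow_tendsto \<beta> bounded_bilinear.tendsto[OF bounded_bilinear_qmult_pure] tp)
  from filippov_set_continuous_part[OF d bounded_linear_compose[OF bounded_linear_vec_nth bl(1)] this]
  show "dP $ i = (1/2) *\<^sub>R qmult (P $ i) (pure_quat (v $ i)) - l\<^sub>1 *\<^sub>R vspow \<beta>\<^sub>1 (disagreement A a\<^sub>0 P (Q\<^sub>0 t) i)"
    by (simp add: ob)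
  have "isCont (\<lambda>p. fst (snd (?f p)) $ i) ?x"
    unfolding isCont_def ob vec_lambda_beta
    by (intro tendsto_intros vspow_tendsto \<beta> tp)
  from filippov_set_continuous_part[OF d bounded_linear_compose[OF bounded_linear_vec_nth bl(2)] this]
  show "dv $ i = z $ i - l\<^sub>2 *\<^sub>R vspow \<beta>\<^sub>2 (disagreement A a\<^sub>0 v (\<omega>\<^sub>0 t) i)"
    by (simp add: ob)
  have "isCont (\<lambda>p. fst (snd (snd (snd (?f p)))) $ i) ?x"
    unfolding isCont_def ob vec_lambda_beta
    by (intro tendsto_intros vspow_tendsto tp) simp
  from filippov_set_continuous_part[OF d bounded_linear_compose[OF bounded_linear_vec_nth bl(4)] this]
  show "dy $ i = - (\<mu>\<^sub>1 * a\<^sub>0 $ i) *\<^sub>R vspow (1/2) (y $ i - \<omega>\<^sub>0 t) + w $ i"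
    by (simp add: ob)
  have blz: "bounded_linear (\<lambda>p :: 'n obs_state. fst (snd (snd p)) $ i $ k)"
    by (intro bounded_linear_compose[OF bounded_linear_vec_nth] bl)
  have sz: "isCont (\<lambda>p :: 'n obs_state. disagreement A a\<^sub>0 (fst (snd (snd p))) (snd (snd (snd (snd p))) $ i) i $ k) ?x"
    unfolding isCont_def fst_conv snd_conv by (intro tendsto_intros tp)
  have fz: "fst (snd (snd (?f p))) $ i $ k = - l\<^sub>3 * sgn (disagreement A a\<^sub>0 (fst (snd (snd p))) (snd (snd (snd (snd p))) $ i) i $ k)" for p
    by (simp add: ob vsgn_def)
  show "\<bar>dz $ i $ k\<bar> \<le> l\<^sub>3"
    using filippov_set_sign_part(1)[OF d blz sz fz l(1)] by simp
  show "disagreement A a\<^sub>0 z (w $ i) i $ k * dz $ i $ k = - l\<^sub>3 * \<bar>disagreement A a\<^sub>0 z (w $ i) i $ k\<bar>"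
    using filippov_set_sign_part(3)[OF d blz sz fz l(1)] by simp
  have blw: "bounded_linear (\<lambda>p :: 'n obs_state. snd (snd (snd (snd p))) $ i $ k)"
    by (intro bounded_linear_compose[OF bounded_linear_vec_nth] bl)
  have sw: "isCont (\<lambda>p :: 'n obs_state. fst (snd (snd (snd p))) $ i $ k - \<omega>\<^sub>0 t $ k) ?x"
    unfolding isCont_def fst_conv snd_conv by (intro tendsto_intros tp)
  have fw: "snd (snd (snd (snd (?f p)))) $ i $ k = - (\<mu>\<^sub>2 * a\<^sub>0 $ i) * sgn (fst (snd (snd (snd p))) $ i $ k - \<omega>\<^sub>0 t $ k)" for p
    by (simp add: ob vsgn_def)
  show "\<bar>dw $ i $ k\<bar> \<le> \<mu>\<^sub>2 * a\<^sub>0 $ i"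
    using filippov_set_sign_part(1)[OF d blw sw fw l(2)] by simp
  show "dw $ i $ k = - (\<mu>\<^sub>2 * a\<^sub>0 $ i) * sgn (y $ i $ k - \<omega>\<^sub>0 t $ k)" if "y $ i $ k \<noteq> \<omega>\<^sub>0 t $ k"
    using filippov_set_sign_part(2)[OF d blw sw fw l(2)] that by simp
qed

lemma bounded_linear_replicate: "bounded_linear (\<lambda>q :: real ^ 'k. (\<chi> i. q) :: real ^ 'k ^ 'n)"
  by (simp add: linear_conv_bounded_linear[symmetric]) (rule linearI; simp add: vec_eq_iff)

lemma err_eq: "err x x0 = x - (\<chi> i. x0)"
  by (simp add: err_def vec_eq_iff)

lemma abs_cont_on_deriv_bounded:
  fixes f :: "real \<Rightarrow> 'a::real_normed_vector"
  assumes d: "\<And>t. 0 \<le> t \<Longrightarrow> (f has_vector_derivative f' t) (at t within {0..})"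
    and bound: "\<And>t. 0 \<le> t \<Longrightarrow> norm (f' t) \<le> K"
  shows "abs_cont_on {0..T} f"
proof (rule abs_cont_on_lipschitz[where L = K])
  fix u v :: real assume uv: "u \<in> {0..T}" "v \<in> {0..T}" "u \<le> v"
  have "norm (f v - f u) \<le> K * norm (v - u)"
  proof (rule differentiable_bound[where S = "{0..}" and f' = "\<lambda>t h. h *\<^sub>R f' t"])
    fix t :: real assume t: "t \<in> {0..}"
    show "(f has_derivative (\<lambda>h. h *\<^sub>R f' t)) (at t within {0..})"
      using d[of t] t by (simp add: has_vector_derivative_def)
    show "onorm (\<lambda>h. h *\<^sub>R f' t) \<le> K"
      using bound[of t] t by (intro onorm_le) (simp add: mult.commute[of K] mult_left_mono)
  qed (use uv in auto)
  then show "norm (f v - f u) \<le> K * (v - u)" using uv by simp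
qed

lemma norm_le_sqrt3_if_infnorm_le:
  fixes x :: "real ^ 3"
  assumes "infnorm x \<le> c"
  shows "norm x \<le> sqrt 3 * c"
proof -
  have "norm x \<le> sqrt 3 * infnorm x" using norm_le_infnorm[of x] by simp
  also have "\<dots> \<le> sqrt 3 * c" using assms by simp
  finally show ?thesis .
qed

lemma norm_le_entries:
  fixes x :: "real ^ 'k ^ 'n"
  assumes "\<And>i k. \<bar>x $ i $ k\<bar> \<le> c"
  shows "norm x \<le> real CARD('n) * (real CARD('k) * c)"
proof -
  have "norm x \<le> (\<Sum>i\<in>UNIV. norm (x $ i))" unfolding norm_vec_def by (rule L2_set_le_sum) simp
  also have "\<dots> \<le> (\<Sum>i\<in>(UNIV :: 'n set). real CARD('k) * c)"
  proof (rule sum_mono)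
    fix i
    have "norm (x $ i) \<le> (\<Sum>k\<in>UNIV. \<bar>x $ i $ k\<bar>)" by (rule norm_le_l1_cart)
    also have "\<dots> \<le> (\<Sum>k\<in>(UNIV :: 'k set). c)" by (rule sum_mono) (rule assms)
    finally show "norm (x $ i) \<le> real CARD('k) * c" by simp
  qed
  finally show ?thesis by simp
qed

lemma norm_le_sum_abs:
  fixes x :: "real ^ 'k ^ 'n"
  shows "norm x \<le> (\<Sum>i\<in>UNIV. \<Sum>k\<in>UNIV. \<bar>x $ i $ k\<bar>)"
proof -
  have "norm x \<le> (\<Sum>i\<in>UNIV. norm (x $ i))" unfolding norm_vec_def by (rule L2_set_le_sum) simp
  also have "\<dots> \<le> (\<Sum>i\<in>UNIV. \<Sum>k\<in>UNIV. \<bar>x $ i $ k\<bar>)" by (intro sum_mono norm_le_l1_cart)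
  finally show ?thesis .
qed

lemma square_powr_half: "(r\<^sup>2) powr (\<alpha> / 2) = \<bar>r\<bar> powr \<alpha>" for r :: real
proof (cases "r = 0")
  case False
  then have "r\<^sup>2 = \<bar>r\<bar> powr 2" by simp
  then have "(r\<^sup>2) powr (\<alpha> / 2) = \<bar>r\<bar> powr (2 * (\<alpha> / 2))" by (simp only: powr_powr)
  then show ?thesis by simp
qed simp

text \<open>
  The inner product is the sum of the (1 + \<beta>)-th powers of the absolute entries, which are
  (1 + \<beta>)/2-th powers of their squares. As the exponent (1 + \<beta>)/2 is at most 1, the power function
  is subadditive, and the sum is at least the same power of the sum of squares.
\<close>

lemma inner_vspow_ge:
  fixes x :: "real ^ 'k ^ 'n"
  assumes "0 \<le> \<beta>" "\<beta> \<le> 1"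
  shows "norm x powr (1 + \<beta>) \<le> x \<bullet> (\<chi> i. vspow \<beta> (x $ i))"
proof -
  have "norm x powr (1 + \<beta>) = ((norm x)\<^sup>2) powr ((1 + \<beta>) / 2)"
    by (simp add: square_powr_half)
  also have "(norm x)\<^sup>2 = (\<Sum>p\<in>UNIV. (x $ fst p $ snd p)\<^sup>2)"
    by (simp add: power2_norm_eq_inner inner_vec_def sum.cartesian_product' flip: UNIV_Times_UNIV power2_eq_square)
  also have "\<dots> powr ((1 + \<beta>) / 2) \<le> (\<Sum>p\<in>UNIV. ((x $ fst p $ snd p)\<^sup>2) powr ((1 + \<beta>) / 2))"
    using assms by (intro powr_sum_le) auto
  also have "\<dots> = (\<Sum>p\<in>UNIV. x $ fst p $ snd p * spow \<beta> (x $ fst p $ snd p))"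
  proof (rule sum.cong)
    fix p :: "'n \<times> 'k"
    show "((x $ fst p $ snd p)\<^sup>2) powr ((1 + \<beta>) / 2) = x $ fst p $ snd p * spow \<beta> (x $ fst p $ snd p)"
      by (simp only: square_powr_half spow_mult_self)
  qed simp
  also have "\<dots> = x \<bullet> (\<chi> i. vspow \<beta> (x $ i))"
    by (simp add: inner_vec_def vspow_def sum.cartesian_product' flip: UNIV_Times_UNIV)
  finally show ?thesis .
qed

section \<open>Dynamics of the errors\<close>

context coercive_operator
begin

text \<open>
  With \<alpha> = 1 + \<beta> the constant on the left is the one in c_rate.
\<close>

lemma energy_rate:
  assumes "0 \<le> \<alpha>"
  shows "(2 * \<sigma>\<^sup>2 / \<Sigma>) powr (\<alpha> / 2) * energy x powr (\<alpha> / 2) \<le> norm (B x) powr \<alpha>"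
proof -
  have "(2 * \<sigma>\<^sup>2 / \<Sigma>) powr (\<alpha> / 2) * energy x powr (\<alpha> / 2) = (2 * \<sigma>\<^sup>2 / \<Sigma> * energy x) powr (\<alpha> / 2)"
    using upper_pos energy_nonneg by (subst powr_mult) auto
  also have "2 * \<sigma>\<^sup>2 / \<Sigma> * energy x = (\<sigma> * sqrt (2 / \<Sigma>) * sqrt (energy x))\<^sup>2"
    using upper_pos energy_nonneg by (simp add: power_mult_distrib)
  also have "\<dots> powr (\<alpha> / 2) \<le> ((norm (B x))\<^sup>2) powr (\<alpha> / 2)"
    using assms lower_pos upper_pos energy_nonneg
    by (intro powr_mono2 power_mono norm_image_ge_energy) auto
  also have "\<dots> = norm (B x) powr \<alpha>" by (simp add: square_powr_half)
  finally show ?thesis .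
qed

end

lemma V_fun_energy:
  assumes "coercive_operator (block_mult H :: real ^ 'k ^ 'n \<Rightarrow> real ^ 'k ^ 'n) s S"
  shows "V_fun H x = coercive_operator.energy (block_mult H) (x :: real ^ 'k ^ 'n)"
  by (simp add: V_fun_eq coercive_operator.energy_def[OF assms])

text \<open>
  The map R that multiplies every block by u is skew and commutes with the operator B of H, so
  B e . R e = e . R (B e) = - R e . B e is its own negative.
\<close>

lemma inner_block_mult_qmult:
  fixes e :: "real ^ 4 ^ 'n"
  assumes B: "coercive_operator (block_mult H :: real ^ 4 ^ 'n \<Rightarrow> _) s S"
  shows "block_mult H e \<bullet> (\<chi> i. qmult (e $ i) (pure_quat u)) = 0"
proof -
  interpret B: coercive_operator "block_mult H :: real ^ 4 ^ 'n \<Rightarrow> _" s S by (rule B)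
  interpret q: bounded_bilinear "\<lambda>p v. qmult p (pure_quat v)" by (rule bounded_bilinear_qmult_pure)
  define R :: "real ^ 4 ^ 'n \<Rightarrow> real ^ 4 ^ 'n" where "R x = (\<chi> i. qmult (x $ i) (pure_quat u))" for x
  have skew: "x \<bullet> R x' = - (R x \<bullet> x')" for x x'
    by (simp add: R_def inner_vec_def[where 'a = "real ^ 4"] qmult_pure_skew sum_negf)
  have comm: "R (block_mult H x) = block_mult H (R x)" for x
    by (simp add: R_def block_mult_def vec_eq_iff q.sum_left q.scaleR_left)
  have "block_mult H e \<bullet> R e = e \<bullet> block_mult H (R e)" by (simp add: B.selfadjoint)
  also have "\<dots> = e \<bullet> R (block_mult H e)" by (simp add: comm)
  also have "\<dots> = - (R e \<bullet> block_mult H e)" by (rule skew)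
  also have "\<dots> = - (block_mult H e \<bullet> R e)" by (simp add: inner_commute)
  finally show ?thesis by (simp add: R_def)
qed

text \<open>
  This locale collects what is fixed before a solution (P, v, z) is chosen. Everything that determines
  t_r has to be defined here, since t_r must not depend on the solution.
\<close>

locale observer_network =
  fixes A :: "real ^ 'n ^ 'n" and a\<^sub>0 :: "real ^ 'n"
    and Q\<^sub>0 :: "real \<Rightarrow> real ^ 4" and \<omega>\<^sub>0 \<omega>\<^sub>0' \<omega>\<^sub>0'' :: "real \<Rightarrow> real ^ 3"
    and y w :: "real \<Rightarrow> real ^ 3 ^ 'n"
    and l\<^sub>1 l\<^sub>2 l\<^sub>3 \<beta>\<^sub>1 \<beta>\<^sub>2 \<mu>\<^sub>1 \<mu>\<^sub>2 \<gamma>\<^sub>1 \<gamma>\<^sub>2 \<gamma>\<^sub>3 :: real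
  assumes gains: "l\<^sub>1 > 0" "l\<^sub>2 > 0" "\<mu>\<^sub>1 > 0" "l\<^sub>3 > \<gamma>\<^sub>3" "\<mu>\<^sub>2 > \<gamma>\<^sub>3"
    and exponents: "0 < \<beta>\<^sub>1" "\<beta>\<^sub>1 < 1" "0 < \<beta>\<^sub>2" "\<beta>\<^sub>2 < 1"
    and followers: "undirected_weights A"
    and leader_links: "\<forall>i. a\<^sub>0 $ i = 0 \<or> a\<^sub>0 $ i = 1"
    and spanning: "spanned_from_leader A a\<^sub>0"
    and leader_attitude: "\<forall>t\<ge>0. Q\<^sub>0 t \<in> sphere 0 1"
      "\<forall>t\<ge>0. (Q\<^sub>0 has_vector_derivative (1/2) *\<^sub>R qmult (Q\<^sub>0 t) (pure_quat (\<omega>\<^sub>0 t)))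
                (at t within {0..})"
    and leader_velocity: "\<forall>t\<ge>0. (\<omega>\<^sub>0 has_vector_derivative \<omega>\<^sub>0' t) (at t within {0..})"
      "\<forall>t\<ge>0. (\<omega>\<^sub>0' has_vector_derivative \<omega>\<^sub>0'' t) (at t within {0..})"
    and leader_bounds: "\<forall>t\<ge>0. infnorm (\<omega>\<^sub>0 t) \<le> \<gamma>\<^sub>1" "\<forall>t\<ge>0. infnorm (\<omega>\<^sub>0' t) \<le> \<gamma>\<^sub>2"
      "\<forall>t\<ge>0. infnorm (\<omega>\<^sub>0'' t) \<le> \<gamma>\<^sub>3"
    and initial: "y 0 = 0" "w 0 = 0"
begin

abbreviation H where "H \<equiv> Hmat A a\<^sub>0"
abbreviation \<sigma> where "\<sigma> \<equiv> sv_min H"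
abbreviation \<Sigma> where "\<Sigma> \<equiv> sv_max H"

lemma H_coercive: "coercive_operator (block_mult H :: real ^ 'k ^ 'n \<Rightarrow> real ^ 'k ^ 'n) \<sigma> \<Sigma>"
  by (intro block_mult_coercive Hmat_symmetric Hmat_positive followers leader_links spanning)

sublocale E3: coercive_operator "block_mult H :: real ^ 3 ^ 'n \<Rightarrow> real ^ 3 ^ 'n" \<sigma> \<Sigma>
  by (rule H_coercive)

sublocale E4: coercive_operator "block_mult H :: real ^ 4 ^ 'n \<Rightarrow> real ^ 4 ^ 'n" \<sigma> \<Sigma>
  by (rule H_coercive)

lemma gamma_nonneg: "0 \<le> \<gamma>\<^sub>1" "0 \<le> \<gamma>\<^sub>2" "0 \<le> \<gamma>\<^sub>3"
  using leader_bounds[rule_format, of 0] infnorm_pos_le[of "\<omega>\<^sub>0 0"] infnorm_pos_le[of "\<omega>\<^sub>0' 0"] infnorm_pos_le[of "\<omega>\<^sub>0'' 0"]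
  by linarith+

lemma leader_abs_cont: "abs_cont_on {0..T} Q\<^sub>0" "abs_cont_on {0..T} \<omega>\<^sub>0" "abs_cont_on {0..T} \<omega>\<^sub>0'"
proof -
  note n = norm_le_sqrt3_if_infnorm_le
  show "abs_cont_on {0..T} \<omega>\<^sub>0"
    by (rule abs_cont_on_deriv_bounded[of _ \<omega>\<^sub>0' "sqrt 3 * \<gamma>\<^sub>2"]) (use leader_velocity leader_bounds n in auto)
  show "abs_cont_on {0..T} \<omega>\<^sub>0'"
    by (rule abs_cont_on_deriv_bounded[of _ \<omega>\<^sub>0'' "sqrt 3 * \<gamma>\<^sub>3"]) (use leader_velocity leader_bounds n in auto)
  show "abs_cont_on {0..T} Q\<^sub>0"
  proof (rule abs_cont_on_deriv_bounded[of _ "\<lambda>t. (1/2) *\<^sub>R qmult (Q\<^sub>0 t) (pure_quat (\<omega>\<^sub>0 t))" "sqrt 3 * \<gamma>\<^sub>1"])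
    fix t :: real assume t: "0 \<le> t"
    show "(Q\<^sub>0 has_vector_derivative (1/2) *\<^sub>R qmult (Q\<^sub>0 t) (pure_quat (\<omega>\<^sub>0 t))) (at t within {0..})"
      using leader_attitude t by blast
    have "norm (Q\<^sub>0 t) = 1" using leader_attitude(1) t by simp
    moreover have "norm (\<omega>\<^sub>0 t) \<le> sqrt 3 * \<gamma>\<^sub>1" using n leader_bounds(1) t by blast
    moreover have "norm ((1/2) *\<^sub>R qmult (Q\<^sub>0 t) (pure_quat (\<omega>\<^sub>0 t))) = (1/2) * norm (\<omega>\<^sub>0 t)"
      using \<open>norm (Q\<^sub>0 t) = 1\<close> by (simp add: norm_qmult_pure)
    ultimately show "norm ((1/2) *\<^sub>R qmult (Q\<^sub>0 t) (pure_quat (\<omega>\<^sub>0 t))) \<le> sqrt 3 * \<gamma>\<^sub>1"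
      using norm_ge_zero[of "\<omega>\<^sub>0 t"] by linarith
  qed
qed

lemma leader_derivatives:
  assumes "0 < t"
  shows "(Q\<^sub>0 has_vector_derivative (1/2) *\<^sub>R qmult (Q\<^sub>0 t) (pure_quat (\<omega>\<^sub>0 t))) (at t)"
    "(\<omega>\<^sub>0 has_vector_derivative \<omega>\<^sub>0' t) (at t)" "(\<omega>\<^sub>0' has_vector_derivative \<omega>\<^sub>0'' t) (at t)"
proof -
  have "at t within {0..} = at t" using assms by (intro at_within_interior) simp
  then show "(Q\<^sub>0 has_vector_derivative (1/2) *\<^sub>R qmult (Q\<^sub>0 t) (pure_quat (\<omega>\<^sub>0 t))) (at t)"
    "(\<omega>\<^sub>0 has_vector_derivative \<omega>\<^sub>0' t) (at t)" "(\<omega>\<^sub>0' has_vector_derivative \<omega>\<^sub>0'' t) (at t)"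
    using leader_attitude(2)[rule_format, of t] leader_velocity(1)[rule_format, of t]
      leader_velocity(2)[rule_format, of t] assms by simp_all
qed

end

lemma err_nth: "err x x0 $ i = x $ i - x0"
  by (simp add: err_def)

lemma err_has_vector_derivative:
  assumes "(x has_vector_derivative dx) (at t)" "(x0 has_vector_derivative dx0) (at t)"
  shows "((\<lambda>t. err (x t) (x0 t)) has_vector_derivative err dx dx0) (at t)"
  unfolding err_eq
  by (intro has_vector_derivative_diff assms bounded_linear.has_vector_derivative[OF bounded_linear_replicate])

lemma abs_cont_on_err:
  assumes "abs_cont_on S x" "abs_cont_on S x0"
  shows "abs_cont_on S (\<lambda>t. err (x t) (x0 t))"
  unfolding err_eq by (intro abs_cont_on_diff assms abs_cont_on_linear[OF bounded_linear_replicate])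

locale observer_solution =
  observer_network A a\<^sub>0 Q\<^sub>0 \<omega>\<^sub>0 \<omega>\<^sub>0' \<omega>\<^sub>0'' y w l\<^sub>1 l\<^sub>2 l\<^sub>3 \<beta>\<^sub>1 \<beta>\<^sub>2 \<mu>\<^sub>1 \<mu>\<^sub>2 \<gamma>\<^sub>1 \<gamma>\<^sub>2 \<gamma>\<^sub>3
  for A :: "real ^ 'n ^ 'n" and a\<^sub>0 Q\<^sub>0 \<omega>\<^sub>0 \<omega>\<^sub>0' \<omega>\<^sub>0'' y w l\<^sub>1 l\<^sub>2 l\<^sub>3 \<beta>\<^sub>1 \<beta>\<^sub>2 \<mu>\<^sub>1 \<mu>\<^sub>2 \<gamma>\<^sub>1 \<gamma>\<^sub>2 \<gamma>\<^sub>3 +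
  fixes P :: "real \<Rightarrow> real ^ 4 ^ 'n" and v z :: "real \<Rightarrow> real ^ 3 ^ 'n"
  assumes solution: "filippov_solution (observer_field A a\<^sub>0 l\<^sub>1 l\<^sub>2 l\<^sub>3 \<beta>\<^sub>1 \<beta>\<^sub>2 \<mu>\<^sub>1 \<mu>\<^sub>2 Q\<^sub>0 \<omega>\<^sub>0)
        (\<lambda>t. (P t, v t, z t, y t, w t))"
begin

abbreviation eP where "eP t \<equiv> err (P t) (Q\<^sub>0 t)"
abbreviation ev where "ev t \<equiv> err (v t) (\<omega>\<^sub>0 t)"
abbreviation ez where "ez t \<equiv> err (z t) (\<omega>\<^sub>0' t)"

lemma solution_abs_cont:
  assumes "0 \<le> T"
  shows "abs_cont_on {0..T} P" "abs_cont_on {0..T} v" "abs_cont_on {0..T} z"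
    "abs_cont_on {0..T} y" "abs_cont_on {0..T} w"
proof -
  have ac: "abs_cont_on {0..T} (\<lambda>t. (P t, v t, z t, y t, w t))"
    using solution assms by (simp add: filippov_solution_def)
  show "abs_cont_on {0..T} P"
    using abs_cont_on_linear[OF bounded_linear_fst ac] by simp
  show "abs_cont_on {0..T} v"
    using abs_cont_on_linear[OF bounded_linear_fst_comp[OF bounded_linear_snd] ac] by simp
  show "abs_cont_on {0..T} z"
    using abs_cont_on_linear[OF bounded_linear_fst_comp[OF bounded_linear_snd_comp[OF bounded_linear_snd]] ac] by simp
  show "abs_cont_on {0..T} y"
    using abs_cont_on_linear[OF bounded_linear_fst_comp[OF bounded_linear_snd_comp[OF bounded_linear_snd_comp[OF bounded_linear_snd]]] ac] by simp
  show "abs_cont_on {0..T} w"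
    using abs_cont_on_linear[OF bounded_linear_snd_comp[OF bounded_linear_snd_comp[OF bounded_linear_snd_comp[OF bounded_linear_snd]]] ac] by simp
qed

lemma error_abs_cont:
  assumes "0 \<le> a"
  shows "abs_cont_on {a..b} eP" "abs_cont_on {a..b} ev" "abs_cont_on {a..b} ez"
proof -
  have sub: "{a..b} \<subseteq> {0..max 0 b}" using assms by auto
  have "abs_cont_on {0..max 0 b} eP" "abs_cont_on {0..max 0 b} ev" "abs_cont_on {0..max 0 b} ez"
    by (intro abs_cont_on_err solution_abs_cont leader_abs_cont max.cobounded1)+
  then show "abs_cont_on {a..b} eP" "abs_cont_on {a..b} ev" "abs_cont_on {a..b} ez"
    using sub by (blast intro: abs_cont_on_subset)+
qed

lemma solution_derivatives:
  "AE t in lebesgue. 0 < t \<longrightarrow> (\<exists>dP dv dz dy dw.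
     (P has_vector_derivative dP) (at t) \<and> (v has_vector_derivative dv) (at t) \<and>
     (z has_vector_derivative dz) (at t) \<and> (y has_vector_derivative dy) (at t) \<and>
     (w has_vector_derivative dw) (at t) \<and>
     (dP, dv, dz, dy, dw) \<in> filippov_set
       (observer_field A a\<^sub>0 l\<^sub>1 l\<^sub>2 l\<^sub>3 \<beta>\<^sub>1 \<beta>\<^sub>2 \<mu>\<^sub>1 \<mu>\<^sub>2 Q\<^sub>0 \<omega>\<^sub>0 t) (P t, v t, z t, y t, w t))"
proof -
  have "AE t in lebesgue. 0 < t \<longrightarrow>
      (\<exists>d\<in>filippov_set (observer_field A a\<^sub>0 l\<^sub>1 l\<^sub>2 l\<^sub>3 \<beta>\<^sub>1 \<beta>\<^sub>2 \<mu>\<^sub>1 \<mu>\<^sub>2 Q\<^sub>0 \<omega>\<^sub>0 t) (P t, v t, z t, y t, w t).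
         ((\<lambda>t. (P t, v t, z t, y t, w t)) has_vector_derivative d) (at t))"
    using solution by (simp add: filippov_solution_def)
  then show ?thesis
  proof eventually_elim
    case (elim t)
    show ?case
    proof
      assume "0 < t"
      with elim obtain dP dv dz dy dw where
        d: "(dP, dv, dz, dy, dw) \<in> filippov_set (observer_field A a\<^sub>0 l\<^sub>1 l\<^sub>2 l\<^sub>3 \<beta>\<^sub>1 \<beta>\<^sub>2 \<mu>\<^sub>1 \<mu>\<^sub>2 Q\<^sub>0 \<omega>\<^sub>0 t) (P t, v t, z t, y t, w t)"
        and D: "((\<lambda>t. (P t, v t, z t, y t, w t)) has_vector_derivative (dP, dv, dz, dy, dw)) (at t)"
        by auto
      note s1 = bounded_linear.has_vector_derivative[OF bounded_linear_snd D, simplified]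
      note s2 = bounded_linear.has_vector_derivative[OF bounded_linear_snd s1, simplified]
      note s3 = bounded_linear.has_vector_derivative[OF bounded_linear_snd s2, simplified]
      have "(P has_vector_derivative dP) (at t)" "(v has_vector_derivative dv) (at t)"
        "(z has_vector_derivative dz) (at t)" "(y has_vector_derivative dy) (at t)" "(w has_vector_derivative dw) (at t)"
        using bounded_linear.has_vector_derivative[OF bounded_linear_fst D]
          bounded_linear.has_vector_derivative[OF bounded_linear_fst s1]
          bounded_linear.has_vector_derivative[OF bounded_linear_fst s2]
          bounded_linear.has_vector_derivative[OF bounded_linear_fst s3]
          bounded_linear.has_vector_derivative[OF bounded_linear_snd s3] by simp_all
      with d show "\<exists>dP dv dz dy dw.
     (P has_vector_derivative dP) (at t) \<and> (v has_vector_derivative dv) (at t) \<and>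
     (z has_vector_derivative dz) (at t) \<and> (y has_vector_derivative dy) (at t) \<and>
     (w has_vector_derivative dw) (at t) \<and>
     (dP, dv, dz, dy, dw) \<in> filippov_set
       (observer_field A a\<^sub>0 l\<^sub>1 l\<^sub>2 l\<^sub>3 \<beta>\<^sub>1 \<beta>\<^sub>2 \<mu>\<^sub>1 \<mu>\<^sub>2 Q\<^sub>0 \<omega>\<^sub>0 t) (P t, v t, z t, y t, w t)" by blast
    qed
  qed
qed

lemma gains_nonneg: "0 \<le> l\<^sub>3" "0 \<le> \<mu>\<^sub>2 * a\<^sub>0 $ i"
  using gains gamma_nonneg leader_links[rule_format, of i] by auto

text \<open>
  For any w the velocity of the z-error is bounded. Once w agrees with the leader acceleration at the
  linked followers, the argument of the sign feedback is exactly the disagreement of the errors, and the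
  gain l_3 dominates the leader jerk.
\<close>

lemma ez_derivative:
  "AE t in lebesgue. 0 < t \<longrightarrow> (\<exists>d. (ez has_vector_derivative d) (at t) \<and>
     norm d \<le> real CARD('n) * (3 * (l\<^sub>3 + \<gamma>\<^sub>3)) \<and>
     ((\<forall>i. a\<^sub>0 $ i = 1 \<longrightarrow> w t $ i = \<omega>\<^sub>0' t) \<longrightarrow>
        block_mult H (ez t) \<bullet> d \<le> - (l\<^sub>3 - \<gamma>\<^sub>3) * norm (block_mult H (ez t))))"
  using solution_derivatives
proof eventually_elim
  case (elim t)
  show ?case
  proof
    assume t: "0 < t"
    with elim obtain dP dv dz dy dw where dz: "(z has_vector_derivative dz) (at t)"
      and d: "(dP, dv, dz, dy, dw) \<in> filippov_set
       (observer_field A a\<^sub>0 l\<^sub>1 l\<^sub>2 l\<^sub>3 \<beta>\<^sub>1 \<beta>\<^sub>2 \<mu>\<^sub>1 \<mu>\<^sub>2 Q\<^sub>0 \<omega>\<^sub>0 t) (P t, v t, z t, y t, w t)" by blast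
    note F = filippov_set_observer[OF d exponents(1,3) gains_nonneg]
    let ?d = "err dz (\<omega>\<^sub>0'' t)"
    have "(ez has_vector_derivative ?d) (at t)"
      by (intro err_has_vector_derivative dz leader_derivatives t)
    moreover
    have \<omega>: "\<bar>\<omega>\<^sub>0'' t $ k\<bar> \<le> \<gamma>\<^sub>3" for k
      using component_le_infnorm_cart[of "\<omega>\<^sub>0'' t" k] leader_bounds(3) t by (meson less_eq_real_def order_trans)
    have "\<bar>?d $ i $ k\<bar> \<le> l\<^sub>3 + \<gamma>\<^sub>3" for i k
      using F(4)[of i k] \<omega>[of k] by (simp add: err_def)
    then have "norm ?d \<le> real CARD('n) * (real CARD(3) * (l\<^sub>3 + \<gamma>\<^sub>3))" by (rule norm_le_entries)
    then have "norm ?d \<le> real CARD('n) * (3 * (l\<^sub>3 + \<gamma>\<^sub>3))" by simp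
    moreover have "block_mult H (ez t) \<bullet> ?d \<le> - (l\<^sub>3 - \<gamma>\<^sub>3) * norm (block_mult H (ez t))"
      if settled: "\<forall>i. a\<^sub>0 $ i = 1 \<longrightarrow> w t $ i = \<omega>\<^sub>0' t"
    proof -
      let ?b = "block_mult H (ez t)"
      have b: "disagreement A a\<^sub>0 (z t) (w t $ i) i = ?b $ i" for i
        using settled leader_links[rule_format, of i]
        unfolding disagreement_err[OF followers, symmetric] by (auto simp: disagreement_def)
      have "?b \<bullet> ?d = (\<Sum>i\<in>UNIV. \<Sum>k\<in>UNIV. ?b $ i $ k * dz $ i $ k - ?b $ i $ k * \<omega>\<^sub>0'' t $ k)"
        by (simp add: inner_vec_def err_def right_diff_distrib)
      also have "\<dots> \<le> (\<Sum>i\<in>UNIV. \<Sum>k\<in>UNIV. - (l\<^sub>3 - \<gamma>\<^sub>3) * \<bar>?b $ i $ k\<bar>)"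
      proof (intro sum_mono)
        fix i k
        have "- (?b $ i $ k * \<omega>\<^sub>0'' t $ k) \<le> \<bar>?b $ i $ k\<bar> * \<bar>\<omega>\<^sub>0'' t $ k\<bar>"
          using abs_ge_minus_self[of "?b $ i $ k * \<omega>\<^sub>0'' t $ k"] by (simp add: abs_mult)
        also have "\<dots> \<le> \<bar>?b $ i $ k\<bar> * \<gamma>\<^sub>3" by (intro mult_left_mono \<omega>) simp
        finally show "?b $ i $ k * dz $ i $ k - ?b $ i $ k * \<omega>\<^sub>0'' t $ k \<le> - (l\<^sub>3 - \<gamma>\<^sub>3) * \<bar>?b $ i $ k\<bar>"
          using F(5)[of i k] unfolding b by (simp add: algebra_simps)
      qed
      also have "\<dots> = - (l\<^sub>3 - \<gamma>\<^sub>3) * (\<Sum>i\<in>UNIV. \<Sum>k\<in>UNIV. \<bar>?b $ i $ k\<bar>)"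
        by (simp only: sum_distrib_left)
      also have "\<dots> \<le> - (l\<^sub>3 - \<gamma>\<^sub>3) * norm ?b"
        using gains(4) norm_le_sum_abs[of ?b] by (intro mult_left_mono_neg) auto
      finally show ?thesis .
    qed
    ultimately show "\<exists>d. (ez has_vector_derivative d) (at t) \<and>
     norm d \<le> real CARD('n) * (3 * (l\<^sub>3 + \<gamma>\<^sub>3)) \<and>
     ((\<forall>i. a\<^sub>0 $ i = 1 \<longrightarrow> w t $ i = \<omega>\<^sub>0' t) \<longrightarrow>
        block_mult H (ez t) \<bullet> d \<le> - (l\<^sub>3 - \<gamma>\<^sub>3) * norm (block_mult H (ez t)))" by blast
  qed
qed

lemma ev_derivative:
  "AE t in lebesgue. 0 < t \<longrightarrow> (\<exists>d. (ev has_vector_derivative d) (at t) \<and>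
     block_mult H (ev t) \<bullet> d \<le> block_mult H (ev t) \<bullet> ez t
        - c_rate H l\<^sub>2 \<beta>\<^sub>2 * E3.energy (ev t) powr ((1 + \<beta>\<^sub>2) / 2))"
  using solution_derivatives
proof eventually_elim
  case (elim t)
  show ?case
  proof
    assume t: "0 < t"
    with elim obtain dP dv dz dy dw where dv: "(v has_vector_derivative dv) (at t)"
      and d: "(dP, dv, dz, dy, dw) \<in> filippov_set
       (observer_field A a\<^sub>0 l\<^sub>1 l\<^sub>2 l\<^sub>3 \<beta>\<^sub>1 \<beta>\<^sub>2 \<mu>\<^sub>1 \<mu>\<^sub>2 Q\<^sub>0 \<omega>\<^sub>0 t) (P t, v t, z t, y t, w t)" by blast
    note F = filippov_set_observer[OF d exponents(1,3) gains_nonneg]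
    let ?b = "block_mult H (ev t)"
    have "(ev has_vector_derivative err dv (\<omega>\<^sub>0' t)) (at t)"
      by (intro err_has_vector_derivative dv leader_derivatives t)
    moreover have "err dv (\<omega>\<^sub>0' t) = ez t - l\<^sub>2 *\<^sub>R (\<chi> i. vspow \<beta>\<^sub>2 (?b $ i))"
      by (simp add: vec_eq_iff[where 'b = 'n] err_nth F(2) disagreement_err[OF followers])
    moreover have "c_rate H l\<^sub>2 \<beta>\<^sub>2 * E3.energy (ev t) powr ((1 + \<beta>\<^sub>2) / 2) \<le> l\<^sub>2 * (?b \<bullet> (\<chi> i. vspow \<beta>\<^sub>2 (?b $ i)))"
      unfolding c_rate_def mult.assoc
      using E3.energy_rate[of "1 + \<beta>\<^sub>2" "ev t"] inner_vspow_ge[of \<beta>\<^sub>2 ?b] exponents gains(2)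
      by (intro mult_left_mono) auto
    ultimately show "\<exists>d. (ev has_vector_derivative d) (at t) \<and>
     ?b \<bullet> d \<le> ?b \<bullet> ez t - c_rate H l\<^sub>2 \<beta>\<^sub>2 * E3.energy (ev t) powr ((1 + \<beta>\<^sub>2) / 2)"
      by (intro exI[of _ "err dv (\<omega>\<^sub>0' t)"]) (simp add: inner_diff_right)
  qed
qed

text \<open>
  Write P v - Q_0 \<omega>_0 = (P - Q_0) \<omega>_0 + P (v - \<omega>_0) for the quaternion products. The first part is
  orthogonal to the gradient. For the second part the norm of P is at most r + 1, where r is the norm
  of the attitude error. The quadratic r (r + 1) / 2 is at most r^2 + 1/8, with equality for r = 1/2, and
  this choice produces the shift \<sigma> / 16 of the energy.
\<close>

lemma eP_derivative:
  "AE t in lebesgue. 0 < t \<longrightarrow> (\<exists>d. (eP has_vector_derivative d) (at t) \<and>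
     block_mult H (eP t) \<bullet> d \<le> (2 * \<Sigma> / \<sigma>) * norm (ev t) * (E4.energy (eP t) + \<sigma> / 16)
        - c_rate H l\<^sub>1 \<beta>\<^sub>1 * E4.energy (eP t) powr ((1 + \<beta>\<^sub>1) / 2))"
  using solution_derivatives
proof eventually_elim
  case (elim t)
  show ?case
  proof
    assume t: "0 < t"
    with elim obtain dP dv dz dy dw where dP: "(P has_vector_derivative dP) (at t)"
      and d: "(dP, dv, dz, dy, dw) \<in> filippov_set
       (observer_field A a\<^sub>0 l\<^sub>1 l\<^sub>2 l\<^sub>3 \<beta>\<^sub>1 \<beta>\<^sub>2 \<mu>\<^sub>1 \<mu>\<^sub>2 Q\<^sub>0 \<omega>\<^sub>0 t) (P t, v t, z t, y t, w t)" by blast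
    note F = filippov_set_observer[OF d exponents(1,3) gains_nonneg]
    interpret q: bounded_bilinear "\<lambda>p v. qmult p (pure_quat v)" by (rule bounded_bilinear_qmult_pure)
    let ?b = "block_mult H (eP t)"
    let ?dQ = "(1/2) *\<^sub>R qmult (Q\<^sub>0 t) (pure_quat (\<omega>\<^sub>0 t))"
    let ?R = "(\<chi> i. qmult (eP t $ i) (pure_quat (\<omega>\<^sub>0 t))) :: real ^ 4 ^ 'n"
    define S :: "real ^ 4 ^ 'n" where "S = (\<chi> i. qmult (P t $ i) (pure_quat (ev t $ i)))"
    have D: "(eP has_vector_derivative err dP ?dQ) (at t)"
      by (intro err_has_vector_derivative dP leader_derivatives t)
    have split: "err dP ?dQ = (1/2) *\<^sub>R (?R + S) - l\<^sub>1 *\<^sub>R (\<chi> i. vspow \<beta>\<^sub>1 (?b $ i))"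
    proof -
      have "err dP ?dQ $ i = (1/2) *\<^sub>R (?R $ i + S $ i) - l\<^sub>1 *\<^sub>R vspow \<beta>\<^sub>1 (?b $ i)" for i
      proof -
        have "err dP ?dQ $ i = (1/2) *\<^sub>R (qmult (P t $ i) (pure_quat (v t $ i)) - qmult (Q\<^sub>0 t) (pure_quat (\<omega>\<^sub>0 t)))
            - l\<^sub>1 *\<^sub>R vspow \<beta>\<^sub>1 (?b $ i)"
          by (simp add: err_nth F(1) disagreement_err[OF followers] scaleR_diff_right)
        also have "qmult (P t $ i) (pure_quat (v t $ i)) - qmult (Q\<^sub>0 t) (pure_quat (\<omega>\<^sub>0 t)) = ?R $ i + S $ i"
          by (simp add: err_nth S_def q.diff_left q.diff_right)
        finally show ?thesis .
      qed
      then show ?thesis by (simp add: vec_eq_iff[where 'b = 'n])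
    qed
    have S: "norm S \<le> (norm (eP t) + 1) * norm (ev t)"
    proof -
      have "norm S \<le> norm ((norm (eP t) + 1) *\<^sub>R ev t)"
      proof (rule norm_le_componentwise_cart)
        fix i
        have "norm (P t $ i) = norm (eP t $ i + Q\<^sub>0 t)" by (simp add: err_def)
        also have "\<dots> \<le> norm (eP t $ i) + norm (Q\<^sub>0 t)" by (rule norm_triangle_ineq)
        also have "\<dots> \<le> norm (eP t) + 1"
          using leader_attitude(1) t Finite_Cartesian_Product.norm_nth_le[of "eP t" i] by simp
        finally have "norm (P t $ i) \<le> norm (eP t) + 1" .
        then show "norm (S $ i) \<le> norm (((norm (eP t) + 1) *\<^sub>R ev t) $ i)"
          by (simp add: S_def norm_qmult_pure mult_right_mono)
      qed
      then show ?thesis by simp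
    qed
    have "?b \<bullet> err dP ?dQ = (1/2) * (?b \<bullet> S) - l\<^sub>1 * (?b \<bullet> (\<chi> i. vspow \<beta>\<^sub>1 (?b $ i)))"
      unfolding split by (simp add: inner_diff_right inner_add_right inner_block_mult_qmult[OF H_coercive])
    moreover have "c_rate H l\<^sub>1 \<beta>\<^sub>1 * E4.energy (eP t) powr ((1 + \<beta>\<^sub>1) / 2) \<le> l\<^sub>1 * (?b \<bullet> (\<chi> i. vspow \<beta>\<^sub>1 (?b $ i)))"
      unfolding c_rate_def mult.assoc
      using E4.energy_rate[of "1 + \<beta>\<^sub>1" "eP t"] inner_vspow_ge[of \<beta>\<^sub>1 ?b] exponents gains(1)
      by (intro mult_left_mono) auto
    moreover have "(1/2) * (?b \<bullet> S) \<le> (2 * \<Sigma> / \<sigma>) * norm (ev t) * (E4.energy (eP t) + \<sigma> / 16)"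
    proof -
      define r where "r = norm (eP t)"
      define u where "u = norm (ev t)"
      have nn: "0 \<le> r" "0 \<le> u" "0 < \<sigma>" "0 < \<Sigma>" using E4.lower_pos E4.upper_pos by (auto simp: r_def u_def)
      have "?b \<bullet> S \<le> norm ?b * norm S" by (rule norm_cauchy_schwarz)
      also have "\<dots> \<le> (\<Sigma> * r) * ((r + 1) * u)"
        using E4.norm_image_le[of "eP t"] S nn unfolding r_def u_def by (intro mult_mono) auto
      finally have "(1/2) * (?b \<bullet> S) \<le> \<Sigma> * u * ((1/2) * (r * (r + 1)))" by (simp add: mult_ac)
      also have "\<dots> \<le> \<Sigma> * u * (r\<^sup>2 + 1/8)"
      proof (rule mult_left_mono)
        have "0 \<le> (r - 1/2)\<^sup>2" by simp
        then show "(1/2) * (r * (r + 1)) \<le> r\<^sup>2 + 1/8" by (simp add: power2_eq_square algebra_simps)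
      qed (use nn in simp)
      also have "\<dots> \<le> \<Sigma> * u * ((2 / \<sigma>) * (E4.energy (eP t) + \<sigma> / 16))"
      proof (rule mult_left_mono)
        have "r\<^sup>2 \<le> 2 / \<sigma> * E4.energy (eP t)"
          using E4.energy_lower[of "eP t"] nn by (simp add: r_def field_simps)
        then show "r\<^sup>2 + 1/8 \<le> (2 / \<sigma>) * (E4.energy (eP t) + \<sigma> / 16)" using nn by (simp add: distrib_left)
      qed (use nn in simp)
      also have "\<dots> = (2 * \<Sigma> / \<sigma>) * u * (E4.energy (eP t) + \<sigma> / 16)" by (simp only: times_divide_eq_left times_divide_eq_right mult_ac)
      finally show ?thesis by (simp only: u_def)
    qed
    ultimately show "\<exists>d. (eP has_vector_derivative d) (at t) \<and>
     ?b \<bullet> d \<le> (2 * \<Sigma> / \<sigma>) * norm (ev t) * (E4.energy (eP t) + \<sigma> / 16)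
        - c_rate H l\<^sub>1 \<beta>\<^sub>1 * E4.energy (eP t) powr ((1 + \<beta>\<^sub>1) / 2)"
      using D by (intro exI[of _ "err dP ?dQ"]) simp
  qed
qed

end

section \<open>Evolution of the energies\<close>

context observer_network
begin

text \<open>
  A bound, valid for every w, on the growth rate of the square root of V_z. It comes from the Euclidean
  norm of the velocity of the z-error, estimated by the sum of its 3 n entries.
\<close>

definition drift :: real where
  "drift = sqrt (2 * \<Sigma>) * (real CARD('n) * (3 * (l\<^sub>3 + \<gamma>\<^sub>3))) / 2"

text \<open>
  An upper bound for the amount by which the square root of V_v can exceed the square root of
  Gamma_v(T_z) because of the growth of the z-error before t_0.
\<close>

definition overshoot :: "real \<Rightarrow> real" where
  "overshoot t\<^sub>0 = drift * t\<^sub>0 * t\<^sub>0 + 2 * (drift * t\<^sub>0)\<^sup>2 / c_z H l\<^sub>3 \<gamma>\<^sub>3"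

text \<open>
  The time in which the decay of V_v makes up for the overshoot. By subadditivity of the power
  1 - \<beta>_2, an excess M over any level b is a difference of at most M powr (1 - \<beta>_2) in the quantity that
  decreases at a constant rate, so this time does not depend on b.
\<close>

definition catch_up :: "real \<Rightarrow> real" where
  "catch_up t\<^sub>0 = overshoot t\<^sub>0 powr (1 - \<beta>\<^sub>2) / ((1 - \<beta>\<^sub>2) / 2 * c_rate H l\<^sub>2 \<beta>\<^sub>2)"

lemma drift_nonneg: "0 \<le> drift"
  using gains gamma_nonneg E3.upper_pos by (simp add: drift_def)

lemma c_z_pos: "0 < c_z H l\<^sub>3 \<gamma>\<^sub>3"
  using gains E3.upper_pos E3.lower_pos by (simp add: c_z_def)

lemma c_rate_pos: "0 < l \<Longrightarrow> 0 < c_rate H l \<beta>"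
  using E3.upper_pos E3.lower_pos by (simp add: c_rate_def)

lemma overshoot_nonneg: "0 \<le> t\<^sub>0 \<Longrightarrow> 0 \<le> overshoot t\<^sub>0"
  using drift_nonneg c_z_pos by (simp add: overshoot_def)

lemma catch_up_nonneg: "0 \<le> catch_up t\<^sub>0"
  using exponents c_rate_pos[OF gains(2), of \<beta>\<^sub>2] by (simp add: catch_up_def)

end

context observer_solution
begin

abbreviation Vz where "Vz t \<equiv> E3.energy (ez t)"
abbreviation Vv where "Vv t \<equiv> E3.energy (ev t)"
abbreviation VP where "VP t \<equiv> E4.energy (eP t)"

lemma Vz_growth:
  assumes "0 \<le> t"
  shows "sqrt (Vz t) \<le> sqrt (Vz 0) + drift * t"
proof -
  have "sqrt (Vz t) \<le> sqrt (Vz 0) + drift * (t - 0)"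
  proof (rule sqrt_growth[OF _ assms drift_nonneg])
    show "abs_cont_on {0..t} Vz" by (intro E3.energy_abs_cont error_abs_cont) simp
    show "AE s in lebesgue. 0 < s \<and> s < t \<longrightarrow>
       (\<exists>d. (Vz has_real_derivative d) (at s) \<and> d \<le> 2 * drift * sqrt (Vz s))"
      using ez_derivative
    proof eventually_elim
      case (elim s)
      show ?case
      proof
        assume "0 < s \<and> s < t"
        with elim obtain d where d: "(ez has_vector_derivative d) (at s)" "norm d \<le> real CARD('n) * (3 * (l\<^sub>3 + \<gamma>\<^sub>3))" by blast
        have "block_mult H (ez s) \<bullet> d \<le> norm (block_mult H (ez s)) * norm d" by (rule norm_cauchy_schwarz)
        also have "\<dots> \<le> (sqrt (2 * \<Sigma>) * sqrt (Vz s)) * (real CARD('n) * (3 * (l\<^sub>3 + \<gamma>\<^sub>3)))"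
          using E3.norm_image_le_energy[of "ez s"] d(2) E3.upper_pos E3.energy_nonneg by (intro mult_mono) auto
        also have "\<dots> = 2 * drift * sqrt (Vz s)" by (simp add: drift_def)
        finally show "\<exists>d. (Vz has_real_derivative d) (at s) \<and> d \<le> 2 * drift * sqrt (Vz s)"
          using E3.energy_derivative[OF d(1)] by blast
      qed
    qed
  qed (rule E3.energy_nonneg)
  then show ?thesis by simp
qed

lemma Vz_decay:
  assumes settled: "settled_from a\<^sub>0 \<omega>\<^sub>0' w t\<^sub>0" and "t\<^sub>0 \<le> t"
  shows "sqrt (Vz t) \<le> max 0 (sqrt (Vz t\<^sub>0) - c_z H l\<^sub>3 \<gamma>\<^sub>3 / 2 * (t - t\<^sub>0))"
proof -
  have t0: "0 \<le> t\<^sub>0" and set: "\<And>s i. t\<^sub>0 \<le> s \<Longrightarrow> a\<^sub>0 $ i = 1 \<Longrightarrow> w s $ i = \<omega>\<^sub>0' s"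
    using settled by (auto simp: settled_from_def)
  have "Vz t powr (1 - 1/2) \<le> max 0 (Vz t\<^sub>0 powr (1 - 1/2) - (1 - 1/2) * c_z H l\<^sub>3 \<gamma>\<^sub>3 * (t - t\<^sub>0))"
  proof (rule finite_time_decay[OF _ \<open>t\<^sub>0 \<le> t\<close> less_imp_le[OF c_z_pos]])
    show "abs_cont_on {t\<^sub>0..t} Vz" by (intro E3.energy_abs_cont error_abs_cont t0)
    show "AE s in lebesgue. t\<^sub>0 < s \<and> s < t \<longrightarrow>
       (\<exists>d. (Vz has_real_derivative d) (at s) \<and> d \<le> - c_z H l\<^sub>3 \<gamma>\<^sub>3 * Vz s powr (1/2))"
      using ez_derivative
    proof eventually_elim
      case (elim s)
      show ?case
      proof
        assume s: "t\<^sub>0 < s \<and> s < t"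
        with elim t0 set obtain d where d: "(ez has_vector_derivative d) (at s)"
          "block_mult H (ez s) \<bullet> d \<le> - (l\<^sub>3 - \<gamma>\<^sub>3) * norm (block_mult H (ez s))"
          by (meson less_imp_le order_le_less_trans)
        have "(l\<^sub>3 - \<gamma>\<^sub>3) * (\<sigma> * sqrt (2 / \<Sigma>) * sqrt (Vz s)) \<le> (l\<^sub>3 - \<gamma>\<^sub>3) * norm (block_mult H (ez s))"
          using gains(4) by (intro mult_left_mono E3.norm_image_ge_energy) auto
        moreover have "Vz s powr (1/2) = sqrt (Vz s)" by (simp add: powr_half_sqrt E3.energy_nonneg)
        ultimately have "c_z H l\<^sub>3 \<gamma>\<^sub>3 * Vz s powr (1/2) \<le> (l\<^sub>3 - \<gamma>\<^sub>3) * norm (block_mult H (ez s))"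
          by (simp add: c_z_def mult.assoc)
        then have "block_mult H (ez s) \<bullet> d \<le> - c_z H l\<^sub>3 \<gamma>\<^sub>3 * Vz s powr (1/2)"
          using d(2) unfolding mult_minus_left by linarith
        then show "\<exists>d. (Vz has_real_derivative d) (at s) \<and> d \<le> - c_z H l\<^sub>3 \<gamma>\<^sub>3 * Vz s powr (1/2)"
          using E3.energy_derivative[OF d(1)] by blast
      qed
    qed
  qed (auto simp: E3.energy_nonneg)
  then show ?thesis by (simp add: powr_half_sqrt E3.energy_nonneg)
qed

lemma Vv_growth:
  assumes "0 \<le> a" "a \<le> b" "0 \<le> h" and h: "\<And>t. t \<in> {a..b} \<Longrightarrow> sqrt (Vz t) \<le> h"
  shows "sqrt (Vv b) \<le> sqrt (Vv a) + h * (b - a)"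
proof (rule sqrt_growth[OF _ assms(2,3)])
  show "abs_cont_on {a..b} Vv" by (intro E3.energy_abs_cont error_abs_cont assms)
  show "AE s in lebesgue. a < s \<and> s < b \<longrightarrow>
       (\<exists>d. (Vv has_real_derivative d) (at s) \<and> d \<le> 2 * h * sqrt (Vv s))"
    using ev_derivative
  proof eventually_elim
    case (elim s)
    show ?case
    proof
      assume s: "a < s \<and> s < b"
      with elim \<open>0 \<le> a\<close> obtain d where d: "(ev has_vector_derivative d) (at s)"
        "block_mult H (ev s) \<bullet> d \<le> block_mult H (ev s) \<bullet> ez s - c_rate H l\<^sub>2 \<beta>\<^sub>2 * Vv s powr ((1 + \<beta>\<^sub>2) / 2)"
        by (meson order_le_less_trans)
      have "0 \<le> c_rate H l\<^sub>2 \<beta>\<^sub>2 * Vv s powr ((1 + \<beta>\<^sub>2) / 2)" using c_rate_pos[OF gains(2)] by (simp add: less_imp_le)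
      then have "block_mult H (ev s) \<bullet> d \<le> ev s \<bullet> block_mult H (ez s)"
        using d(2) E3.selfadjoint[of "ev s" "ez s"] by linarith
      also have "\<dots> \<le> 2 * sqrt (Vv s) * sqrt (Vz s)" by (rule E3.form_cauchy_schwarz)
      also have "\<dots> \<le> 2 * sqrt (Vv s) * h" using h[of s] s E3.energy_nonneg by (intro mult_left_mono) auto
      finally show "\<exists>d. (Vv has_real_derivative d) (at s) \<and> d \<le> 2 * h * sqrt (Vv s)"
        using E3.energy_derivative[OF d(1)] by (auto simp: mult_ac)
    qed
  qed
qed (rule E3.energy_nonneg)

lemma Vv_decay:
  assumes "0 \<le> a" "a \<le> b" and ez: "\<And>t. t \<in> {a..b} \<Longrightarrow> ez t = 0"
  shows "Vv b powr ((1 - \<beta>\<^sub>2) / 2) \<le>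
    max 0 (Vv a powr ((1 - \<beta>\<^sub>2) / 2) - (1 - \<beta>\<^sub>2) / 2 * c_rate H l\<^sub>2 \<beta>\<^sub>2 * (b - a))"
proof -
  have e: "1 - (1 + \<beta>\<^sub>2) / 2 = (1 - \<beta>\<^sub>2) / 2" by (simp add: field_simps)
  show ?thesis unfolding e[symmetric]
  proof (rule finite_time_decay[OF _ assms(2) less_imp_le[OF c_rate_pos[OF gains(2)]]])
    show "abs_cont_on {a..b} Vv" by (intro E3.energy_abs_cont error_abs_cont assms)
    show "AE s in lebesgue. a < s \<and> s < b \<longrightarrow>
       (\<exists>d. (Vv has_real_derivative d) (at s) \<and> d \<le> - c_rate H l\<^sub>2 \<beta>\<^sub>2 * Vv s powr ((1 + \<beta>\<^sub>2) / 2))"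
      using ev_derivative
    proof eventually_elim
      case (elim s)
      show ?case
      proof
        assume s: "a < s \<and> s < b"
        with elim \<open>0 \<le> a\<close> obtain d where d: "(ev has_vector_derivative d) (at s)"
          "block_mult H (ev s) \<bullet> d \<le> block_mult H (ev s) \<bullet> ez s - c_rate H l\<^sub>2 \<beta>\<^sub>2 * Vv s powr ((1 + \<beta>\<^sub>2) / 2)"
          by (meson order_le_less_trans)
        then show "\<exists>d. (Vv has_real_derivative d) (at s) \<and> d \<le> - c_rate H l\<^sub>2 \<beta>\<^sub>2 * Vv s powr ((1 + \<beta>\<^sub>2) / 2)"
          using E3.energy_derivative[OF d(1)] ez[of s] s by auto
      qed
    qed
  qed (use exponents in \<open>auto simp: E3.energy_nonneg\<close>)
qed

lemma VP_growth:
  assumes "0 \<le> a" "a \<le> b" and g: "\<And>t. t \<in> {a..b} \<Longrightarrow> norm (ev t) \<le> g"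
  shows "VP b + \<sigma> / 16 \<le> (VP a + \<sigma> / 16) * exp (2 * \<Sigma> / \<sigma> * g * (b - a))"
proof (rule exponential_growth[OF _ assms(2)])
  show "abs_cont_on {a..b} (\<lambda>t. VP t + \<sigma> / 16)"
    by (intro abs_cont_on_add abs_cont_on_const E4.energy_abs_cont error_abs_cont assms)
  show "AE s in lebesgue. a < s \<and> s < b \<longrightarrow>
       (\<exists>d. ((\<lambda>t. VP t + \<sigma> / 16) has_real_derivative d) (at s) \<and> d \<le> 2 * \<Sigma> / \<sigma> * g * (VP s + \<sigma> / 16))"
    using eP_derivative
  proof eventually_elim
    case (elim s)
    show ?case
    proof
      assume s: "a < s \<and> s < b"
      with elim \<open>0 \<le> a\<close> obtain d where d: "(eP has_vector_derivative d) (at s)"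
        "block_mult H (eP s) \<bullet> d \<le> (2 * \<Sigma> / \<sigma>) * norm (ev s) * (VP s + \<sigma> / 16)
        - c_rate H l\<^sub>1 \<beta>\<^sub>1 * VP s powr ((1 + \<beta>\<^sub>1) / 2)"
        by (meson order_le_less_trans)
      have "0 \<le> c_rate H l\<^sub>1 \<beta>\<^sub>1 * VP s powr ((1 + \<beta>\<^sub>1) / 2)" using c_rate_pos[OF gains(1)] by (simp add: less_imp_le)
      then have "block_mult H (eP s) \<bullet> d \<le> (2 * \<Sigma> / \<sigma>) * norm (ev s) * (VP s + \<sigma> / 16)" using d(2) by linarith
      also have "\<dots> \<le> (2 * \<Sigma> / \<sigma>) * g * (VP s + \<sigma> / 16)"
        using g[of s] s E4.upper_pos E4.lower_pos E4.energy_nonneg[of "eP s"]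
        by (intro mult_right_mono mult_left_mono) auto
      finally show "\<exists>d. ((\<lambda>t. VP t + \<sigma> / 16) has_real_derivative d) (at s) \<and> d \<le> 2 * \<Sigma> / \<sigma> * g * (VP s + \<sigma> / 16)"
        using E4.energy_derivative[OF d(1)] by (intro exI conjI) (auto intro!: derivative_eq_intros)
    qed
  qed
qed

lemma VP_decay:
  assumes "0 \<le> a" "a \<le> b" and ev: "\<And>t. t \<in> {a..b} \<Longrightarrow> ev t = 0"
  shows "VP b powr ((1 - \<beta>\<^sub>1) / 2) \<le>
    max 0 (VP a powr ((1 - \<beta>\<^sub>1) / 2) - (1 - \<beta>\<^sub>1) / 2 * c_rate H l\<^sub>1 \<beta>\<^sub>1 * (b - a))"
proof -
  have e: "1 - (1 + \<beta>\<^sub>1) / 2 = (1 - \<beta>\<^sub>1) / 2" by (simp add: field_simps)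
  show ?thesis unfolding e[symmetric]
  proof (rule finite_time_decay[OF _ assms(2) less_imp_le[OF c_rate_pos[OF gains(1)]]])
    show "abs_cont_on {a..b} VP" by (intro E4.energy_abs_cont error_abs_cont assms)
    show "AE s in lebesgue. a < s \<and> s < b \<longrightarrow>
       (\<exists>d. (VP has_real_derivative d) (at s) \<and> d \<le> - c_rate H l\<^sub>1 \<beta>\<^sub>1 * VP s powr ((1 + \<beta>\<^sub>1) / 2))"
      using eP_derivative
    proof eventually_elim
      case (elim s)
      show ?case
      proof
        assume s: "a < s \<and> s < b"
        with elim \<open>0 \<le> a\<close> obtain d where d: "(eP has_vector_derivative d) (at s)"
          "block_mult H (eP s) \<bullet> d \<le> (2 * \<Sigma> / \<sigma>) * norm (ev s) * (VP s + \<sigma> / 16)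
            - c_rate H l\<^sub>1 \<beta>\<^sub>1 * VP s powr ((1 + \<beta>\<^sub>1) / 2)"
          by (meson order_le_less_trans)
        then show "\<exists>d. (VP has_real_derivative d) (at s) \<and> d \<le> - c_rate H l\<^sub>1 \<beta>\<^sub>1 * VP s powr ((1 + \<beta>\<^sub>1) / 2)"
          using E4.energy_derivative[OF d(1)] ev[of s] s by auto
      qed
    qed
  qed (use exponents in \<open>auto simp: E4.energy_nonneg\<close>)
qed

text \<open>
  Here t_z is the time by which the z-error has vanished, and b is the square root of Gamma_v(T_z). Until
  t_z the square root of V_v grows at most at the rate of the bound sqrt (V_z(0)) + drift t_0 of the square
  root of V_z. The resulting bound is quadratic in sqrt (V_z(0)). Its quadratic term is contained in b, and
  so are its mixed terms, by the first lower bound on t_r, even with sqrt (V_z(0)) to spare. Hence the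
  excess over b is at most overshoot minus sqrt (V_z(0)): it matters only for small initial z-errors, for which
  t_z is bounded. By the second lower bound on t_r the excess is gone before T_z.
\<close>

lemma transient:
  assumes settled: "settled_from a\<^sub>0 \<omega>\<^sub>0' w t\<^sub>0"
    and tr: "t\<^sub>0 + 4 * (drift * t\<^sub>0) / c_z H l\<^sub>3 \<gamma>\<^sub>3 + 1 \<le> t\<^sub>r"
      "t\<^sub>0 + 2 * (drift * t\<^sub>0) / c_z H l\<^sub>3 \<gamma>\<^sub>3 + catch_up t\<^sub>0 \<le> t\<^sub>r"
  defines "tz \<equiv> t\<^sub>0 + 2 * (sqrt (Vz 0) + drift * t\<^sub>0) / c_z H l\<^sub>3 \<gamma>\<^sub>3"
    and "Tz \<equiv> T_z H l\<^sub>3 \<gamma>\<^sub>3 t\<^sub>r (Vz 0)"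
  defines "b \<equiv> (1/2) * c_v0 H (Vz 0) * Tz + sqrt (Vv 0)"
  shows "\<And>t. tz \<le> t \<Longrightarrow> ez t = 0"
    and "0 \<le> tz" "tz + catch_up t\<^sub>0 \<le> Tz"
    and "\<And>t. 0 \<le> t \<Longrightarrow> sqrt (Vv t) \<le> b + max 0 (overshoot t\<^sub>0 - sqrt (Vz 0))"
    and "\<And>t. tz + catch_up t\<^sub>0 \<le> t \<Longrightarrow> sqrt (Vv t) \<le> b"
proof -
  define az where "az = sqrt (Vz 0)"
  define cz where "cz = c_z H l\<^sub>3 \<gamma>\<^sub>3"
  define K where "K = drift * t\<^sub>0"
  define M where "M = overshoot t\<^sub>0"
  have t0: "0 \<le> t\<^sub>0" using settled by (simp add: settled_from_def)
  have nn: "0 \<le> az" "0 < cz" "0 \<le> K" "0 \<le> M" "0 \<le> catch_up t\<^sub>0"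
    using E3.energy_nonneg c_z_pos drift_nonneg t0 overshoot_nonneg catch_up_nonneg
    by (auto simp: az_def cz_def K_def M_def)
  have tz: "tz = t\<^sub>0 + 2 * (az + K) / cz" by (simp add: tz_def az_def K_def cz_def)
  have Tz: "Tz = 2 * az / cz + t\<^sub>r" by (simp add: Tz_def T_z_def az_def cz_def)
  have tz0: "t\<^sub>0 \<le> tz" using nn by (simp add: tz)
  show tz_nonneg: "0 \<le> tz" using tz0 t0 by simp
  have Tz_ge: "tz + catch_up t\<^sub>0 \<le> Tz"
    using tr(2) nn unfolding tz Tz K_def[symmetric] cz_def[symmetric] by (simp add: add_divide_distrib)
  then show "tz + catch_up t\<^sub>0 \<le> Tz" .
  have Vz_t0: "sqrt (Vz t\<^sub>0) \<le> az + K" using Vz_growth[OF t0] by (simp add: az_def K_def)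
  have Vz_le: "sqrt (Vz t) \<le> az + K" if "0 \<le> t" for t
  proof (cases "t \<le> t\<^sub>0")
    case True
    then have "drift * t \<le> K" unfolding K_def by (intro mult_left_mono drift_nonneg)
    then show ?thesis using Vz_growth[OF that] by (simp add: az_def)
  next
    case False
    have "0 \<le> cz / 2 * (t - t\<^sub>0)" using nn False by simp
    then show ?thesis using Vz_decay[OF settled, of t] False Vz_t0 nn unfolding cz_def[symmetric] by linarith
  qed
  show ez0: "ez t = 0" if "tz \<le> t" for t
  proof -
    have "cz / 2 * (tz - t\<^sub>0) \<le> cz / 2 * (t - t\<^sub>0)" using that nn by (intro mult_left_mono) auto
    moreover have "cz / 2 * (tz - t\<^sub>0) = az + K" using nn by (simp add: tz)
    ultimately have "sqrt (Vz t) \<le> 0"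
      using Vz_decay[OF settled, of t] that tz0 Vz_t0 unfolding cz_def[symmetric] by linarith
    then have "Vz t = 0" using E3.energy_nonneg[of "ez t"] by simp
    then show ?thesis by (simp add: E3.energy_eq_0_iff)
  qed
  have Tz_nonneg: "0 \<le> Tz" using Tz_ge nn tz_nonneg by linarith
  have b_ge: "az * Tz + sqrt (Vv 0) \<le> b"
  proof -
    have "(1/2) * c_v0 H (Vz 0) = az * (\<Sigma> / \<sigma>)"
    proof -
      have "c_v0 H (Vz 0) = \<Sigma> * (sqrt (2 / \<sigma>) * sqrt (2 / \<sigma>)) * az"
        by (simp add: c_v0_def gamma_z_def az_def real_sqrt_mult real_sqrt_divide)
      also have "sqrt (2 / \<sigma>) * sqrt (2 / \<sigma>) = 2 / \<sigma>" using E3.lower_pos by simp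
      finally show ?thesis by simp
    qed
    moreover have "az * 1 \<le> az * (\<Sigma> / \<sigma>)" using nn E3.ordered E3.lower_pos by (intro mult_left_mono) auto
    ultimately have "az * Tz \<le> (1/2) * c_v0 H (Vz 0) * Tz" using Tz_nonneg by (intro mult_right_mono) auto
    then show ?thesis by (simp add: b_def)
  qed
  have b_nonneg: "0 \<le> b"
    using b_ge nn Tz_nonneg E3.energy_nonneg[of "ev 0"] by (meson add_nonneg_nonneg mult_nonneg_nonneg order_trans real_sqrt_ge_zero)
  have over: "(az + K) * tz \<le> az * Tz + (M - az)"
  proof -
    have "(az + K) * tz = az * t\<^sub>0 + K * t\<^sub>0 + (2 * az\<^sup>2 + 4 * az * K + 2 * K\<^sup>2) / cz"
      by (simp add: tz power2_eq_square algebra_simps add_divide_distrib)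
    moreover have "az * (t\<^sub>0 + 4 * K / cz + 1) \<le> az * t\<^sub>r"
      using tr(1) nn unfolding K_def[symmetric] cz_def[symmetric] by (intro mult_left_mono) auto
    moreover have "az * (t\<^sub>0 + 4 * K / cz + 1) = az * t\<^sub>0 + 4 * az * K / cz + az" by (simp add: algebra_simps)
    moreover have "M = K * t\<^sub>0 + 2 * K\<^sup>2 / cz" by (simp add: M_def overshoot_def K_def cz_def)
    moreover have "az * Tz = 2 * az\<^sup>2 / cz + az * t\<^sub>r" by (simp add: Tz power2_eq_square algebra_simps)
    ultimately show ?thesis by (simp add: add_divide_distrib)
  qed
  have p: "Vv t powr ((1 - \<beta>\<^sub>2) / 2) = sqrt (Vv t) powr (1 - \<beta>\<^sub>2)" for t
    using square_powr_half[of "sqrt (Vv t)" "1 - \<beta>\<^sub>2"] by (simp add: E3.energy_nonneg)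
  have le_iff: "x \<le> x'" if "x powr (1 - \<beta>\<^sub>2) \<le> x' powr (1 - \<beta>\<^sub>2)" "0 \<le> x'" for x x' :: real
    using that powr_less_mono2[of "1 - \<beta>\<^sub>2" x' x] exponents(4) by (meson diff_gt_0_iff_gt not_le)
  have decay: "sqrt (Vv t) powr (1 - \<beta>\<^sub>2) \<le>
      max 0 (sqrt (Vv s) powr (1 - \<beta>\<^sub>2) - (1 - \<beta>\<^sub>2) / 2 * c_rate H l\<^sub>2 \<beta>\<^sub>2 * (t - s))"
    if "tz \<le> s" "s \<le> t" for s t
    using Vv_decay[of s t] that tz_nonneg ez0 unfolding p by simp
  have rate: "0 < (1 - \<beta>\<^sub>2) / 2 * c_rate H l\<^sub>2 \<beta>\<^sub>2"
    using exponents c_rate_pos[OF gains(2)] by simp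
  have anti: "sqrt (Vv t) \<le> sqrt (Vv s)" if "tz \<le> s" "s \<le> t" for s t
  proof (rule le_iff)
    have "0 \<le> (1 - \<beta>\<^sub>2) / 2 * c_rate H l\<^sub>2 \<beta>\<^sub>2 * (t - s)"
      by (rule mult_nonneg_nonneg[OF less_imp_le[OF rate]]) (use that in simp)
    moreover have "0 \<le> sqrt (Vv s) powr (1 - \<beta>\<^sub>2)" by simp
    ultimately show "sqrt (Vv t) powr (1 - \<beta>\<^sub>2) \<le> sqrt (Vv s) powr (1 - \<beta>\<^sub>2)"
      using decay[OF that] by linarith
  qed (simp add: E3.energy_nonneg)
  have early: "sqrt (Vv t) \<le> b + (M - az)" if "0 \<le> t" "t \<le> tz" for t
  proof -
    have "sqrt (Vv t) \<le> sqrt (Vv 0) + (az + K) * (t - 0)"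
      using Vz_le nn that by (intro Vv_growth) auto
    moreover have "(az + K) * t \<le> (az + K) * tz" using that nn by (intro mult_left_mono) auto
    ultimately show ?thesis using over b_ge by simp
  qed
  show "sqrt (Vv t) \<le> b + max 0 (overshoot t\<^sub>0 - sqrt (Vz 0))" if "0 \<le> t" for t
  proof (cases "t \<le> tz")
    case True
    then show ?thesis using early[OF that True] unfolding M_def az_def by linarith
  next
    case False
    then show ?thesis using anti[of tz t] early[OF tz_nonneg order_refl] unfolding M_def az_def by linarith
  qed
  have "sqrt (Vv (tz + catch_up t\<^sub>0)) \<le> b"
  proof (rule le_iff)
    have "sqrt (Vv tz) \<le> b + M" using early[OF tz_nonneg order_refl] nn by linarith
    then have "sqrt (Vv tz) powr (1 - \<beta>\<^sub>2) \<le> (b + M) powr (1 - \<beta>\<^sub>2)"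
      using exponents by (intro powr_mono2) (auto simp: E3.energy_nonneg)
    also have "\<dots> \<le> b powr (1 - \<beta>\<^sub>2) + M powr (1 - \<beta>\<^sub>2)"
      using exponents b_nonneg nn by (intro powr_add_le) auto
    finally have "sqrt (Vv tz) powr (1 - \<beta>\<^sub>2) \<le> b powr (1 - \<beta>\<^sub>2) + M powr (1 - \<beta>\<^sub>2)" .
    moreover have "(1 - \<beta>\<^sub>2) / 2 * c_rate H l\<^sub>2 \<beta>\<^sub>2 * catch_up t\<^sub>0 = M powr (1 - \<beta>\<^sub>2)"
      using rate unfolding catch_up_def M_def by (metis less_irrefl nonzero_mult_div_cancel_left times_divide_eq_right)
    moreover have "0 \<le> b powr (1 - \<beta>\<^sub>2)" by simp
    ultimately show "sqrt (Vv (tz + catch_up t\<^sub>0)) powr (1 - \<beta>\<^sub>2) \<le> b powr (1 - \<beta>\<^sub>2)"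
      using decay[of tz "tz + catch_up t\<^sub>0"] nn unfolding add_diff_cancel_left' by linarith
  qed (rule b_nonneg)
  then show "sqrt (Vv t) \<le> b" if "tz + catch_up t\<^sub>0 \<le> t" for t
    using anti[of "tz + catch_up t\<^sub>0" t] that nn by linarith
qed

end

section \<open>The states y and w\<close>

text \<open>
  A zero with nonzero derivative is isolated. Zeros that are 1/(n+1)-isolated lie in different
  intervals of length 1/(n+1), so there are countably many of them for each n.
\<close>

lemma countable_simple_zeros:
  fixes f :: "real \<Rightarrow> real"
  shows "countable {t. f t = 0 \<and> (\<exists>d. d \<noteq> 0 \<and> (f has_real_derivative d) (at t))}" (is "countable ?S")
proof -
  define Z where "Z n = {t. f t = 0 \<and> (\<forall>s. s \<noteq> t \<and> real (Suc n) * \<bar>s - t\<bar> < 1 \<longrightarrow> f s \<noteq> 0)}" for n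
  have "?S \<subseteq> (\<Union>n. Z n)"
  proof
    fix t assume "t \<in> ?S"
    then obtain d where t: "f t = 0" "d \<noteq> 0" "(f has_real_derivative d) (at t)" by auto
    then have "((\<lambda>s. (f s - f t) / (s - t)) \<longlongrightarrow> d) (at t)" by (simp add: has_field_derivative_iff)
    then have "\<forall>\<^sub>F s in at t. (f s - f t) / (s - t) \<noteq> 0" using t(2) by (rule tendsto_imp_eventually_ne)
    then obtain r where r: "r > 0" "\<And>s. s \<noteq> t \<Longrightarrow> dist s t < r \<Longrightarrow> f s \<noteq> 0"
      unfolding eventually_at using t(1) by auto
    obtain n where n: "inverse (real (Suc n)) < r" using reals_Archimedean[OF r(1)] by blast
    have "f s \<noteq> 0" if "s \<noteq> t" "real (Suc n) * \<bar>s - t\<bar> < 1" for s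
    proof (rule r(2)[OF that(1)])
      have "\<bar>s - t\<bar> < inverse (real (Suc n))" using that(2) by (simp add: field_simps)
      then show "dist s t < r" using n by (simp add: dist_real_def)
    qed
    then show "t \<in> (\<Union>n. Z n)" using t(1) by (auto simp: Z_def)
  qed
  moreover have "countable (Z n)" for n
  proof -
    have "inj_on (\<lambda>t. \<lfloor>real (Suc n) * t\<rfloor>) (Z n)"
    proof (rule inj_onI, rule ccontr)
      fix s t assume st: "s \<in> Z n" "t \<in> Z n" "\<lfloor>real (Suc n) * s\<rfloor> = \<lfloor>real (Suc n) * t\<rfloor>" "s \<noteq> t"
      then have "\<bar>real (Suc n) * s - real (Suc n) * t\<bar> < 1" by linarith
      then have "real (Suc n) * \<bar>s - t\<bar> < 1" by (simp only: right_diff_distrib[symmetric] abs_mult abs_of_nat)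
      then show False using st by (auto simp: Z_def)
    qed
    then show ?thesis by (rule countable_image_inj_on[rotated]) simp
  qed
  ultimately show ?thesis by (meson countable_UN countable_subset uncountable_def countableI_type)
qed

lemma has_real_derivative_abs_nonzero:
  fixes f :: "real \<Rightarrow> real"
  assumes "(f has_real_derivative d) (at t)" "f t \<noteq> 0"
  shows "((\<lambda>s. \<bar>f s\<bar>) has_real_derivative sgn (f t) * d) (at t)"
proof -
  have "(f \<longlongrightarrow> f t) (at t)" using DERIV_isCont[OF assms(1)] by (simp add: isCont_def)
  then have "\<forall>\<^sub>F s in at t. \<bar>f s\<bar> = sgn (f t) * f s"
  proof -
    consider "f t > 0" | "f t < 0" using assms(2) by linarith
    then show ?thesis
    proof cases
      case 1
      then have "\<forall>\<^sub>F s in at t. 0 < f s" using \<open>(f \<longlongrightarrow> f t) (at t)\<close> by (intro order_tendstoD(1))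
      then show ?thesis by (rule eventually_mono) (use 1 in simp)
    next
      case 2
      then have "\<forall>\<^sub>F s in at t. f s < 0" using \<open>(f \<longlongrightarrow> f t) (at t)\<close> by (intro order_tendstoD(2))
      then show ?thesis by (rule eventually_mono) (use 2 in simp)
    qed
  qed
  moreover have "((\<lambda>s. sgn (f t) * f s) has_real_derivative sgn (f t) * d) (at t)"
    using assms(1) by (rule DERIV_cmult)
  ultimately show ?thesis
    by (subst DERIV_cong_ev[where g = "\<lambda>s. sgn (f t) * f s"])
       (auto simp: eventually_at_filter abs_sgn mult.commute elim!: eventually_mono)
qed

lemma has_real_derivative_abs_critical:
  fixes f :: "real \<Rightarrow> real"
  assumes "(f has_real_derivative 0) (at t)" "f t = 0"
  shows "((\<lambda>s. \<bar>f s\<bar>) has_real_derivative 0) (at t)"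
proof -
  have "((\<lambda>s. (f s - f t) / (s - t)) \<longlongrightarrow> 0) (at t)" using assms(1) by (simp add: has_field_derivative_iff)
  then have "((\<lambda>s. \<bar>(f s - f t) / (s - t)\<bar>) \<longlongrightarrow> 0) (at t)" by (rule tendsto_rabs_zero)
  then have "((\<lambda>s. \<bar>(\<bar>f s\<bar> - \<bar>f t\<bar>) / (s - t)\<bar>) \<longlongrightarrow> 0) (at t)" using assms(2) by (simp add: abs_divide)
  then have "((\<lambda>s. (\<bar>f s\<bar> - \<bar>f t\<bar>) / (s - t)) \<longlongrightarrow> 0) (at t)" by (rule tendsto_rabs_zero_cancel)
  then show ?thesis by (simp add: has_field_derivative_iff)
qed

lemma norm_nonincreasing:
  fixes e :: "real \<Rightarrow> 'a::real_inner"
  assumes ac: "abs_cont_on {a..b} e" and "a \<le> b"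
    and deriv: "AE t in lebesgue. a < t \<and> t < b \<longrightarrow> (\<exists>d. (e has_vector_derivative d) (at t) \<and> e t \<bullet> d \<le> 0)"
  shows "norm (e b) \<le> norm (e a)"
proof -
  have "e b \<bullet> e b \<le> e a \<bullet> e a"
  proof (rule abs_cont_on_nonincreasing[OF _ \<open>a \<le> b\<close>])
    show "abs_cont_on {a..b} (\<lambda>t. e t \<bullet> e t)"
      by (intro abs_cont_on_bilinear[OF bounded_bilinear_inner] ac)
    show "AE t in lebesgue. a < t \<and> t < b \<longrightarrow> (\<exists>d\<le>0. ((\<lambda>t. e t \<bullet> e t) has_real_derivative d) (at t))"
      using deriv
    proof eventually_elim
      case (elim t)
      show ?case
      proof
        assume "a < t \<and> t < b"
        with elim obtain d where d: "(e has_vector_derivative d) (at t)" "e t \<bullet> d \<le> 0" by blast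
        have "((\<lambda>t. e t \<bullet> e t) has_vector_derivative (e t \<bullet> d + d \<bullet> e t)) (at t)"
          by (intro bounded_bilinear.has_vector_derivative[OF bounded_bilinear_inner] d)
        then show "\<exists>d\<le>0. ((\<lambda>t. e t \<bullet> e t) has_real_derivative d) (at t)"
          using d(2)
          by (intro exI[of _ "e t \<bullet> d + d \<bullet> e t"]) (simp add: has_real_derivative_iff_has_vector_derivative inner_commute)
      qed
    qed
  qed
  then show ?thesis by (simp add: norm_eq_sqrt_inner)
qed

context observer_solution
begin

lemma component_abs_cont:
  assumes "0 \<le> a"
  shows "abs_cont_on {a..b} (\<lambda>t. y t $ i)" "abs_cont_on {a..b} (\<lambda>t. w t $ i)"
proof -
  have sub: "{a..b} \<subseteq> {0..max 0 b}" using assms by auto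
  have "abs_cont_on {a..b} y" "abs_cont_on {a..b} w"
    using solution_abs_cont(4,5)[of "max 0 b"] sub by (auto intro: abs_cont_on_subset)
  then show "abs_cont_on {a..b} (\<lambda>t. y t $ i)" "abs_cont_on {a..b} (\<lambda>t. w t $ i)"
    by (auto intro: abs_cont_on_linear[OF bounded_linear_vec_nth])
qed

lemma yw_derivative:
  "AE t in lebesgue. 0 < t \<longrightarrow> (\<exists>dy dw. ((\<lambda>t. y t $ i) has_vector_derivative dy) (at t) \<and>
     ((\<lambda>t. w t $ i) has_vector_derivative dw) (at t) \<and>
     dy = - (\<mu>\<^sub>1 * a\<^sub>0 $ i) *\<^sub>R vspow (1/2) (y t $ i - \<omega>\<^sub>0 t) + w t $ i \<and>
     (\<forall>k. \<bar>dw $ k\<bar> \<le> \<mu>\<^sub>2 * a\<^sub>0 $ i) \<and>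
     (\<forall>k. y t $ i $ k \<noteq> \<omega>\<^sub>0 t $ k \<longrightarrow> dw $ k = - (\<mu>\<^sub>2 * a\<^sub>0 $ i) * sgn (y t $ i $ k - \<omega>\<^sub>0 t $ k)))"
  using solution_derivatives
proof eventually_elim
  case (elim t)
  show ?case
  proof
    assume t: "0 < t"
    with elim obtain dP dv dz dy dw where D: "(y has_vector_derivative dy) (at t)" "(w has_vector_derivative dw) (at t)"
      and d: "(dP, dv, dz, dy, dw) \<in> filippov_set
       (observer_field A a\<^sub>0 l\<^sub>1 l\<^sub>2 l\<^sub>3 \<beta>\<^sub>1 \<beta>\<^sub>2 \<mu>\<^sub>1 \<mu>\<^sub>2 Q\<^sub>0 \<omega>\<^sub>0 t) (P t, v t, z t, y t, w t)" by blast
    note F = filippov_set_observer[OF d exponents(1,3) gains_nonneg]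
    note C = D[THEN bounded_linear.has_vector_derivative[OF bounded_linear_vec_nth[of i]]]
    show "\<exists>dy dw. ((\<lambda>t. y t $ i) has_vector_derivative dy) (at t) \<and>
     ((\<lambda>t. w t $ i) has_vector_derivative dw) (at t) \<and>
     dy = - (\<mu>\<^sub>1 * a\<^sub>0 $ i) *\<^sub>R vspow (1/2) (y t $ i - \<omega>\<^sub>0 t) + w t $ i \<and>
     (\<forall>k. \<bar>dw $ k\<bar> \<le> \<mu>\<^sub>2 * a\<^sub>0 $ i) \<and>
     (\<forall>k. y t $ i $ k \<noteq> \<omega>\<^sub>0 t $ k \<longrightarrow> dw $ k = - (\<mu>\<^sub>2 * a\<^sub>0 $ i) * sgn (y t $ i $ k - \<omega>\<^sub>0 t $ k))"
      by (intro exI[of _ "dy $ i"] exI[of _ "dw $ i"] conjI C F(3) allI impI F(6) F(7))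
  qed
qed

lemma unlinked_rest:
  assumes "a\<^sub>0 $ i = 0" "0 \<le> t"
  shows "w t $ i = 0" "y t $ i = 0"
proof -
  have w: "w s $ i = 0" if "0 \<le> s" for s
  proof -
    have "norm (w s $ i) \<le> norm (w 0 $ i)"
    proof (rule norm_nonincreasing[OF component_abs_cont(2) that])
      show "AE t in lebesgue. 0 < t \<and> t < s \<longrightarrow> (\<exists>d. ((\<lambda>t. w t $ i) has_vector_derivative d) (at t) \<and> w t $ i \<bullet> d \<le> 0)"
        using yw_derivative[of i]
      proof eventually_elim
        case (elim t)
        show ?case
        proof
          assume "0 < t \<and> t < s"
          with elim obtain d where "((\<lambda>t. w t $ i) has_vector_derivative d) (at t)" "\<forall>k. \<bar>d $ k\<bar> \<le> \<mu>\<^sub>2 * a\<^sub>0 $ i" by blast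
          moreover from this(2) have "d = 0" using assms(1) by (simp add: vec_eq_iff)
          ultimately show "\<exists>d. ((\<lambda>t. w t $ i) has_vector_derivative d) (at t) \<and> w t $ i \<bullet> d \<le> 0" by auto
        qed
      qed
    qed simp
    then show ?thesis using initial by simp
  qed
  then show "w t $ i = 0" using assms by simp
  have "norm (y t $ i) \<le> norm (y 0 $ i)"
  proof (rule norm_nonincreasing[OF component_abs_cont(1) \<open>0 \<le> t\<close>])
    show "AE s in lebesgue. 0 < s \<and> s < t \<longrightarrow> (\<exists>d. ((\<lambda>t. y t $ i) has_vector_derivative d) (at s) \<and> y s $ i \<bullet> d \<le> 0)"
      using yw_derivative[of i]
    proof eventually_elim
      case (elim s)
      show ?case
      proof
        assume "0 < s \<and> s < t"
        with elim w[of s] assms(1) have "((\<lambda>t. y t $ i) has_vector_derivative 0) (at s)" by auto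
        then show "\<exists>d. ((\<lambda>t. y t $ i) has_vector_derivative d) (at s) \<and> y s $ i \<bullet> d \<le> 0" by auto
      qed
    qed
  qed simp
  then show "y t $ i = 0" using initial by simp
qed

lemma linked_error_nonincreasing:
  assumes settled: "settled_from a\<^sub>0 \<omega>\<^sub>0' w t\<^sub>0" and i: "a\<^sub>0 $ i = 1" and "t\<^sub>0 \<le> t"
  shows "norm (y t $ i - \<omega>\<^sub>0 t) \<le> norm (y t\<^sub>0 $ i - \<omega>\<^sub>0 t\<^sub>0)"
proof (rule norm_nonincreasing[where e = "\<lambda>t. y t $ i - \<omega>\<^sub>0 t", OF _ \<open>t\<^sub>0 \<le> t\<close>])
  have t0: "0 \<le> t\<^sub>0" using settled by (simp add: settled_from_def)
  then show "abs_cont_on {t\<^sub>0..t} (\<lambda>t. y t $ i - \<omega>\<^sub>0 t)"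
    using leader_abs_cont(2)[of t] by (intro abs_cont_on_diff component_abs_cont) (auto elim: abs_cont_on_subset)
  show "AE s in lebesgue. t\<^sub>0 < s \<and> s < t \<longrightarrow>
      (\<exists>d. ((\<lambda>t. y t $ i - \<omega>\<^sub>0 t) has_vector_derivative d) (at s) \<and> (y s $ i - \<omega>\<^sub>0 s) \<bullet> d \<le> 0)"
    using yw_derivative[of i]
  proof eventually_elim
    case (elim s)
    show ?case
    proof
      assume s: "t\<^sub>0 < s \<and> s < t"
      then have "w s $ i = \<omega>\<^sub>0' s" "0 < s" using settled i t0 by (auto simp: settled_from_def)
      with elim i have "((\<lambda>t. y t $ i) has_vector_derivative - \<mu>\<^sub>1 *\<^sub>R vspow (1/2) (y s $ i - \<omega>\<^sub>0 s) + \<omega>\<^sub>0' s) (at s)" by auto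
      from has_vector_derivative_diff[OF this leader_derivatives(2)[OF \<open>0 < s\<close>]]
      have "((\<lambda>t. y t $ i - \<omega>\<^sub>0 t) has_vector_derivative - \<mu>\<^sub>1 *\<^sub>R vspow (1/2) (y s $ i - \<omega>\<^sub>0 s)) (at s)" by simp
      moreover have "0 \<le> (y s $ i - \<omega>\<^sub>0 s) \<bullet> vspow (1/2) (y s $ i - \<omega>\<^sub>0 s)"
        unfolding inner_vec_def vspow_def vec_lambda_beta inner_real_def spow_mult_self by (intro sum_nonneg) simp
      ultimately show "\<exists>d. ((\<lambda>t. y t $ i - \<omega>\<^sub>0 t) has_vector_derivative d) (at s) \<and> (y s $ i - \<omega>\<^sub>0 s) \<bullet> d \<le> 0"
        using gains(3) by (intro exI conjI) auto
    qed
  qed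
qed

text \<open>
  The function \<mu>_2 |y| + w^2 / 2 does not increase: the terms \<mu>_2 w sgn y cancel, and the square root
  feedback only dissipates. The absolute value causes trouble only where y has a zero with nonzero
  derivative, and there are only countably many such times. At the other zeros y' = 0, so w = 0 by the
  equation for y, and the unknown value of w' does not matter.
\<close>

lemma super_twisting_rest:
  assumes \<omega>: "\<And>t. 0 \<le> t \<Longrightarrow> \<omega>\<^sub>0 t = 0" and i: "a\<^sub>0 $ i = 1" and "0 \<le> t"
  shows "w t $ i = 0"
proof -
  have "w t $ i $ k = 0" for k
  proof -
    let ?y = "\<lambda>t. y t $ i $ k" and ?w = "\<lambda>t. w t $ i $ k"
    have ac: "abs_cont_on {0..t} ?y" "abs_cont_on {0..t} ?w"
      by (auto intro: abs_cont_on_linear[OF bounded_linear_vec_nth] component_abs_cont)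
    have m: "0 < \<mu>\<^sub>2" using gains gamma_nonneg by linarith
    have "\<mu>\<^sub>2 * \<bar>?y t\<bar> + (1/2) * (?w t * ?w t) \<le> \<mu>\<^sub>2 * \<bar>?y 0\<bar> + (1/2) * (?w 0 * ?w 0)"
    proof (rule abs_cont_on_nonincreasing[where g = "\<lambda>t. \<mu>\<^sub>2 * \<bar>?y t\<bar> + (1/2) * (?w t * ?w t)", OF _ \<open>0 \<le> t\<close>])
      have "abs_cont_on {0..t} (\<lambda>t. \<bar>?y t\<bar>)"
        by (rule abs_cont_on_compose_lipschitz[OF ac(1), where L = 1]) (simp add: abs_triangle_ineq3)
      then show "abs_cont_on {0..t} (\<lambda>t. \<mu>\<^sub>2 * \<bar>?y t\<bar> + (1/2) * (?w t * ?w t))"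
        by (intro abs_cont_on_add abs_cont_on_linear[OF bounded_linear_mult_right] abs_cont_on_bilinear[OF bounded_bilinear_mult] ac)
      have "{s. ?y s = 0 \<and> (\<exists>d. d \<noteq> 0 \<and> (?y has_real_derivative d) (at s))} \<in> null_sets lebesgue"
        by (intro null_sets_completionI countable_imp_null_set_lborel countable_simple_zeros)
      then have "AE s in lebesgue. s \<notin> {s. ?y s = 0 \<and> (\<exists>d. d \<noteq> 0 \<and> (?y has_real_derivative d) (at s))}"
        by (rule AE_not_in)
      with yw_derivative[of i]
      show "AE s in lebesgue. 0 < s \<and> s < t \<longrightarrow>
          (\<exists>d\<le>0. ((\<lambda>t. \<mu>\<^sub>2 * \<bar>?y t\<bar> + (1/2) * (?w t * ?w t)) has_real_derivative d) (at s))"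
      proof eventually_elim
        case (elim s)
        show ?case
        proof
          assume s: "0 < s \<and> s < t"
          with elim(1) obtain dy dw where D: "((\<lambda>t. y t $ i) has_vector_derivative dy) (at s)"
            "((\<lambda>t. w t $ i) has_vector_derivative dw) (at s)"
            and dy: "dy = - (\<mu>\<^sub>1 * a\<^sub>0 $ i) *\<^sub>R vspow (1/2) (y s $ i - \<omega>\<^sub>0 s) + w s $ i"
            and dw: "\<forall>k. y s $ i $ k \<noteq> \<omega>\<^sub>0 s $ k \<longrightarrow> dw $ k = - (\<mu>\<^sub>2 * a\<^sub>0 $ i) * sgn (y s $ i $ k - \<omega>\<^sub>0 s $ k)"
            by blast
          have D': "(?y has_real_derivative dy $ k) (at s)" "(?w has_real_derivative dw $ k) (at s)"
            using D[THEN bounded_linear.has_vector_derivative[OF bounded_linear_vec_nth[of k]]]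
            by (simp_all add: has_real_derivative_iff_has_vector_derivative)
          have dyk: "dy $ k = - \<mu>\<^sub>1 * spow (1/2) (?y s) + ?w s" using dy i \<omega>[of s] s by (simp add: vspow_def)
          show "\<exists>d\<le>0. ((\<lambda>t. \<mu>\<^sub>2 * \<bar>?y t\<bar> + (1/2) * (?w t * ?w t)) has_real_derivative d) (at s)"
          proof (cases "?y s = 0")
            case True
            then have "dy $ k = 0" using elim(2) D'(1) by auto
            then have "?w s = 0" using dyk True by (simp add: spow_def)
            have "((\<lambda>t. \<bar>?y t\<bar>) has_real_derivative 0) (at s)"
              using has_real_derivative_abs_critical[of ?y s] D'(1) \<open>dy $ k = 0\<close> True by simp
            then have "((\<lambda>t. \<mu>\<^sub>2 * \<bar>?y t\<bar> + (1/2) * (?w t * ?w t)) has_real_derivative \<mu>\<^sub>2 * 0 + (1/2) * (dw $ k * ?w s + dw $ k * ?w s)) (at s)"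
              by (intro DERIV_add DERIV_cmult DERIV_mult D'(2))
            then show ?thesis using \<open>?w s = 0\<close> by auto
          next
            case False
            have dwk: "dw $ k = - \<mu>\<^sub>2 * sgn (?y s)" using dw False i \<omega>[of s] s by simp
            have "((\<lambda>t. \<mu>\<^sub>2 * \<bar>?y t\<bar> + (1/2) * (?w t * ?w t)) has_real_derivative
                \<mu>\<^sub>2 * (sgn (?y s) * dy $ k) + (1/2) * (dw $ k * ?w s + dw $ k * ?w s)) (at s)"
              by (intro DERIV_add DERIV_cmult DERIV_mult D'(2) has_real_derivative_abs_nonzero D'(1) False)
            moreover have "\<mu>\<^sub>2 * (sgn (?y s) * dy $ k) + (1/2) * (dw $ k * ?w s + dw $ k * ?w s)
                = - (\<mu>\<^sub>2 * \<mu>\<^sub>1 * (sgn (?y s) * spow (1/2) (?y s)))"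
              unfolding dyk dwk by (simp add: algebra_simps)
            moreover have "0 \<le> \<mu>\<^sub>2 * \<mu>\<^sub>1 * (sgn (?y s) * spow (1/2) (?y s))"
            proof -
              have "0 \<le> (sgn (?y s) * sgn (?y s)) * \<bar>?y s\<bar> powr (1/2)" by (intro mult_nonneg_nonneg zero_le_square) simp
              then have "0 \<le> sgn (?y s) * spow (1/2) (?y s)" by (simp add: spow_def mult.assoc)
              moreover have "0 \<le> \<mu>\<^sub>2 * \<mu>\<^sub>1" using m gains(3) by simp
              ultimately show ?thesis by (simp only: mult_nonneg_nonneg)
            qed
            ultimately show ?thesis by (intro exI conjI) auto
          qed
        qed
      qed
    qed
    then have "\<mu>\<^sub>2 * \<bar>?y t\<bar> + (1/2) * (?w t * ?w t) \<le> 0" using initial by simp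
    moreover have "0 \<le> \<mu>\<^sub>2 * \<bar>?y t\<bar>" using m by simp
    ultimately have "?w t * ?w t \<le> 0" by linarith
    then show ?thesis by (metis mult_eq_0_iff order_antisym zero_le_square)
  qed
  then show ?thesis by (simp add: vec_eq_iff)
qed

end

section \<open>Convergence\<close>

lemma bounded_after_continuous:
  fixes f :: "real \<Rightarrow> real ^ 'k ^ 'n"
  assumes "continuous_on {0..T} f" and "\<And>t i. T \<le> t \<Longrightarrow> norm (f t $ i) \<le> C"
  shows "\<exists>B. \<forall>t\<ge>0. \<forall>i. norm (f t $ i) \<le> B"
proof -
  have "bounded (f ` {0..T})" using assms(1) by (intro compact_imp_bounded compact_continuous_image) auto
  then obtain B where B: "\<And>t. t \<in> {0..T} \<Longrightarrow> norm (f t) \<le> B" unfolding bounded_iff by blast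
  have "norm (f t $ i) \<le> max B C" if "0 \<le> t" for t i
  proof (cases "t \<le> T")
    case True
    then show ?thesis
      using B[of t] that Finite_Cartesian_Product.norm_nth_le[of "f t" i] by simp
  next
    case False
    then show ?thesis using assms(2)[of t i] by simp
  qed
  then show ?thesis by blast
qed

lemma err_eq_0_iff: "err x x0 = 0 \<longleftrightarrow> (\<forall>i. x $ i = x0)"
  by (simp add: err_def vec_eq_iff[where 'b = 'b])

context observer_network
begin

text \<open>
  The first two conditions are those of transient. The third one bounds the surplus in the exponent of the
  attitude estimate, for initial z-errors small enough to cause an overshoot, by the
  contribution of the summand sqrt (3 n) * gamma_1 of gamma_v.
\<close>

definition sufficient_delay :: "real \<Rightarrow> real \<Rightarrow> bool" where
  "sufficient_delay t\<^sub>0 t\<^sub>r \<longleftrightarrow>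
     t\<^sub>0 + 4 * (drift * t\<^sub>0) / c_z H l\<^sub>3 \<gamma>\<^sub>3 + 1 \<le> t\<^sub>r \<and>
     t\<^sub>0 + 2 * (drift * t\<^sub>0) / c_z H l\<^sub>3 \<gamma>\<^sub>3 + catch_up t\<^sub>0 \<le> t\<^sub>r \<and>
     sqrt (2 / \<sigma>) * overshoot t\<^sub>0 *
       (t\<^sub>0 + 2 * (overshoot t\<^sub>0 + drift * t\<^sub>0) / c_z H l\<^sub>3 \<gamma>\<^sub>3 + catch_up t\<^sub>0)
       \<le> sqrt (3 * real CARD('n)) * \<gamma>\<^sub>1 * t\<^sub>r"

lemma sufficient_delay_exists:
  assumes "\<gamma>\<^sub>1 = 0 \<Longrightarrow> t\<^sub>0 = 0"
  obtains t\<^sub>r where "t\<^sub>0 \<le> t\<^sub>r" "sufficient_delay t\<^sub>0 t\<^sub>r"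
proof -
  let ?a = "t\<^sub>0 + 4 * (drift * t\<^sub>0) / c_z H l\<^sub>3 \<gamma>\<^sub>3 + 1"
  let ?b = "t\<^sub>0 + 2 * (drift * t\<^sub>0) / c_z H l\<^sub>3 \<gamma>\<^sub>3 + catch_up t\<^sub>0"
  let ?c = "sqrt (2 / \<sigma>) * overshoot t\<^sub>0 *
       (t\<^sub>0 + 2 * (overshoot t\<^sub>0 + drift * t\<^sub>0) / c_z H l\<^sub>3 \<gamma>\<^sub>3 + catch_up t\<^sub>0)"
  let ?d = "sqrt (3 * real CARD('n)) * \<gamma>\<^sub>1"
  define t\<^sub>r where "t\<^sub>r = max (max t\<^sub>0 ?a) (max ?b (?c / ?d))"
  have "?c \<le> ?d * t\<^sub>r"
  proof (cases "\<gamma>\<^sub>1 = 0")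
    case True
    then show ?thesis using assms by (simp add: overshoot_def)
  next
    case False
    then have d: "0 < ?d" using gamma_nonneg by simp
    have "?c / ?d \<le> t\<^sub>r" by (simp only: t\<^sub>r_def max.coboundedI2 max.cobounded2)
    then show ?thesis using d by (simp only: pos_divide_le_eq mult.commute)
  qed
  moreover have "t\<^sub>0 \<le> t\<^sub>r" "?a \<le> t\<^sub>r" "?b \<le> t\<^sub>r"
    unfolding t\<^sub>r_def by (intro max.coboundedI1 max.cobounded1 max.cobounded2 max.coboundedI2 | rule max.coboundedI1, rule max.cobounded2)+
  ultimately show ?thesis using that[of t\<^sub>r] by (simp only: sufficient_delay_def simp_thms)
qed

end

context observer_solution
begin

lemma is_T_v_exists:
  assumes Tz: "0 \<le> Tz" and ez: "\<And>t. Tz \<le> t \<Longrightarrow> ez t = 0" and G: "Vv Tz \<le> Gz"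
  shows "\<exists>Tv. is_T_v H l\<^sub>2 \<beta>\<^sub>2 \<omega>\<^sub>0 v Tz Gz Tv"
proof -
  define c where "c = (1 - \<beta>\<^sub>2) / 2 * c_rate H l\<^sub>2 \<beta>\<^sub>2"
  have c: "0 < c" using exponents c_rate_pos[OF gains(2)] by (simp add: c_def)
  define Tv where "Tv = Tz + Gz powr ((1 - \<beta>\<^sub>2) / 2) / c"
  have Tv_ge: "Tz \<le> Tv" using c by (simp add: Tv_def)
  have "ev t = 0" if "Tv \<le> t" for t
  proof -
    have "Vv t powr ((1 - \<beta>\<^sub>2) / 2) \<le> max 0 (Vv Tz powr ((1 - \<beta>\<^sub>2) / 2) - c * (t - Tz))"
      unfolding c_def using that Tv_ge Tz ez by (intro Vv_decay) auto
    moreover have "Vv Tz powr ((1 - \<beta>\<^sub>2) / 2) \<le> Gz powr ((1 - \<beta>\<^sub>2) / 2)"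
      using G exponents by (intro powr_mono2) (auto simp: E3.energy_nonneg)
    moreover have "Gz powr ((1 - \<beta>\<^sub>2) / 2) \<le> c * (t - Tz)"
      using that c by (simp add: Tv_def field_simps)
    ultimately have "Vv t powr ((1 - \<beta>\<^sub>2) / 2) \<le> 0" by linarith
    then have "Vv t = 0" by (metis order_antisym powr_eq_0_iff powr_ge_zero)
    then show ?thesis by (simp add: E3.energy_eq_0_iff)
  qed
  moreover have "Gz powr ((1 - \<beta>\<^sub>2) / 2) / c = 2 * Gz powr ((1 - \<beta>\<^sub>2) / 2) / (c_rate H l\<^sub>2 \<beta>\<^sub>2 * (1 - \<beta>\<^sub>2))"
    by (simp add: c_def mult.commute)
  ultimately show ?thesis using Tv_ge by (intro exI[of _ Tv]) (simp add: is_T_v_def Tv_def)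
qed

lemma attitude_converges:
  assumes Tv: "0 \<le> Tv" and ev: "\<And>t. Tv \<le> t \<Longrightarrow> ev t = 0"
    and bound: "VP Tv \<le> c_p2 H g (VP 0) * exp (c_p0 H g * Tv) - c_p10 H g"
    and t: "T_p_bound H l\<^sub>1 \<beta>\<^sub>1 g (VP 0) Tv \<le> t"
  shows "eP t = 0" "Tv \<le> t"
proof -
  define c where "c = (1 - \<beta>\<^sub>1) / 2 * c_rate H l\<^sub>1 \<beta>\<^sub>1"
  have c: "0 < c" using exponents c_rate_pos[OF gains(1)] by (simp add: c_def)
  define V where "V = c_p2 H g (VP 0) * exp (c_p0 H g * Tv) - c_p10 H g"
  have T: "T_p_bound H l\<^sub>1 \<beta>\<^sub>1 g (VP 0) Tv = Tv + V powr ((1 - \<beta>\<^sub>1) / 2) / c"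
    by (simp add: T_p_bound_def V_def c_def mult.commute)
  have "0 \<le> V powr ((1 - \<beta>\<^sub>1) / 2) / c" using c by simp
  then show "Tv \<le> t" using t unfolding T by linarith
  then have "VP t powr ((1 - \<beta>\<^sub>1) / 2) \<le> max 0 (VP Tv powr ((1 - \<beta>\<^sub>1) / 2) - c * (t - Tv))"
    unfolding c_def using Tv ev by (intro VP_decay) auto
  moreover have "VP Tv powr ((1 - \<beta>\<^sub>1) / 2) \<le> V powr ((1 - \<beta>\<^sub>1) / 2)"
    using bound exponents unfolding V_def by (intro powr_mono2) (auto simp: E4.energy_nonneg)
  moreover have "V powr ((1 - \<beta>\<^sub>1) / 2) \<le> c * (t - Tv)"
    using t c unfolding T by (simp add: field_simps)
  ultimately have "VP t powr ((1 - \<beta>\<^sub>1) / 2) \<le> 0" by linarith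
  then have "VP t = 0" by (metis order_antisym powr_eq_0_iff powr_ge_zero)
  then show "eP t = 0" by (simp add: E4.energy_eq_0_iff)
qed

text \<open>
  After te the square root of V_v is at most b, and before te at most b + m. The exponents of
  the growth on the two intervals add up to a multiple of b Tv + m te, and the surplus m te is paid for by the part of gamma_v that stems from the bound on the leader velocity.
\<close>

lemma attitude_energy_bound:
  assumes te: "0 \<le> te" "te \<le> Tv" and "0 \<le> b" "0 \<le> m"
    and early: "\<And>t. 0 \<le> t \<Longrightarrow> sqrt (Vv t) \<le> b + m"
    and late: "\<And>t. te \<le> t \<Longrightarrow> sqrt (Vv t) \<le> b"
    and slack: "sqrt (2 / \<sigma>) * m * te \<le> sqrt (3 * real CARD('n)) * \<gamma>\<^sub>1 * Tv"
  defines "g \<equiv> gamma_v H \<gamma>\<^sub>1 (b\<^sup>2)"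
  shows "VP Tv \<le> c_p2 H g (VP 0) * exp (c_p0 H g * Tv) - c_p10 H g"
proof -
  define s where "s = sqrt (2 / \<sigma>)"
  define k where "k = 2 * \<Sigma> / \<sigma>"
  define \<delta> where "\<delta> = sqrt (3 * real CARD('n)) * \<gamma>\<^sub>1"
  have pos: "0 < \<sigma>" "0 < \<Sigma>" "0 \<le> s" "0 \<le> k" "0 \<le> \<delta>"
    using E4.lower_pos E4.upper_pos gamma_nonneg by (auto simp: s_def k_def \<delta>_def)
  have g: "g = s * b + \<delta>"
    using \<open>0 \<le> b\<close> by (simp add: g_def gamma_v_def s_def \<delta>_def real_sqrt_mult real_sqrt_divide)
  have norm_ev: "norm (ev t) \<le> s * c" if "sqrt (Vv t) \<le> c" for t c
    using E3.norm_le_energy[of "ev t"] mult_left_mono[OF that pos(3)] unfolding s_def by linarith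
  have p10: "c_p10 H g = \<sigma> / 16"
    using pos by (simp add: c_p10_def c_p0_def c_p1_def)
  have "VP te + \<sigma> / 16 \<le> (VP 0 + \<sigma> / 16) * exp (k * (s * (b + m)) * (te - 0))"
    unfolding k_def using te early by (intro VP_growth norm_ev) auto
  moreover have "VP Tv + \<sigma> / 16 \<le> (VP te + \<sigma> / 16) * exp (k * (s * b) * (Tv - te))"
    unfolding k_def using te late by (intro VP_growth norm_ev) auto
  ultimately have "VP Tv + \<sigma> / 16 \<le> (VP 0 + \<sigma> / 16) * exp (k * (s * (b + m)) * (te - 0)) * exp (k * (s * b) * (Tv - te))"
    by (meson exp_ge_zero mult_right_mono order_trans)
  also have "\<dots> = (VP 0 + \<sigma> / 16) * exp (k * (s * b * Tv + s * m * te))"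
    by (simp add: mult.assoc exp_add[symmetric] algebra_simps)
  also have "\<dots> \<le> (VP 0 + \<sigma> / 16) * exp (c_p0 H g * Tv)"
  proof (intro mult_left_mono)
    have "k * (s * b * Tv + s * m * te) \<le> k * (s * b * Tv + \<delta> * Tv)"
      using slack pos by (intro mult_left_mono add_left_mono) (auto simp: s_def \<delta>_def)
    also have "\<dots> = 1 * (k * g * Tv)" by (simp add: g algebra_simps)
    also have "\<dots> \<le> real CARD('n) * (k * g * Tv)"
      using pos te \<open>0 \<le> b\<close> by (intro mult_right_mono mult_nonneg_nonneg) (auto simp: g Suc_le_eq)
    also have "\<dots> = c_p0 H g * Tv" by (simp add: c_p0_def k_def)
    finally show "exp (k * (s * b * Tv + s * m * te)) \<le> exp (c_p0 H g * Tv)" by simp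
    show "0 \<le> VP 0 + \<sigma> / 16" using pos E4.energy_nonneg[of "eP 0"] by simp
  qed
  finally show ?thesis by (simp add: c_p2_def p10)
qed

lemma convergence:
  assumes settled: "settled_from a\<^sub>0 \<omega>\<^sub>0' w t\<^sub>0" and delay: "sufficient_delay t\<^sub>0 t\<^sub>r"
  defines "Tz \<equiv> T_z H l\<^sub>3 \<gamma>\<^sub>3 t\<^sub>r (Vz 0)"
  defines "Gz \<equiv> Gamma_v H (Vz 0) (Vv 0) Tz"
  defines "g \<equiv> gamma_v H \<gamma>\<^sub>1 Gz"
  shows "\<exists>Tv. is_T_v H l\<^sub>2 \<beta>\<^sub>2 \<omega>\<^sub>0 v Tz Gz Tv"
    and "\<And>Tv. is_T_v H l\<^sub>2 \<beta>\<^sub>2 \<omega>\<^sub>0 v Tz Gz Tv \<Longrightarrow>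
      0 \<le> T_p_bound H l\<^sub>1 \<beta>\<^sub>1 g (VP 0) Tv \<and>
      (\<forall>t\<ge>T_p_bound H l\<^sub>1 \<beta>\<^sub>1 g (VP 0) Tv. eP t = 0 \<and> ev t = 0 \<and> ez t = 0)"
proof -
  define az where "az = sqrt (Vz 0)"
  define b where "b = (1/2) * c_v0 H (Vz 0) * Tz + sqrt (Vv 0)"
  define m where "m = max 0 (overshoot t\<^sub>0 - az)"
  define tz where "tz = t\<^sub>0 + 2 * (sqrt (Vz 0) + drift * t\<^sub>0) / c_z H l\<^sub>3 \<gamma>\<^sub>3"
  define te where "te = tz + catch_up t\<^sub>0"
  note D = delay[unfolded sufficient_delay_def]
  note tr = transient[OF settled conjunct1[OF D] conjunct1[OF conjunct2[OF D]],
      folded Tz_def, folded b_def tz_def, folded te_def az_def, folded m_def]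
  have te: "tz \<le> te" "0 \<le> te" "te \<le> Tz" "0 \<le> Tz"
    using tr(2,3) catch_up_nonneg[of t\<^sub>0] by (auto simp: te_def)
  have Gz: "Gz = b\<^sup>2" by (simp add: Gz_def Gamma_v_def b_def)
  have b: "0 \<le> b" using tr(5)[OF order_refl] E3.energy_nonneg[of "ev te"] by (meson order_trans real_sqrt_ge_zero)
  have "Vv Tz \<le> Gz"
    using tr(5)[OF te(3)] b by (simp add: Gz sqrt_le_D)
  then show "\<exists>Tv. is_T_v H l\<^sub>2 \<beta>\<^sub>2 \<omega>\<^sub>0 v Tz Gz Tv"
    using te tr(1) by (intro is_T_v_exists) auto
  fix Tv assume Tv: "is_T_v H l\<^sub>2 \<beta>\<^sub>2 \<omega>\<^sub>0 v Tz Gz Tv"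
  then have TzTv: "Tz \<le> Tv" and ev: "\<And>t. Tv \<le> t \<Longrightarrow> ev t = 0" by (auto simp: is_T_v_def)
  have Tz_tr: "t\<^sub>r \<le> Tz" using c_z_pos E3.energy_nonneg by (simp add: Tz_def T_z_def)
  have slack: "sqrt (2 / \<sigma>) * m * te \<le> sqrt (3 * real CARD('n)) * \<gamma>\<^sub>1 * Tv"
  proof (cases "overshoot t\<^sub>0 \<le> az")
    case True
    then show ?thesis using te TzTv gamma_nonneg by (simp add: m_def)
  next
    case False
    have az: "0 \<le> az" using E3.energy_nonneg by (simp add: az_def)
    have "te \<le> t\<^sub>0 + 2 * (overshoot t\<^sub>0 + drift * t\<^sub>0) / c_z H l\<^sub>3 \<gamma>\<^sub>3 + catch_up t\<^sub>0"
      using False c_z_pos drift_nonneg unfolding te_def tz_def az_def[symmetric]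
      by (intro add_mono divide_right_mono mult_left_mono) auto
    then have "sqrt (2 / \<sigma>) * m * te \<le> sqrt (2 / \<sigma>) * overshoot t\<^sub>0 *
        (t\<^sub>0 + 2 * (overshoot t\<^sub>0 + drift * t\<^sub>0) / c_z H l\<^sub>3 \<gamma>\<^sub>3 + catch_up t\<^sub>0)"
      using False az te E3.lower_pos by (intro mult_mono mult_nonneg_nonneg) (auto simp: m_def)
    also have "\<dots> \<le> sqrt (3 * real CARD('n)) * \<gamma>\<^sub>1 * t\<^sub>r" using D by blast
    also have "\<dots> \<le> sqrt (3 * real CARD('n)) * \<gamma>\<^sub>1 * Tv"
      using Tz_tr TzTv gamma_nonneg by (intro mult_left_mono) auto
    finally show ?thesis .
  qed
  have bound: "VP Tv \<le> c_p2 H g (VP 0) * exp (c_p0 H g * Tv) - c_p10 H g"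
    unfolding g_def Gz using te TzTv b slack tr(4,5)
    by (intro attitude_energy_bound[where te = te and m = m]) (auto simp: m_def)
  have Tv0: "0 \<le> Tv" using te TzTv by linarith
  have conv: "eP t = 0" "Tv \<le> t" if "T_p_bound H l\<^sub>1 \<beta>\<^sub>1 g (VP 0) Tv \<le> t" for t
    using attitude_converges[OF Tv0 ev bound that] by blast+
  show "0 \<le> T_p_bound H l\<^sub>1 \<beta>\<^sub>1 g (VP 0) Tv \<and>
      (\<forall>t\<ge>T_p_bound H l\<^sub>1 \<beta>\<^sub>1 g (VP 0) Tv. eP t = 0 \<and> ev t = 0 \<and> ez t = 0)"
  proof (intro conjI allI impI)
    show "0 \<le> T_p_bound H l\<^sub>1 \<beta>\<^sub>1 g (VP 0) Tv" using conv(2)[OF order_refl] Tv0 by linarith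
    fix t assume t: "T_p_bound H l\<^sub>1 \<beta>\<^sub>1 g (VP 0) Tv \<le> t"
    show "eP t = 0" using conv(1)[OF t] .
    show "ev t = 0" using conv(2)[OF t] ev by blast
    show "ez t = 0" using conv(2)[OF t] te TzTv tr(1)[of t] by linarith
  qed
qed

lemma states_bounded:
  assumes settled: "settled_from a\<^sub>0 \<omega>\<^sub>0' w t\<^sub>0" and T: "0 \<le> T"
    and conv: "\<And>t. T \<le> t \<Longrightarrow> eP t = 0 \<and> ev t = 0 \<and> ez t = 0"
  shows "\<exists>B. \<forall>t\<ge>0. \<forall>i. norm (P t $ i) \<le> B \<and> norm (v t $ i) \<le> B \<and> norm (z t $ i) \<le> B
                     \<and> norm (y t $ i) \<le> B \<and> norm (w t $ i) \<le> B"
proof -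
  note n = norm_le_sqrt3_if_infnorm_le
  have t0: "0 \<le> t\<^sub>0" using settled by (simp add: settled_from_def)
  note cont = solution_abs_cont[THEN abs_cont_on_imp_continuous_on]
  have "\<exists>B. \<forall>t\<ge>0. \<forall>i. norm (P t $ i) \<le> B"
    by (rule bounded_after_continuous[OF cont(1)[OF T], where C = 1])
       (use conv T leader_attitude(1) in \<open>auto simp: err_eq_0_iff\<close>)
  moreover have "\<exists>B. \<forall>t\<ge>0. \<forall>i. norm (v t $ i) \<le> B"
    by (rule bounded_after_continuous[OF cont(2)[OF T], where C = "sqrt 3 * \<gamma>\<^sub>1"])
       (use conv T leader_bounds(1) n in \<open>auto simp: err_eq_0_iff\<close>)
  moreover have "\<exists>B. \<forall>t\<ge>0. \<forall>i. norm (z t $ i) \<le> B"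
    by (rule bounded_after_continuous[OF cont(3)[OF T], where C = "sqrt 3 * \<gamma>\<^sub>2"])
       (use conv T leader_bounds(2) n in \<open>auto simp: err_eq_0_iff\<close>)
  moreover have "\<exists>B. \<forall>t\<ge>0. \<forall>i. norm (y t $ i) \<le> B"
  proof (rule bounded_after_continuous[OF cont(4)[OF t0]])
    fix t i assume t: "t\<^sub>0 \<le> t"
    show "norm (y t $ i) \<le> (\<Sum>j\<in>UNIV. norm (y t\<^sub>0 $ j - \<omega>\<^sub>0 t\<^sub>0)) + sqrt 3 * \<gamma>\<^sub>1"
    proof (cases "a\<^sub>0 $ i = 1")
      case True
      have "norm (y t $ i) \<le> norm (y t $ i - \<omega>\<^sub>0 t) + norm (\<omega>\<^sub>0 t)"
        using norm_triangle_ineq[of "y t $ i - \<omega>\<^sub>0 t" "\<omega>\<^sub>0 t"] by simp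
      moreover have "norm (y t $ i - \<omega>\<^sub>0 t) \<le> norm (y t\<^sub>0 $ i - \<omega>\<^sub>0 t\<^sub>0)"
        by (rule linked_error_nonincreasing[OF settled True t])
      moreover have "norm (y t\<^sub>0 $ i - \<omega>\<^sub>0 t\<^sub>0) \<le> (\<Sum>j\<in>UNIV. norm (y t\<^sub>0 $ j - \<omega>\<^sub>0 t\<^sub>0))"
        by (rule member_le_sum) auto
      moreover have "norm (\<omega>\<^sub>0 t) \<le> sqrt 3 * \<gamma>\<^sub>1" using n leader_bounds(1) t t0 by simp
      ultimately show ?thesis by linarith
    next
      case False
      then have "y t $ i = 0" using unlinked_rest(2)[of i t] leader_links t t0 by auto
      then show ?thesis using gamma_nonneg by (simp add: sum_nonneg)
    qed
  qed
  moreover have "\<exists>B. \<forall>t\<ge>0. \<forall>i. norm (w t $ i) \<le> B"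
  proof (rule bounded_after_continuous[OF cont(5)[OF t0]])
    fix t i assume t: "t\<^sub>0 \<le> t"
    show "norm (w t $ i) \<le> sqrt 3 * \<gamma>\<^sub>2"
    proof (cases "a\<^sub>0 $ i = 1")
      case True
      then show ?thesis using settled t t0 n leader_bounds(2) by (simp add: settled_from_def)
    next
      case False
      then have "w t $ i = 0" using unlinked_rest(1)[of i t] leader_links t t0 by auto
      then show ?thesis using gamma_nonneg by simp
    qed
  qed
  ultimately obtain B1 B2 B3 B4 B5 where
    "\<forall>t\<ge>0. \<forall>i. norm (P t $ i) \<le> B1" "\<forall>t\<ge>0. \<forall>i. norm (v t $ i) \<le> B2" "\<forall>t\<ge>0. \<forall>i. norm (z t $ i) \<le> B3"
    "\<forall>t\<ge>0. \<forall>i. norm (y t $ i) \<le> B4" "\<forall>t\<ge>0. \<forall>i. norm (w t $ i) \<le> B5" by (elim exE) (rule that)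
  then show ?thesis
    by (intro exI[of _ "max B1 (max B2 (max B3 (max B4 B5)))"]) (simp add: le_max_iff_disj)
qed

text \<open>
  This covers the one case in which the leader bound leaves no slack for the transient.
\<close>

lemma settled_from_0:
  assumes "\<gamma>\<^sub>1 = 0"
  shows "settled_from a\<^sub>0 \<omega>\<^sub>0' w 0"
proof -
  have \<omega>: "\<omega>\<^sub>0 t = 0" if "0 \<le> t" for t
    using leader_bounds(1) that assms infnorm_pos_le[of "\<omega>\<^sub>0 t"] infnorm_eq_0[of "\<omega>\<^sub>0 t"] by (metis order_antisym)
  have "\<omega>\<^sub>0' t = 0" if "0 \<le> t" for t
  proof (rule vector_derivative_unique_within)
    show "(\<omega>\<^sub>0 has_vector_derivative \<omega>\<^sub>0' t) (at t within {0..})" using leader_velocity(1) that by blast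
    show "(\<omega>\<^sub>0 has_vector_derivative 0) (at t within {0..})"
      using has_vector_derivative_const by (rule has_vector_derivative_transform[rotated 2]) (use that \<omega> in auto)
    show "at t within {0..} \<noteq> bot"
      using that islimpt_greaterThanLessThan1[of t "t + 1"] unfolding trivial_limit_within
      by (auto elim: islimpt_subset)
  qed
  then show ?thesis using super_twisting_rest \<omega> by (simp add: settled_from_def)
qed

end

theorem mainTheorem1:
  fixes A :: "real ^ 'n ^ 'n" and a\<^sub>0 :: "real ^ 'n"
    and Q\<^sub>0 :: "real \<Rightarrow> real ^ 4" and \<omega>\<^sub>0 \<omega>\<^sub>0' \<omega>\<^sub>0'' :: "real \<Rightarrow> real ^ 3"
    and y w :: "real \<Rightarrow> real ^ 3 ^ 'n"
    and l\<^sub>1 l\<^sub>2 l\<^sub>3 \<beta>\<^sub>1 \<beta>\<^sub>2 \<mu>\<^sub>1 \<mu>\<^sub>2 \<gamma>\<^sub>1 \<gamma>\<^sub>2 \<gamma>\<^sub>3 :: real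
  assumes gains: "l\<^sub>1 > 0" "l\<^sub>2 > 0" "\<mu>\<^sub>1 > 0" "l\<^sub>3 > \<gamma>\<^sub>3" "\<mu>\<^sub>2 > \<gamma>\<^sub>3"
    and exponents: "0 < \<beta>\<^sub>1" "\<beta>\<^sub>1 < 1" "0 < \<beta>\<^sub>2" "\<beta>\<^sub>2 < 1"
    and followers: "undirected_weights A"
    and leader_links: "\<forall>i. a\<^sub>0 $ i = 0 \<or> a\<^sub>0 $ i = 1"
    and spanning: "spanned_from_leader A a\<^sub>0"
    and leader_attitude: "\<forall>t\<ge>0. Q\<^sub>0 t \<in> sphere 0 1"
      "\<forall>t\<ge>0. (Q\<^sub>0 has_vector_derivative (1/2) *\<^sub>R qmult (Q\<^sub>0 t) (pure_quat (\<omega>\<^sub>0 t)))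
                (at t within {0..})"
    and leader_velocity: "\<forall>t\<ge>0. (\<omega>\<^sub>0 has_vector_derivative \<omega>\<^sub>0' t) (at t within {0..})"
      "\<forall>t\<ge>0. (\<omega>\<^sub>0' has_vector_derivative \<omega>\<^sub>0'' t) (at t within {0..})"
      "continuous_on {0..} \<omega>\<^sub>0''"
    and leader_bounds: "\<forall>t\<ge>0. infnorm (\<omega>\<^sub>0 t) \<le> \<gamma>\<^sub>1" "\<forall>t\<ge>0. infnorm (\<omega>\<^sub>0' t) \<le> \<gamma>\<^sub>2"
      "\<forall>t\<ge>0. infnorm (\<omega>\<^sub>0'' t) \<le> \<gamma>\<^sub>3"
    and initial: "y 0 = 0" "w 0 = 0"
    and finite_t_r: "\<exists>t. settled_from a\<^sub>0 \<omega>\<^sub>0' w t"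
  shows "\<exists>t\<^sub>r. settled_from a\<^sub>0 \<omega>\<^sub>0' w t\<^sub>r \<and>
    (\<forall>P v z.
      filippov_solution (observer_field A a\<^sub>0 l\<^sub>1 l\<^sub>2 l\<^sub>3 \<beta>\<^sub>1 \<beta>\<^sub>2 \<mu>\<^sub>1 \<mu>\<^sub>2 Q\<^sub>0 \<omega>\<^sub>0)
        (\<lambda>t. (P t, v t, z t, y t, w t)) \<longrightarrow>
      (let H = Hmat A a\<^sub>0;
           Vz0 = V_fun H (err (z 0) (\<omega>\<^sub>0' 0));
           Vv0 = V_fun H (err (v 0) (\<omega>\<^sub>0 0));
           Vp0 = V_fun H (err (P 0) (Q\<^sub>0 0));
           Tz = T_z H l\<^sub>3 \<gamma>\<^sub>3 t\<^sub>r Vz0;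
           Gz = Gamma_v H Vz0 Vv0 Tz;
           g = gamma_v H \<gamma>\<^sub>1 Gz
       in (\<exists>B. \<forall>t\<ge>0. \<forall>i. norm (P t $ i) \<le> B \<and> norm (v t $ i) \<le> B \<and> norm (z t $ i) \<le> B
                     \<and> norm (y t $ i) \<le> B \<and> norm (w t $ i) \<le> B) \<and>
          (\<exists>Tv. is_T_v H l\<^sub>2 \<beta>\<^sub>2 \<omega>\<^sub>0 v Tz Gz Tv) \<and>
          (\<forall>Tv. is_T_v H l\<^sub>2 \<beta>\<^sub>2 \<omega>\<^sub>0 v Tz Gz Tv \<longrightarrow>
            (\<exists>Tp\<ge>0. Tp \<le> T_p_bound H l\<^sub>1 \<beta>\<^sub>1 g Vp0 Tv \<and>
              (\<forall>t\<ge>Tp. \<forall>i. P t $ i = Q\<^sub>0 t \<and> v t $ i = \<omega>\<^sub>0 t \<and> z t $ i = \<omega>\<^sub>0' t)))))"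
proof -
  interpret observer_network A a\<^sub>0 Q\<^sub>0 \<omega>\<^sub>0 \<omega>\<^sub>0' \<omega>\<^sub>0'' y w l\<^sub>1 l\<^sub>2 l\<^sub>3 \<beta>\<^sub>1 \<beta>\<^sub>2 \<mu>\<^sub>1 \<mu>\<^sub>2 \<gamma>\<^sub>1 \<gamma>\<^sub>2 \<gamma>\<^sub>3
    using assms by unfold_locales auto
  let ?sol = "\<lambda>P v z. filippov_solution (observer_field A a\<^sub>0 l\<^sub>1 l\<^sub>2 l\<^sub>3 \<beta>\<^sub>1 \<beta>\<^sub>2 \<mu>\<^sub>1 \<mu>\<^sub>2 Q\<^sub>0 \<omega>\<^sub>0) (\<lambda>t. (P t, v t, z t, y t, w t))"
  have sol: "observer_solution A a\<^sub>0 Q\<^sub>0 \<omega>\<^sub>0 \<omega>\<^sub>0' \<omega>\<^sub>0'' y w l\<^sub>1 l\<^sub>2 l\<^sub>3 \<beta>\<^sub>1 \<beta>\<^sub>2 \<mu>\<^sub>1 \<mu>\<^sub>2 \<gamma>\<^sub>1 \<gamma>\<^sub>2 \<gamma>\<^sub>3 P v z"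
    if "?sol P v z" for P v z
    using that by (intro observer_solution.intro observer_solution_axioms.intro observer_network_axioms)
  show ?thesis
  \<comment> \<open>That w is settled from the start if gamma_1 = 0 is a property of y and w, but it is obtained from
    the observer equations, so that some solution has to be available.\<close>
  proof (cases "\<exists>P v z. ?sol P v z")
    case False
    then show ?thesis using finite_t_r by blast
  next
    case True
    then obtain P\<^sub>1 v\<^sub>1 z\<^sub>1 where "?sol P\<^sub>1 v\<^sub>1 z\<^sub>1" by blast
    note rest = observer_solution.settled_from_0[OF sol[OF this]]
    obtain t\<^sub>0 where t0: "settled_from a\<^sub>0 \<omega>\<^sub>0' w t\<^sub>0" "\<gamma>\<^sub>1 = 0 \<Longrightarrow> t\<^sub>0 = 0"
      using finite_t_r rest by (cases "\<gamma>\<^sub>1 = 0") auto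
    obtain t\<^sub>r where tr: "t\<^sub>0 \<le> t\<^sub>r" "sufficient_delay t\<^sub>0 t\<^sub>r"
      using sufficient_delay_exists[of t\<^sub>0] t0(2) by blast
    have "settled_from a\<^sub>0 \<omega>\<^sub>0' w t\<^sub>r" using t0(1) tr(1) by (auto simp: settled_from_def)
    then show ?thesis
    proof (intro exI[of _ t\<^sub>r] conjI allI impI)
      fix P v z assume "?sol P v z"
      then interpret observer_solution A a\<^sub>0 Q\<^sub>0 \<omega>\<^sub>0 \<omega>\<^sub>0' \<omega>\<^sub>0'' y w l\<^sub>1 l\<^sub>2 l\<^sub>3 \<beta>\<^sub>1 \<beta>\<^sub>2 \<mu>\<^sub>1 \<mu>\<^sub>2 \<gamma>\<^sub>1 \<gamma>\<^sub>2 \<gamma>\<^sub>3 P v z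
        by (rule sol)
      note c = convergence[OF t0(1) tr(2)]
      obtain Tv where "is_T_v H l\<^sub>2 \<beta>\<^sub>2 \<omega>\<^sub>0 v (T_z H l\<^sub>3 \<gamma>\<^sub>3 t\<^sub>r (Vz 0)) (Gamma_v H (Vz 0) (Vv 0) (T_z H l\<^sub>3 \<gamma>\<^sub>3 t\<^sub>r (Vz 0))) Tv"
        using c(1) by blast
      note bd = states_bounded[OF t0(1) conjunct1[OF c(2)[OF this]] conjunct2[OF c(2)[OF this], rule_format]]
      show "let H = Hmat A a\<^sub>0;
           Vz0 = V_fun H (err (z 0) (\<omega>\<^sub>0' 0));
           Vv0 = V_fun H (err (v 0) (\<omega>\<^sub>0 0));
           Vp0 = V_fun H (err (P 0) (Q\<^sub>0 0));
           Tz = T_z H l\<^sub>3 \<gamma>\<^sub>3 t\<^sub>r Vz0;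
           Gz = Gamma_v H Vz0 Vv0 Tz;
           g = gamma_v H \<gamma>\<^sub>1 Gz
       in (\<exists>B. \<forall>t\<ge>0. \<forall>i. norm (P t $ i) \<le> B \<and> norm (v t $ i) \<le> B \<and> norm (z t $ i) \<le> B
                     \<and> norm (y t $ i) \<le> B \<and> norm (w t $ i) \<le> B) \<and>
          (\<exists>Tv. is_T_v H l\<^sub>2 \<beta>\<^sub>2 \<omega>\<^sub>0 v Tz Gz Tv) \<and>
          (\<forall>Tv. is_T_v H l\<^sub>2 \<beta>\<^sub>2 \<omega>\<^sub>0 v Tz Gz Tv \<longrightarrow>
            (\<exists>Tp\<ge>0. Tp \<le> T_p_bound H l\<^sub>1 \<beta>\<^sub>1 g Vp0 Tv \<and>
              (\<forall>t\<ge>Tp. \<forall>i. P t $ i = Q\<^sub>0 t \<and> v t $ i = \<omega>\<^sub>0 t \<and> z t $ i = \<omega>\<^sub>0' t)))"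
        unfolding Let_def V_fun_energy[OF H_coercive]
      proof (intro conjI bd c(1) allI impI)
        fix Tv assume "is_T_v H l\<^sub>2 \<beta>\<^sub>2 \<omega>\<^sub>0 v (T_z H l\<^sub>3 \<gamma>\<^sub>3 t\<^sub>r (Vz 0)) (Gamma_v H (Vz 0) (Vv 0) (T_z H l\<^sub>3 \<gamma>\<^sub>3 t\<^sub>r (Vz 0))) Tv"
        from c(2)[OF this]
        show "\<exists>Tp\<ge>0. Tp \<le> T_p_bound H l\<^sub>1 \<beta>\<^sub>1 (gamma_v H \<gamma>\<^sub>1 (Gamma_v H (Vz 0) (Vv 0) (T_z H l\<^sub>3 \<gamma>\<^sub>3 t\<^sub>r (Vz 0)))) (VP 0) Tv \<and>
              (\<forall>t\<ge>Tp. \<forall>i. P t $ i = Q\<^sub>0 t \<and> v t $ i = \<omega>\<^sub>0 t \<and> z t $ i = \<omega>\<^sub>0' t)"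
          by (auto simp: err_eq_0_iff)
      qed
    qed
  qed
qed

end
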